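(* Let $G$ be a second countable compact abelian group and let $A:G\to G$ be a continuous surjective group homomorphism such that $\ker A$ is finite and $\bigcup_{j\in\mathbb{N}_0}\ker A^j$ is dense in $G$. Let $1\le p<\infty$. Functions $(\varphi_j)_{j\in\mathbb{N}_0}\subset L^p(G)$ form a scaling sequence for an MRA of $L^p(G)$ if and only if all of the following hold: (1) $\widehat{\varphi}_0(\chi)=0$ for all $\chi\in\widehat{G}$ with $\chi\neq \mathbf{0}$. (2) For any $j\in\mathbb{N}_0$ and any $\eta\in\widehat{G}$, there exists $\chi\in(\ker A^j)^{\perp}+\eta$ such that $\widehat{\varphi}_j(\chi)\neq 0$. (3) For any $\chi\in\widehat{G}$, there exists $j\in\mathbb{N}_0$ such that $\widehat{\varphi}_j(\chi)\neq 0$. (4) For any $j\in\mathbb{N}$ and any $\eta\in\widehat{G}$, there exists a number $\mu^j_{\eta}\in\mathbb{C}$ such that $\widehat{\varphi}_{j-1}(\chi)=\mu^j_{\eta}\,\widehat{\varphi}_j(\chi)$ for all $\chi\in(\ker A^j)^{\perp}+\eta$. (5) For any $j\in\mathbb{N}_0$ and any $\eta\in\widehat{G}$, there exists a number $\gamma^j_{\eta}\in\mathbb{C}$, $\gamma^j_\eta\neq 0$, such that $\widehat{\varphi}_{j+1}(\widehat{A}(\chi))=\gamma^j_{\eta}\,\widehat{\varphi}_j(\chi)$ for all $\chi\in(\ker A^j)^{\perp}+\eta$.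
   Context: $\mathbb{N}=\{1,2,\ldots\}$, $\mathbb{N}_0=\{0,1,2,\ldots\}$, and $A^0$ is the identity map. $\widehat{G}$ is the (discrete) dual group of continuous characters of $G$, written additively, $(\chi_1+\chi_2)(x)=\chi_1(x)\chi_2(x)$, with identity $\mathbf{0}$ (the trivial character). For a subgroup $H\subset G$, $H^{\perp}=\{\chi\in\widehat{G}:\chi(h)=1\text{ for all }h\in H\}$. $dx$ is Haar measure on $G$ normalized to total mass $1$, $L^p(G)$ consists of complex-valued functions, and $\widehat{f}(\chi)=\int_G f(x)\overline{\chi(x)}\,dx$ for $f\in L^1(G)$. The adjoint homomorphism $\widehat{A}:\widehat{G}\to\widehat{G}$ is $\widehat{A}(\chi)=\chi\circ A$. Translation: $T_yf(x)=f(x-y)$, $y\in G$. Periodization: $Pf(x)=\sum_{a\in\ker A}f(y+a)$, where $y\in G$ is any element with $Ay=x$. A multiresolution analysis (MRA) of $L^p(G)$ (associated with $(G,A)$) is a sequence $(V_j)_{j\in\mathbb{N}_0}$ of closed subspaces of $L^p(G)$ such that: MR1. $V_j\subset V_{j+1}$ for all $j\in\mathbb{N}_0$; MR2. $\overline{\bigcup_{j=0}^\infty V_j}=L^p(G)$; MR3. for all $j\in\mathbb{N}_0$ and $\gamma\in\ker A^j$, $f\in V_j$ if and only if $T_\gamma f\in V_j$; MR4. for each $j\in\mathbb{N}_0$ there exists $\varphi_j\in V_j$ such that $(T_a\varphi_j)_{a\in\ker A^j}$ is a basis of $V_j$; MR5. for all $j\in\mathbb{N}_0$: a) $f\in V_j\Rightarrow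 f(A(\cdot))\in V_{j+1}$, and b) $f\in V_{j+1}\Rightarrow Pf\in V_j$. A sequence $(\varphi_j)_{j\in\mathbb{N}_0}$ as in MR4 is called a scaling sequence of the MRA $(V_j)$. *)

theory Defs
  imports "HOL-Probability.Probability"
begin

section \<open>The group, its endomorphism and its Haar measure\<close>

text \<open>
  A second countable compact (Hausdorff) abelian group is a type of sort
  \<open>{topological_ab_group_add, second_countable_topology, t2_space}\<close> whose universe is compact.
\<close>

definition group_hom_add :: "('a::ab_group_add \<Rightarrow> 'a) \<Rightarrow> bool" where
  "group_hom_add A \<longleftrightarrow> (\<forall>x y. A (x + y) = A x + A y)"

definition ker :: "('a::ab_group_add \<Rightarrow> 'a) \<Rightarrow> 'a set" where
  "ker A = {x. A x = 0}"

text \<open>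
  Normalized Haar measure: the translation invariant Borel probability measure. Regularity is
  automatic for finite Borel measures on a compact Hausdorff second countable space, so it is not
  listed.
\<close>

definition normalized_haar :: "'a::topological_ab_group_add measure \<Rightarrow> bool" where
  "normalized_haar M \<longleftrightarrow>
     prob_space M \<and> sets M = sets borel \<and>
     (\<forall>a. \<forall>B\<in>sets borel. emeasure M ((\<lambda>x. a + x) ` B) = emeasure M B)"


section \<open>The dual group and Fourier coefficients\<close>

definition dual_group :: "('a::topological_ab_group_add \<Rightarrow> complex) set" where
  "dual_group = {\<xi>. continuous_on UNIV \<xi> \<and> (\<forall>x. norm (\<xi> x) = 1) \<and>
                     (\<forall>x y. \<xi> (x + y) = \<xi> x * \<xi> y)}"

definition char_zero :: "'a \<Rightarrow> complex" where
  "char_zero = (\<lambda>x. 1)"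

definition char_add :: "('a \<Rightarrow> complex) \<Rightarrow> ('a \<Rightarrow> complex) \<Rightarrow> 'a \<Rightarrow> complex" where
  "char_add \<xi> \<eta> = (\<lambda>x. \<xi> x * \<eta> x)"

definition annihilator :: "'a::topological_ab_group_add set \<Rightarrow> ('a \<Rightarrow> complex) set" where
  "annihilator H = {\<xi>\<in>dual_group. \<forall>h\<in>H. \<xi> h = 1}"

definition char_coset :: "('a \<Rightarrow> complex) set \<Rightarrow> ('a \<Rightarrow> complex) \<Rightarrow> ('a \<Rightarrow> complex) set" where
  "char_coset K \<eta> = (\<lambda>\<xi>. char_add \<xi> \<eta>) ` K"

definition adjoint_hom :: "('a \<Rightarrow> 'a) \<Rightarrow> ('a \<Rightarrow> complex) \<Rightarrow> 'a \<Rightarrow> complex" where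
  "adjoint_hom A \<xi> = \<xi> \<circ> A"

definition fourier :: "'a measure \<Rightarrow> ('a \<Rightarrow> complex) \<Rightarrow> ('a \<Rightarrow> complex) \<Rightarrow> complex" where
  "fourier M f \<xi> = (LINT x|M. f x * cnj (\<xi> x))"


section \<open>The space \<open>L\<^sup>p(G)\<close>\<close>

text \<open>
  Elements of \<open>L\<^sup>p\<close> are represented by functions. Identification almost everywhere enters through
  the seminorm: a set of representatives that is closed for the seminorm contains, with every
  function, all functions equal to it almost everywhere, so closed subspaces in the sense below
  correspond one-to-one to closed subspaces of the quotient space. Membership of concrete
  functions in such sets is therefore independent of representatives.
\<close>

definition Lp :: "'a measure \<Rightarrow> real \<Rightarrow> ('a \<Rightarrow> complex) set" where
  "Lp M p = {f\<in>borel_measurable M. integrable M (\<lambda>x. norm (f x) powr p)}"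

definition Lp_norm :: "'a measure \<Rightarrow> real \<Rightarrow> ('a \<Rightarrow> complex) \<Rightarrow> real" where
  "Lp_norm M p f = (LINT x|M. norm (f x) powr p) powr (1 / p)"

definition Lp_closure :: "'a measure \<Rightarrow> real \<Rightarrow> ('a \<Rightarrow> complex) set \<Rightarrow> ('a \<Rightarrow> complex) set" where
  "Lp_closure M p S = {f\<in>Lp M p. \<forall>e>0. \<exists>g\<in>S. Lp_norm M p (\<lambda>x. f x - g x) < e}"

definition closed_subspace :: "'a measure \<Rightarrow> real \<Rightarrow> ('a \<Rightarrow> complex) set \<Rightarrow> bool" where
  "closed_subspace M p V \<longleftrightarrow>
     V \<subseteq> Lp M p \<and>
     (\<lambda>x. 0) \<in> V \<and>
     (\<forall>f\<in>V. \<forall>g\<in>V. (\<lambda>x. f x + g x) \<in> V) \<and>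
     (\<forall>c. \<forall>f\<in>V. (\<lambda>x. c * f x) \<in> V) \<and>
     Lp_closure M p V = V"

text \<open>
  The finite indexed family \<open>(b i)\<close>, \<open>i \<in> I\<close>, is a basis of \<open>V\<close>, vectors being taken modulo
  equality almost everywhere. Only finite index sets occur, by \<open>finite_ker_funpow\<close> below.
\<close>

definition is_basis ::
    "'a measure \<Rightarrow> 'i set \<Rightarrow> ('i \<Rightarrow> 'a \<Rightarrow> complex) \<Rightarrow> ('a \<Rightarrow> complex) set \<Rightarrow> bool" where
  "is_basis M I b V \<longleftrightarrow>
     (\<forall>i\<in>I. b i \<in> V) \<and>
     (\<forall>c. (AE x in M. (\<Sum>i\<in>I. c i * b i x) = 0) \<longrightarrow> (\<forall>i\<in>I. c i = 0)) \<and>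
     (\<forall>f\<in>V. \<exists>c. AE x in M. f x = (\<Sum>i\<in>I. c i * b i x))"


section \<open>Multiresolution analyses\<close>

definition translate :: "'a::ab_group_add \<Rightarrow> ('a \<Rightarrow> complex) \<Rightarrow> 'a \<Rightarrow> complex" where
  "translate y f = (\<lambda>x. f (x - y))"

text \<open>The sum does not depend on the chosen preimage, see \<open>periodization_eq\<close> below.\<close>

definition periodization ::
    "('a::ab_group_add \<Rightarrow> 'a) \<Rightarrow> ('a \<Rightarrow> complex) \<Rightarrow> 'a \<Rightarrow> complex" where
  "periodization A f = (\<lambda>x. \<Sum>a\<in>ker A. f ((SOME y. A y = x) + a))"

definition scaling_sequence ::
    "'a::topological_ab_group_add measure \<Rightarrow> ('a \<Rightarrow> 'a) \<Rightarrow> (nat \<Rightarrow> ('a \<Rightarrow> complex) set) \<Rightarrow>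
     (nat \<Rightarrow> 'a \<Rightarrow> complex) \<Rightarrow> bool" where
  "scaling_sequence M A V \<phi> \<longleftrightarrow>
     (\<forall>j. \<phi> j \<in> V j \<and> is_basis M (ker (A ^^ j)) (\<lambda>a. translate a (\<phi> j)) (V j))"

definition MRA ::
    "'a::topological_ab_group_add measure \<Rightarrow> real \<Rightarrow> ('a \<Rightarrow> 'a) \<Rightarrow>
     (nat \<Rightarrow> ('a \<Rightarrow> complex) set) \<Rightarrow> bool" where
  "MRA M p A V \<longleftrightarrow>
     (\<forall>j. closed_subspace M p (V j)) \<and>
     (\<forall>j. V j \<subseteq> V (j + 1)) \<and>
     Lp_closure M p (\<Union>j. V j) = Lp M p \<and>
     (\<forall>j. \<forall>\<gamma>\<in>ker (A ^^ j). \<forall>f\<in>Lp M p. f \<in> V j \<longleftrightarrow> translate \<gamma> f \<in> V j) \<and>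
     (\<forall>j. \<exists>\<psi>\<in>V j. is_basis M (ker (A ^^ j)) (\<lambda>a. translate a \<psi>) (V j)) \<and>
     (\<forall>j. \<forall>f\<in>V j. (\<lambda>x. f (A x)) \<in> V (j + 1)) \<and>
     (\<forall>j. \<forall>f\<in>V (j + 1). periodization A f \<in> V j)"


section \<open>Well-definedness\<close>

lemma periodization_eq:
  assumes A: "group_hom_add A" and y: "A y = x"
  shows "periodization A f x = (\<Sum>a\<in>ker A. f (y + a))"
proof -
  define z where "z = (SOME y. A y = x)"
  have z: "A z = x"
    unfolding z_def using y by (rule someI)
  have add: "A (u + v) = A u + A v" for u v
    using A by (simp add: group_hom_add_def)
  have diff: "A (u - v) = A u - A v" for u v
    using add[of "u - v" v] by (simp add: algebra_simps)
  have "(\<Sum>a\<in>ker A. f (z + a)) = (\<Sum>a\<in>ker A. f (y + a))"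
    by (rule sum.reindex_bij_witness[where i = "\<lambda>a. a + (y - z)" and j = "\<lambda>a. a + (z - y)"])
       (auto simp: ker_def add diff y z algebra_simps)
  then show ?thesis
    by (simp add: periodization_def z_def)
qed

lemma finite_ker_funpow:
  assumes A: "group_hom_add A" and fin: "finite (ker A)"
  shows "finite (ker (A ^^ j))"
proof (induction j)
  case 0
  show ?case by (simp add: ker_def)
next
  case (Suc j)
  have add: "A (u + v) = A u + A v" for u v
    using A by (simp add: group_hom_add_def)
  have diff: "A (u - v) = A u - A v" for u v
    using add[of "u - v" v] by (simp add: algebra_simps)
  have fib: "finite (A -` {k})" for k
  proof (cases "\<exists>z. A z = k")
    case True
    then obtain z where z: "A z = k" by blast
    have "A -` {k} \<subseteq> (\<lambda>a. z + a) ` ker A"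
    proof
      fix y assume "y \<in> A -` {k}"
      then have "y - z \<in> ker A" by (simp add: ker_def diff z)
      then show "y \<in> (\<lambda>a. z + a) ` ker A" by (rule rev_image_eqI) simp
    qed
    then show ?thesis using fin finite_subset by blast
  next
    case False
    then have "A -` {k} = {}" by blast
    then show ?thesis by simp
  qed
  have "ker (A ^^ Suc j) = (\<Union>k\<in>ker (A ^^ j). A -` {k})"
    by (auto simp: ker_def funpow_swap1)
  then show ?case using Suc fib by (simp only: finite_UN_I)
qed

end

theory Submission
  imports Defs
begin

text \<open>
  Everything is read off from Fourier coefficients. Write \<open>K j\<close> for the kernel of \<open>A ^^ j\<close>, a finite
  group, so that two characters lie in the same coset of the annihilator of \<open>K j\<close> exactly if they
  agree on \<open>K j\<close>. A translation by \<open>a\<close> multiplies the coefficient at \<open>\<xi>\<close> by \<open>cnj (\<xi> a)\<close>. Hence a linear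
  combination of the translates of \<open>\<phi> j\<close> by elements of \<open>K j\<close> multiplies the coefficients of \<open>\<phi> j\<close> by a
  factor that is constant on cosets, and by Fourier inversion on the finite group \<open>K j\<close> every such
  factor occurs. So the span of the translates is the space \<open>mult_space j\<close> of all \<open>f\<close> in \<open>L\<^sup>p\<close> whose
  coefficients are, on each coset, a multiple of those of \<open>\<phi> j\<close> (\<open>translates_span\<close>), and the translates
  are independent exactly if \<open>\<phi> j\<close> has a nonzero coefficient on each coset.

  From a scaling sequence to the coefficient conditions: the inclusion of \<open>\<phi> j\<close> in the next space is
  the refinement relation, the inclusion of its dilate is the dilation relation, and density of the
  union prevents all \<open>\<phi> j\<close> from vanishing at the same character. The vanishing of the coefficients of
  \<open>\<phi> 0\<close> away from the trivial character is less direct (\<open>level_zero_constant\<close>): refinement and dilation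
  make these coefficients invariant under the adjoint of \<open>A\<close>; a nontrivial character has an infinite
  orbit, as the kernels are dense, and the Riemann--Lebesgue lemma applies.

  From the conditions to a multiresolution analysis: the spaces \<open>mult_space j\<close> are defined by linear
  equations between Fourier coefficients, which makes them closed, and refinement and dilation
  translate into nestedness and the two dilation axioms. For density, the average of the translates
  \<open>\<xi> a * T\<^sub>a f\<close> over \<open>a \<in> K k\<close> keeps only the coefficients of \<open>f\<close> on the coset of \<open>\<xi>\<close>, so for growing \<open>k\<close> it
  converges to the component of \<open>f\<close> at \<open>\<xi>\<close> (\<open>char_average_tendsto\<close>); applied to a \<open>\<phi> j\<close> that does not
  vanish at \<open>\<xi>\<close> this places every character in the closure of the union
  (\<open>char_in_limit_space\<close>).

  All of this rests on the facts that the dual group separates the points of \<open>G\<close>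
  (\<open>dual_group_separates\<close>), that trigonometric polynomials are dense in \<open>L\<^sup>p\<close> (\<open>trig_poly_dense\<close>), and that
  Fourier coefficients determine an integrable function (\<open>fourier_unique\<close>). Separation is obtained
  from the dense chain of finite subgroups: Plancherel on a finite subgroup yields characters with a
  large coefficient at a fixed continuous function, such characters are equicontinuous, and a
  compactness argument passes to the limit along the chain. The other two facts follow from
  Stone--Weierstrass.
\<close>

section \<open>Characters of finite subgroups\<close>

definition add_subgroup :: "'a::ab_group_add set \<Rightarrow> bool" where
  "add_subgroup K \<longleftrightarrow> 0 \<in> K \<and> (\<forall>x\<in>K. \<forall>y\<in>K. x - y \<in> K)"

lemma add_subgroup_zero: "add_subgroup K \<Longrightarrow> 0 \<in> K"
  and add_subgroup_diff: "add_subgroup K \<Longrightarrow> x \<in> K \<Longrightarrow> y \<in> K \<Longrightarrow> x - y \<in> K"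
  by (auto simp: add_subgroup_def)

lemma add_subgroup_uminus: "add_subgroup K \<Longrightarrow> x \<in> K \<Longrightarrow> - x \<in> K"
  using add_subgroup_diff[of K 0 x] by (simp add: add_subgroup_zero)

lemma add_subgroup_add: "add_subgroup K \<Longrightarrow> x \<in> K \<Longrightarrow> y \<in> K \<Longrightarrow> x + y \<in> K"
  using add_subgroup_diff[of K x "- y"] by (simp add: add_subgroup_uminus)

text \<open>
  Characters of a subgroup are extended by zero, so that a character is determined by its
  restriction to the subgroup and a finite subgroup has finitely many of them.
\<close>

definition subgroup_chars :: "'a::ab_group_add set \<Rightarrow> ('a \<Rightarrow> complex) set" where
  "subgroup_chars K = {\<xi>. (\<forall>x\<in>K. norm (\<xi> x) = 1) \<and> (\<forall>x\<in>K. \<forall>y\<in>K. \<xi> (x + y) = \<xi> x * \<xi> y) \<and>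
                            (\<forall>x. x \<notin> K \<longrightarrow> \<xi> x = 0)}"

lemma subgroup_charsD:
  assumes "\<xi> \<in> subgroup_chars K"
  shows "x \<in> K \<Longrightarrow> norm (\<xi> x) = 1" "x \<in> K \<Longrightarrow> y \<in> K \<Longrightarrow> \<xi> (x + y) = \<xi> x * \<xi> y"
    "x \<notin> K \<Longrightarrow> \<xi> x = 0"
  using assms by (auto simp: subgroup_chars_def)

lemma subgroup_char_zero:
  assumes "\<xi> \<in> subgroup_chars K" "add_subgroup K" shows "\<xi> 0 = 1"
proof -
  have "\<xi> (0 + 0) = \<xi> 0 * \<xi> 0" "norm (\<xi> 0) = 1"
    using assms subgroup_charsD add_subgroup_zero by metis+
  then show ?thesis by auto
qed

lemma subgroup_char_uminus:
  assumes "\<xi> \<in> subgroup_chars K" "add_subgroup K" "x \<in> K" shows "\<xi> (- x) = cnj (\<xi> x)"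
proof -
  have "\<xi> (x + - x) = \<xi> x * \<xi> (- x)"
    using assms subgroup_charsD(2) add_subgroup_uminus by metis
  then have "\<xi> x * \<xi> (- x) = 1" using subgroup_char_zero[OF assms(1,2)] by simp
  moreover have "\<xi> x * cnj (\<xi> x) = 1"
    using subgroup_charsD(1)[OF assms(1,3)] by (simp add: complex_norm_square[symmetric])
  ultimately show ?thesis
    by (metis mult_cancel_left mult_zero_left zero_neq_one)
qed

lemma subgroup_char_diff:
  assumes "\<xi> \<in> subgroup_chars K" "add_subgroup K" "x \<in> K" "y \<in> K"
  shows "\<xi> (x - y) = \<xi> x * cnj (\<xi> y)"
  using subgroup_charsD(2)[OF assms(1), of x "- y"] assms
  by (simp add: add_subgroup_uminus subgroup_char_uminus)

lemma sum_subgroup_translate: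
  assumes "add_subgroup K" "a \<in> K"
  shows "(\<Sum>x\<in>K. f (x + a)) = (\<Sum>x\<in>K. f x)"
  by (rule sum.reindex_bij_witness[where i = "\<lambda>x. x - a" and j = "\<lambda>x. x + a"])
     (use assms in \<open>auto simp: add_subgroup_add add_subgroup_diff\<close>)

lemma prod_subgroup_translate:
  assumes "add_subgroup K" "a \<in> K"
  shows "(\<Prod>x\<in>K. f (x + a)) = (\<Prod>x\<in>K. f x)"
  by (rule prod.reindex_bij_witness[where i = "\<lambda>x. x - a" and j = "\<lambda>x. x + a"])
     (use assms in \<open>auto simp: add_subgroup_add add_subgroup_diff\<close>)

text \<open>
  Translation by \<open>x\<close> permutes the factors of the product of \<open>\<xi>\<close> over the subgroup and multiplies the
  product by \<open>\<xi> x ^ card K\<close>.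
\<close>

lemma subgroup_char_root_of_unity:
  assumes "\<xi> \<in> subgroup_chars K" "add_subgroup K" "finite K" "x \<in> K"
  shows "\<xi> x ^ card K = 1"
proof -
  let ?P = "\<Prod>y\<in>K. \<xi> y"
  have "?P = (\<Prod>y\<in>K. \<xi> (y + x))" by (rule prod_subgroup_translate[OF assms(2,4), symmetric])
  also have "\<dots> = (\<Prod>y\<in>K. \<xi> y * \<xi> x)"
    by (rule prod.cong) (auto simp: subgroup_charsD(2)[OF assms(1)] assms(4))
  also have "\<dots> = ?P * \<xi> x ^ card K" by (simp add: prod.distrib)
  finally have "?P * \<xi> x ^ card K = ?P * 1" by simp
  moreover have "?P \<noteq> 0"
    using subgroup_charsD(1)[OF assms(1)] assms(3) by (auto simp: prod_zero_iff) (metis norm_zero zero_neq_one)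
  ultimately show ?thesis using mult_left_cancel by blast
qed

lemma finite_subgroup_chars:
  assumes K: "add_subgroup K" "finite K" shows "finite (subgroup_chars K)"
proof -
  have "card K > 0" using K add_subgroup_zero card_gt_0_iff by blast
  then have "finite {z::complex. z ^ card K = 1}" by (intro finite_roots_unity) simp
  then have "finite {\<xi>. \<forall>x. (x \<in> K \<longrightarrow> \<xi> x \<in> {z::complex. z ^ card K = 1}) \<and> (x \<notin> K \<longrightarrow> \<xi> x = 0)}"
    using K(2) by (rule finite_set_of_finite_funs[rotated])
  then show ?thesis
    by (rule finite_subset[rotated])
       (use K in \<open>auto simp: subgroup_char_root_of_unity dest: subgroup_charsD(3)\<close>)
qed

primrec nat_mult :: "nat \<Rightarrow> 'a::ab_group_add \<Rightarrow> 'a" where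
  "nat_mult 0 x = 0" | "nat_mult (Suc n) x = x + nat_mult n x"

lemma nat_mult_add: "nat_mult (m + n) x = nat_mult m x + nat_mult n x"
  by (induction m) (auto simp: algebra_simps)

lemma nat_mult_mem: "add_subgroup K \<Longrightarrow> x \<in> K \<Longrightarrow> nat_mult n x \<in> K"
  by (induction n) (auto simp: add_subgroup_zero add_subgroup_add)

lemma nat_mult_mult: "nat_mult (k * m) x = nat_mult k (nat_mult m x)"
  by (induction k) (auto simp: nat_mult_add)

lemma subgroup_char_nat_mult:
  assumes "\<xi> \<in> subgroup_chars K" "add_subgroup K" "x \<in> K"
  shows "\<xi> (nat_mult n x) = \<xi> x ^ n"
  by (induction n)
     (auto simp: subgroup_char_zero[OF assms(1,2)] subgroup_charsD(2)[OF assms(1)] nat_mult_mem assms)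

lemma nat_mult_eq_zero_ex:
  assumes "add_subgroup K" "finite K" "x \<in> K"
  obtains m where "m > 0" "nat_mult m x = 0"
proof -
  have "range (\<lambda>n. nat_mult n x) \<subseteq> K" using nat_mult_mem[OF assms(1,3)] by auto
  then have "\<not> inj (\<lambda>n::nat. nat_mult n x)"
    using assms(2) finite_subset infinite_UNIV_nat finite_imageD by metis
  then obtain i j :: nat where "i < j" "nat_mult i x = nat_mult j x"
    by (auto simp: inj_def) (metis nat_neq_iff)
  then have "nat_mult (j - i) x = 0" "j - i > 0"
    using nat_mult_add[of i "j - i" x] by auto
  then show ?thesis using that by blast
qed

text \<open>
  Adjoining one element \<open>x\<close> to the domain of a character: if \<open>m\<close> is the order of \<open>x\<close> modulo \<open>H\<close>,
  then any \<open>m\<close>-th root of \<open>\<xi> (m x)\<close> may serve as the value at \<open>x\<close>.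
\<close>

lemma subgroup_char_extend_step:
  assumes K: "add_subgroup K" "finite K"
    and H: "add_subgroup H" "H \<subseteq> K" and \<xi>: "\<xi> \<in> subgroup_chars H"
    and x: "x \<in> K" and m: "m > 0" "nat_mult m x \<in> H"
    and min: "\<And>n. 0 < n \<Longrightarrow> nat_mult n x \<in> H \<Longrightarrow> m \<le> n"
    and w: "\<omega> ^ m = \<xi> (nat_mult m x)"
  obtains H' \<xi>' where "add_subgroup H'" "H \<subseteq> H'" "H' \<subseteq> K" "x \<in> H'" "\<xi>' \<in> subgroup_chars H'"
    "\<And>y. y \<in> H \<Longrightarrow> \<xi>' y = \<xi> y" "\<xi>' x = \<omega>"
proof -
  note H0 = add_subgroup_zero[OF H(1)] and Hd = add_subgroup_diff[OF H(1)]
    and Ha = add_subgroup_add[OF H(1)]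
  have dvd: "m dvd n" if "nat_mult n x \<in> H" for n
  proof -
    have "nat_mult n x = nat_mult (n div m) (nat_mult m x) + nat_mult (n mod m) x"
      by (metis div_mult_mod_eq nat_mult_add nat_mult_mult)
    moreover have "nat_mult (n div m) (nat_mult m x) \<in> H" using m(2) H(1) by (rule nat_mult_mem[rotated])
    ultimately have "nat_mult (n mod m) x \<in> H"
      using Hd[OF that] by (metis add_diff_cancel_left')
    then have "n mod m = 0" using min[of "n mod m"] m(1) by (metis mod_less_divisor not_le not_gr_zero)
    then show ?thesis by auto
  qed
  have val: "\<xi> (nat_mult n x) = \<omega> ^ n" if n: "nat_mult n x \<in> H" for n
  proof -
    obtain k where "n = k * m" using dvd[OF n] by (metis dvd_div_mult_self)
    then show ?thesis
      using subgroup_char_nat_mult[OF \<xi> H(1) m(2), of k] w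
      by (metis mult.commute nat_mult_mult power_mult)
  qed
  define H' where "H' = {y. \<exists>n. y - nat_mult n x \<in> H}"
  \<comment> \<open>The value at \<open>y\<close> is computed from one representation \<open>y = h + n x\<close>; \<open>indep\<close> below shows that all of
    them give the same value.\<close>
  define N where "N = (\<lambda>y. SOME n. y - nat_mult n x \<in> H)"
  define \<xi>' where "\<xi>' = (\<lambda>y. if y \<in> H' then \<xi> (y - nat_mult (N y) x) * \<omega> ^ N y else 0)"
  have N: "y - nat_mult (N y) x \<in> H" if "y \<in> H'" for y
    using that unfolding N_def H'_def by (auto intro: someI)
  have indep_le: "\<xi> (y - nat_mult n x) * \<omega> ^ n = \<xi> (y - nat_mult n' x) * \<omega> ^ n'"
    if "y - nat_mult n x \<in> H" "y - nat_mult n' x \<in> H" "n \<le> n'" for y n n'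
  proof -
    have e: "nat_mult n' x = nat_mult (n' - n) x + nat_mult n x"
      using nat_mult_add[of "n' - n" n x] that(3) by simp
    have e2: "nat_mult (n' - n) x = (y - nat_mult n x) - (y - nat_mult n' x)"
      using e by (simp add: algebra_simps)
    then have i: "nat_mult (n' - n) x \<in> H" using Hd that by metis
    have "y - nat_mult n x = nat_mult (n' - n) x + (y - nat_mult n' x)"
      unfolding e2 by (rule diff_add_cancel[symmetric])
    then have "\<xi> (y - nat_mult n x) = \<xi> ((y - nat_mult n' x) + nat_mult (n' - n) x)"
      by (metis add.commute)
    also have "\<dots> = \<xi> (y - nat_mult n' x) * \<omega> ^ (n' - n)"
      using subgroup_charsD(2)[OF \<xi> that(2) i] val[OF i] by simp
    finally show ?thesis using that(3) by (simp add: mult.assoc flip: power_add)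
  qed
  have indep: "\<xi>' y = \<xi> (y - nat_mult n x) * \<omega> ^ n" if "y - nat_mult n x \<in> H" for y n
  proof -
    have y: "y \<in> H'" using that H'_def by auto
    show ?thesis
    proof (cases "n \<le> N y")
      case True then show ?thesis using indep_le[OF that N[OF y]] y by (simp add: \<xi>'_def)
    next
      case False then show ?thesis using indep_le[OF N[OF y] that] y by (simp add: \<xi>'_def)
    qed
  qed
  have w1: "norm \<omega> = 1"
  proof -
    have "norm \<omega> ^ m = 1" using w subgroup_charsD(1)[OF \<xi> m(2)] by (metis norm_power)
    then show ?thesis using power_eq_imp_eq_base[of "norm \<omega>" m 1] m(1) by simp
  qed
  have sub: "H \<subseteq> H'"
  proof
    fix y assume "y \<in> H" then have "y - nat_mult 0 x \<in> H" by simp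
    then show "y \<in> H'" unfolding H'_def by blast
  qed
  have K': "H' \<subseteq> K"
  proof
    fix y assume "y \<in> H'"
    then obtain n where "y - nat_mult n x \<in> K" using H(2) by (auto simp: H'_def)
    then have "(y - nat_mult n x) + nat_mult n x \<in> K"
      using add_subgroup_add[OF K(1)] nat_mult_mem[OF K(1) x] by blast
    then show "y \<in> K" by simp
  qed
  have add': "y + z - nat_mult (n + k) x \<in> H \<and> \<xi>' (y + z) = \<xi>' y * \<xi>' z"
    if "y - nat_mult n x \<in> H" "z - nat_mult k x \<in> H" for y z n k
  proof -
    have e: "y + z - nat_mult (n + k) x = (y - nat_mult n x) + (z - nat_mult k x)"
      by (simp add: nat_mult_add algebra_simps)
    then have i: "y + z - nat_mult (n + k) x \<in> H" using Ha that by metis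
    have "\<xi>' (y + z) = \<xi> (y - nat_mult n x) * \<xi> (z - nat_mult k x) * \<omega> ^ (n + k)"
      using indep[OF i] e subgroup_charsD(2)[OF \<xi> that] by simp
    then show ?thesis using i indep[OF that(1)] indep[OF that(2)] by (simp add: power_add)
  qed
  have neg: "- y \<in> H'" if "y \<in> H'" for y
  proof -
    obtain n where n: "y - nat_mult n x \<in> H" using \<open>y \<in> H'\<close> unfolding H'_def by blast
    have "nat_mult (m * n) x \<in> H"
      using nat_mult_mem[OF H(1) m(2), of n] by (simp add: nat_mult_mult[symmetric] mult.commute)
    moreover have "nat_mult (m * n) x = nat_mult (m * n - n) x + nat_mult n x"
      using m(1) nat_mult_add[of "m * n - n" n x] by (simp add: Suc_leI)
    ultimately have "0 - (y - nat_mult n x) - (nat_mult (m * n - n) x + nat_mult n x) \<in> H"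
      using Hd H0 n by metis
    then have "- y - nat_mult (m * n - n) x \<in> H" by (simp add: algebra_simps)
    then show ?thesis unfolding H'_def by blast
  qed
  have sg: "add_subgroup H'"
    unfolding add_subgroup_def
  proof (intro conjI ballI)
    show "0 \<in> H'" using sub H0 by auto
    fix y z assume "y \<in> H'" "z \<in> H'"
    then have "y \<in> H'" "- z \<in> H'" using neg by auto
    then obtain n k where "y - nat_mult n x \<in> H" "- z - nat_mult k x \<in> H" by (auto simp: H'_def)
    from add'[OF this] have "y + - z - nat_mult (n + k) x \<in> H" by blast
    then have "y + - z \<in> H'" unfolding H'_def by blast
    then show "y - z \<in> H'" by simp
  qed
  have x1: "x - nat_mult 1 x \<in> H" using H0 by simp
  show ?thesis
  proof (rule that[OF sg sub K'])
    show "x \<in> H'" using x1 unfolding H'_def by blast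
    show "\<xi>' x = \<omega>" using indep[OF x1] subgroup_char_zero[OF \<xi> H(1)] by simp
    show "\<xi>' y = \<xi> y" if "y \<in> H" for y using indep[of y 0] that by simp
    show "\<xi>' \<in> subgroup_chars H'"
      unfolding subgroup_chars_def
    proof (safe)
      fix y assume "y \<in> H'"
      then show "norm (\<xi>' y) = 1" 
        using N[of y] subgroup_charsD(1)[OF \<xi>] by (simp add: \<xi>'_def norm_mult norm_power w1)
    next
      fix y z assume "y \<in> H'" "z \<in> H'"
      then obtain n k where "y - nat_mult n x \<in> H" "z - nat_mult k x \<in> H" by (auto simp: H'_def)
      then show "\<xi>' (y + z) = \<xi>' y * \<xi>' z" using add' by blast
    qed (simp add: \<xi>'_def)
  qed
qed

text \<open>
  Adjoin one element at a time until the domain is all of \<open>K\<close>.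
\<close>

lemma subgroup_char_extend:
  assumes K: "add_subgroup K" "finite K"
    and H: "add_subgroup H" "H \<subseteq> K" and \<xi>: "\<xi> \<in> subgroup_chars H"
  obtains \<xi>' where "\<xi>' \<in> subgroup_chars K" "\<And>y. y \<in> H \<Longrightarrow> \<xi>' y = \<xi> y"
proof -
  have "\<exists>\<xi>'\<in>subgroup_chars K. \<forall>y\<in>H. \<xi>' y = \<xi> y"
    using H \<xi>
  proof (induction "card K - card H" arbitrary: H \<xi> rule: less_induct)
    case less
    show ?case
    proof (cases "H = K")
      case True then show ?thesis using less.prems by auto
    next
      case False
      then obtain x where x: "x \<in> K" "x \<notin> H" using less.prems by auto
      define m where "m = (LEAST m. 0 < m \<and> nat_mult m x \<in> H)"
      obtain m0 where m0: "0 < m0 \<and> nat_mult m0 x \<in> H"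
        using nat_mult_eq_zero_ex[OF K x(1)] add_subgroup_zero[OF less.prems(1)] by metis
      have m: "0 < m" "nat_mult m x \<in> H"
        using LeastI[of "\<lambda>m. 0 < m \<and> nat_mult m x \<in> H", OF m0] by (auto simp: m_def)
      have min: "m \<le> n" if "0 < n" "nat_mult n x \<in> H" for n
        unfolding m_def by (rule Least_le) (use that in auto)
      obtain \<omega> where w: "\<omega> ^ m = \<xi> (nat_mult m x)"
      proof -
        have "\<xi> (nat_mult m x) \<noteq> 0" using subgroup_charsD(1)[OF less.prems(3) m(2)] by auto
        then have "card {z. z ^ m = \<xi> (nat_mult m x)} = m" using m(1) by (rule card_nth_roots)
        then have "{z. z ^ m = \<xi> (nat_mult m x)} \<noteq> {}" using m(1) by (metis card.empty less_irrefl)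
        then show ?thesis using that by blast
      qed
      obtain H' \<xi>' where H': "add_subgroup H'" "H \<subseteq> H'" "H' \<subseteq> K" "x \<in> H'" "\<xi>' \<in> subgroup_chars H'"
        "\<And>y. y \<in> H \<Longrightarrow> \<xi>' y = \<xi> y"
        using subgroup_char_extend_step[OF K less.prems(1,2,3) x(1) m min w] by metis
      have "card H < card H'" "card H' \<le> card K"
        using H' x K(2) by (auto intro!: psubset_card_mono card_mono dest: finite_subset)
      then obtain \<xi>'' where "\<xi>'' \<in> subgroup_chars K" "\<forall>y\<in>H'. \<xi>'' y = \<xi>' y"
        using less.hyps[OF diff_less_mono2 H'(1,3,5)] by fastforce
      then show ?thesis using H' by (metis subsetD)
    qed
  qed
  then show ?thesis using that by blast
qed

text \<open>
  On the cyclic group generated by \<open>a\<close> a primitive root of unity is an admissible value at \<open>a\<close>.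
\<close>

lemma subgroup_chars_separate:
  assumes K: "add_subgroup K" "finite K" and a: "a \<in> K" "a \<noteq> 0"
  obtains \<xi> where "\<xi> \<in> subgroup_chars K" "\<xi> a \<noteq> 1"
proof -
  define m where "m = (LEAST m. 0 < m \<and> nat_mult m a \<in> {0})"
  obtain m0 where m0: "0 < m0 \<and> nat_mult m0 a \<in> {0}"
    using nat_mult_eq_zero_ex[OF K a(1)] by (metis singletonI)
  have m: "0 < m" "nat_mult m a \<in> {0}" using LeastI[of "\<lambda>m. 0 < m \<and> nat_mult m a \<in> {0}", OF m0] by (auto simp: m_def)
  have min: "m \<le> n" if "0 < n" "nat_mult n a \<in> {0}" for n
    unfolding m_def by (rule Least_le) (use that in auto)
  have "m \<noteq> 1" using m(2) a(2) by auto
  then have m2: "m \<ge> 2" using m(1) by simp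
  define \<omega> where "\<omega> = cis (2 * pi / m)"
  have wm: "\<omega> ^ m = 1" using m(1) unfolding \<omega>_def Complex.DeMoivre by simp
  have w1: "\<omega> \<noteq> 1"
  proof
    assume "\<omega> = 1"
    then have "cos (2 * pi / m) = 1" by (simp add: \<omega>_def complex_eq_iff)
    moreover have "0 < 2 * pi / m" "2 * pi / m \<le> pi" using m2 by (auto simp: field_simps)
    ultimately show False using cos_monotone_0_pi[of 0 "2 * pi / m"] by simp
  qed
  define \<xi> where "\<xi> = (\<lambda>x::'a. if x = 0 then 1 else 0 :: complex)"
  have c: "\<xi> \<in> subgroup_chars {0}" "add_subgroup {0::'a}" "{0} \<subseteq> K"
    using add_subgroup_zero[OF K(1)] by (auto simp: \<xi>_def subgroup_chars_def add_subgroup_def)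
  have "\<omega> ^ m = \<xi> (nat_mult m a)" using m(2) wm by (simp add: \<xi>_def)
  then obtain H' \<xi>' where H': "add_subgroup H'" "H' \<subseteq> K" "a \<in> H'" "\<xi>' \<in> subgroup_chars H'" "\<xi>' a = \<omega>"
    using subgroup_char_extend_step[OF K c(2,3,1) a(1) m min] by metis
  then show ?thesis using subgroup_char_extend[OF K H'(1,2,4)] that w1 by metis
qed

lemma subgroup_chars_mult:
  assumes "\<xi> \<in> subgroup_chars K" "\<xi>' \<in> subgroup_chars K"
  shows "(\<lambda>x. \<xi> x * \<xi>' x) \<in> subgroup_chars K"
  using assms by (auto simp: subgroup_chars_def norm_mult)

lemma subgroup_chars_cnj:
  assumes "\<xi> \<in> subgroup_chars K" shows "(\<lambda>x. cnj (\<xi> x)) \<in> subgroup_chars K"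
  using assms by (auto simp: subgroup_chars_def)

lemma subgroup_char_mult_cnj:
  assumes "\<xi> \<in> subgroup_chars K" "x \<in> K" shows "\<xi> x * cnj (\<xi> x) = 1"
  using subgroup_charsD(1)[OF assms] by (simp add: complex_norm_square[symmetric])

text \<open>
  Translating the sum by \<open>b\<close> reproduces it up to the factor \<open>\<xi> b\<close>.
\<close>

lemma sum_nontrivial_char:
  fixes \<xi> :: "'a::ab_group_add \<Rightarrow> complex"
  assumes K: "add_subgroup K" and hom: "\<And>x y. x \<in> K \<Longrightarrow> y \<in> K \<Longrightarrow> \<xi> (x + y) = \<xi> x * \<xi> y"
    and b: "b \<in> K" "\<xi> b \<noteq> 1"
  shows "(\<Sum>x\<in>K. \<xi> x) = 0"
proof -
  have "(\<Sum>x\<in>K. \<xi> x) = (\<Sum>x\<in>K. \<xi> (x + b))" by (rule sum_subgroup_translate[OF K b(1), symmetric])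
  also have "\<dots> = (\<Sum>x\<in>K. \<xi> x) * \<xi> b" by (simp add: hom b sum_distrib_right)
  finally have "(\<Sum>x\<in>K. \<xi> x) * (\<xi> b - 1) = 0" by (simp add: algebra_simps)
  then show ?thesis using b by simp
qed

lemma sum_chars_at_nonzero:
  assumes K: "add_subgroup K" "finite K" and a: "a \<in> K" "a \<noteq> 0"
  shows "(\<Sum>\<xi>\<in>subgroup_chars K. \<xi> a) = 0"
proof -
  obtain \<psi> where p: "\<psi> \<in> subgroup_chars K" "\<psi> a \<noteq> 1" using subgroup_chars_separate[OF K a] by blast
  have canc: "(\<lambda>x. (\<xi> x * cnj (\<psi> x)) * \<psi> x) = \<xi>" "(\<lambda>x. (\<xi> x * \<psi> x) * cnj (\<psi> x)) = \<xi>"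
    if "\<xi> \<in> subgroup_chars K" for \<xi>
  proof -
    have "(\<xi> x * cnj (\<psi> x)) * \<psi> x = \<xi> x \<and> (\<xi> x * \<psi> x) * cnj (\<psi> x) = \<xi> x" for x
      using subgroup_char_mult_cnj[OF p(1), of x] subgroup_charsD(3)[OF that, of x]
      by (cases "x \<in> K") (auto simp: mult.assoc mult.commute)
    then show "(\<lambda>x. (\<xi> x * cnj (\<psi> x)) * \<psi> x) = \<xi>" "(\<lambda>x. (\<xi> x * \<psi> x) * cnj (\<psi> x)) = \<xi>" by auto
  qed
  have "(\<Sum>\<xi>\<in>subgroup_chars K. \<xi> a) = (\<Sum>\<xi>\<in>subgroup_chars K. \<xi> a * \<psi> a)"
    by (rule sum.reindex_bij_witness[where i = "\<lambda>\<xi> x. \<xi> x * \<psi> x" and j = "\<lambda>\<xi> x. \<xi> x * cnj (\<psi> x)"])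
       (use p(1) fun_cong[OF canc(1), of _ a] in
         \<open>simp_all only: canc subgroup_chars_mult subgroup_chars_cnj\<close>)
  also have "\<dots> = (\<Sum>\<xi>\<in>subgroup_chars K. \<xi> a) * \<psi> a"
    by (simp add: sum_distrib_right)
  finally have "(\<Sum>\<xi>\<in>subgroup_chars K. \<xi> a) * (\<psi> a - 1) = 0"
    by (simp add: algebra_simps)
  then show ?thesis using p by simp
qed

text \<open>
  Both orthogonality relations evaluate the sum of \<open>\<xi> x\<close> over all \<open>\<xi>\<close> and \<open>x\<close>.
\<close>

lemma card_subgroup_chars:
  assumes K: "add_subgroup K" "finite K"
  shows "card (subgroup_chars K) = card K"
proof -
  let ?X = "subgroup_chars K"
  define e where "e = (\<lambda>x. if x \<in> K then 1 else 0 :: complex)"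
  have e: "e \<in> ?X" using K by (auto simp: subgroup_chars_def e_def add_subgroup_add)
  have "of_nat (card ?X) = (\<Sum>x\<in>K. if x = 0 then of_nat (card ?X) else 0 :: complex)"
    using K(2) add_subgroup_zero[OF K(1)] by simp
  also have "\<dots> = (\<Sum>x\<in>K. \<Sum>\<xi>\<in>?X. \<xi> x)"
    by (rule sum.cong) (auto simp: sum_chars_at_nonzero[OF K] subgroup_char_zero[OF _ K(1)])
  also have "\<dots> = (\<Sum>\<xi>\<in>?X. \<Sum>x\<in>K. \<xi> x)" by (rule sum.swap)
  also have "\<dots> = (\<Sum>\<xi>\<in>?X. if \<xi> = e then of_nat (card K) else 0)"
  proof (rule sum.cong)
    fix \<xi> assume c: "\<xi> \<in> ?X"
    show "(\<Sum>x\<in>K. \<xi> x) = (if \<xi> = e then of_nat (card K) else 0)"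
    proof (cases "\<xi> = e")
      case False
      then obtain b where "\<xi> b \<noteq> e b" by (auto simp: fun_eq_iff)
      then have "b \<in> K" "\<xi> b \<noteq> 1" using subgroup_charsD(3)[OF c, of b] by (auto simp: e_def split: if_splits)
      then show ?thesis using False sum_nontrivial_char[OF K(1) subgroup_charsD(2)[OF c]] by simp
    qed (simp add: e_def)
  qed simp
  also have "\<dots> = of_nat (card K)" using e finite_subgroup_chars[OF K] by simp
  finally show ?thesis using of_nat_eq_iff by blast
qed

definition finite_fourier :: "'a set \<Rightarrow> ('a \<Rightarrow> complex) \<Rightarrow> ('a \<Rightarrow> complex) \<Rightarrow> complex" where
  "finite_fourier K f \<xi> = (\<Sum>x\<in>K. f x * cnj (\<xi> x)) / of_nat (card K)"

lemma finite_plancherel: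
  assumes K: "add_subgroup K" "finite K"
  shows "(\<Sum>\<xi>\<in>subgroup_chars K. (norm (finite_fourier K f \<xi>))\<^sup>2) = (\<Sum>x\<in>K. (norm (f x))\<^sup>2) / card K"
proof -
  let ?X = "subgroup_chars K" and ?N = "of_nat (card K) :: complex"
  have N: "?N \<noteq> 0" using K add_subgroup_zero by fastforce
  have orth: "(\<Sum>\<xi>\<in>?X. cnj (\<xi> x) * \<xi> y) = (if x = y then ?N else 0)" if "x \<in> K" "y \<in> K" for x y
  proof -
    have "(\<Sum>\<xi>\<in>?X. cnj (\<xi> x) * \<xi> y) = (\<Sum>\<xi>\<in>?X. \<xi> (y - x))"
      by (rule sum.cong) (auto simp: subgroup_char_diff[OF _ K(1)] that)
    also have "\<dots> = (if x = y then ?N else 0)"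
      using that sum_chars_at_nonzero[OF K, of "y - x"] card_subgroup_chars[OF K]
      by (auto simp: subgroup_char_zero[OF _ K(1)] add_subgroup_diff[OF K(1)])
    finally show ?thesis .
  qed
  have "(\<Sum>\<xi>\<in>?X. finite_fourier K f \<xi> * cnj (finite_fourier K f \<xi>))
      = (\<Sum>\<xi>\<in>?X. (\<Sum>x\<in>K. \<Sum>y\<in>K. f x * cnj (f y) * (cnj (\<xi> x) * \<xi> y)) / (?N * ?N))"
  proof (rule sum.cong[OF refl])
    fix \<xi> :: "'a \<Rightarrow> complex"
    have "finite_fourier K f \<xi> * cnj (finite_fourier K f \<xi>)
        = ((\<Sum>x\<in>K. f x * cnj (\<xi> x)) * (\<Sum>y\<in>K. cnj (f y) * \<xi> y)) / (?N * ?N)"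
      by (simp add: finite_fourier_def)
    also have "(\<Sum>x\<in>K. f x * cnj (\<xi> x)) * (\<Sum>y\<in>K. cnj (f y) * \<xi> y)
        = (\<Sum>x\<in>K. \<Sum>y\<in>K. f x * cnj (f y) * (cnj (\<xi> x) * \<xi> y))"
      unfolding sum_product by (intro sum.cong refl) (simp add: mult_ac)
    finally show "finite_fourier K f \<xi> * cnj (finite_fourier K f \<xi>)
        = (\<Sum>x\<in>K. \<Sum>y\<in>K. f x * cnj (f y) * (cnj (\<xi> x) * \<xi> y)) / (?N * ?N)" .
  qed
  also have "\<dots> = (\<Sum>\<xi>\<in>?X. \<Sum>x\<in>K. \<Sum>y\<in>K. f x * cnj (f y) * (cnj (\<xi> x) * \<xi> y)) / (?N * ?N)"
    by (rule sum_divide_distrib[symmetric])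
  also have "(\<Sum>\<xi>\<in>?X. \<Sum>x\<in>K. \<Sum>y\<in>K. f x * cnj (f y) * (cnj (\<xi> x) * \<xi> y))
     = (\<Sum>x\<in>K. \<Sum>\<xi>\<in>?X. \<Sum>y\<in>K. f x * cnj (f y) * (cnj (\<xi> x) * \<xi> y))" by (rule sum.swap)
  also have "\<dots> = (\<Sum>x\<in>K. \<Sum>y\<in>K. f x * cnj (f y) * (\<Sum>\<xi>\<in>?X. cnj (\<xi> x) * \<xi> y))"
    unfolding sum_distrib_left by (rule sum.cong[OF refl]) (rule sum.swap)
  also have "\<dots> = (\<Sum>x\<in>K. f x * cnj (f x) * ?N)"
  proof (rule sum.cong[OF refl])
    fix x assume x: "x \<in> K"
    have "(\<Sum>y\<in>K. f x * cnj (f y) * (\<Sum>\<xi>\<in>?X. cnj (\<xi> x) * \<xi> y))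
        = (\<Sum>y\<in>K. if x = y then f x * cnj (f x) * ?N else 0)"
      by (rule sum.cong[OF refl]) (auto simp: orth x)
    then show "(\<Sum>y\<in>K. f x * cnj (f y) * (\<Sum>\<xi>\<in>?X. cnj (\<xi> x) * \<xi> y)) = f x * cnj (f x) * ?N"
      using x K(2) by simp
  qed
  also have "\<dots> / (?N * ?N) = (\<Sum>x\<in>K. f x * cnj (f x)) / ?N" using N by (simp add: sum_distrib_right[symmetric])
  finally have "complex_of_real (\<Sum>\<xi>\<in>?X. (norm (finite_fourier K f \<xi>))\<^sup>2)
     = complex_of_real ((\<Sum>x\<in>K. (norm (f x))\<^sup>2) / card K)"
    by (simp only: of_real_sum of_real_divide complex_norm_square of_real_of_nat_eq)
  then show ?thesis using of_real_eq_iff by blast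
qed


section \<open>Continuous characters separate points\<close>

text \<open>
  The modulus of continuity of \<open>f\<close> enters only through these sets, which are neighbourhoods of \<open>0\<close> by
  compactness.
\<close>

definition almost_periods :: "('a::ab_group_add \<Rightarrow> real) \<Rightarrow> real \<Rightarrow> 'a set" where
  "almost_periods f e = {x. \<forall>t. \<bar>f (x + t) - f t\<bar> \<le> e}"

lemma almost_periodsD: "x \<in> almost_periods f e \<Longrightarrow> \<bar>f (x + t) - f t\<bar> \<le> e"
  by (simp add: almost_periods_def)

lemma almost_periods_diff:
  assumes "x \<in> almost_periods f e" "y \<in> almost_periods f e"
  shows "x - y \<in> almost_periods f (2 * e)"
  unfolding almost_periods_def
proof (clarify)
  fix t
  have "\<bar>f (x + (t - y)) - f (t - y)\<bar> \<le> e" "\<bar>f (y + (t - y)) - f (t - y)\<bar> \<le> e"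
    using assms almost_periodsD by blast+
  then show "\<bar>f (x - y + t) - f t\<bar> \<le> 2 * e" by (simp add: algebra_simps)
qed

lemma almost_periods_nhds:
  fixes f :: "'a::{topological_ab_group_add, t2_space} \<Rightarrow> real"
  assumes "compact (UNIV :: 'a set)" "continuous_on UNIV f" "e > 0"
  shows "0 \<in> interior (almost_periods f e)"
proof -
  have c: "continuous_on (UNIV \<times> UNIV) (\<lambda>z::'a \<times> 'a. f (fst z + snd z))"
    by (intro continuous_on_compose2[OF assms(2)] continuous_intros) auto
  obtain X where X: "0 \<in> X" "open X" "\<forall>x\<in>X \<inter> UNIV. \<forall>t\<in>UNIV. dist (f (fst (x, t) + snd (x, t))) (f (fst (0::'a, t) + snd (0::'a, t))) \<le> e"
    using continuous_on_prod_compactE[OF c assms(1) _ assms(3), of 0] by blast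
  then have "X \<subseteq> almost_periods f e" by (auto simp: almost_periods_def dist_real_def)
  then show ?thesis using X interior_maximal by blast
qed

text \<open>
  Finitely many translates of the set of almost periods cover the whole group, so its density in a
  finite subgroup has a lower bound that does not depend on the subgroup.
\<close>

lemma almost_periods_density:
  fixes f :: "'a::{topological_ab_group_add, t2_space} \<Rightarrow> real"
  assumes "compact (UNIV :: 'a set)" "continuous_on UNIV f" "e > 0"
  obtains n :: nat where "n > 0"
    "\<And>K. add_subgroup K \<Longrightarrow> finite K \<Longrightarrow> card K \<le> n * card (K \<inter> almost_periods f e)"
proof -
  define U where "U = interior (almost_periods f (e/2))"
  have U: "0 \<in> U" "open U" using almost_periods_nhds[OF assms(1,2), of "e/2"] assms(3) by (auto simp: U_def)
  have op: "open ((\<lambda>x. x - c) -` U)" for c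
    by (intro open_vimage U continuous_intros)
  have "x \<in> (\<lambda>y. y - x) -` U" for x using U(1) by simp
  then have "(UNIV::'a set) \<subseteq> (\<Union>c\<in>UNIV. (\<lambda>x. x - c) -` U)" by blast
  then obtain C where C: "finite C" "(UNIV::'a set) \<subseteq> (\<Union>c\<in>C. (\<lambda>x. x - c) -` U)"
    using compactE_image[OF assms(1), of UNIV "\<lambda>c. (\<lambda>x. x - c) -` U"] op by metis
  have "card K \<le> card C * card (K \<inter> almost_periods f e)" if K: "add_subgroup K" "finite K" for K
  proof -
    have le: "card (K \<inter> (\<lambda>x. x - c) -` U) \<le> card (K \<inter> almost_periods f e)" for c
    proof (cases "K \<inter> (\<lambda>x. x - c) -` U = {}")
      case False
      then obtain k where k: "k \<in> K" "k - c \<in> U" by auto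
      show ?thesis
      proof (rule card_inj_on_le[where f = "\<lambda>x. x - k"])
        show "(\<lambda>x. x - k) ` (K \<inter> (\<lambda>x. x - c) -` U) \<subseteq> K \<inter> almost_periods f e"
        proof safe
          fix x assume x: "x \<in> K" "x - c \<in> U"
          show "x - k \<in> K" using add_subgroup_diff K x k by blast
          have "(x - c) - (k - c) \<in> almost_periods f (2 * (e / 2))"
            using x k interior_subset unfolding U_def by (intro almost_periods_diff) blast+
          then show "x - k \<in> almost_periods f e" by simp
        qed
      qed (use K in \<open>auto simp: inj_on_def\<close>)
    qed simp
    have "card K \<le> card (\<Union>c\<in>C. K \<inter> (\<lambda>x. x - c) -` U)"
      using C K by (intro card_mono) auto
    also have "\<dots> \<le> (\<Sum>c\<in>C. card (K \<inter> (\<lambda>x. x - c) -` U))" by (rule card_UN_le[OF C(1)])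
    also have "\<dots> \<le> (\<Sum>c\<in>C. card (K \<inter> almost_periods f e))" by (rule sum_mono) (rule le)
    finally show ?thesis by simp
  qed
  moreover have "card C > 0" using C by (auto simp: card_gt_0_iff)
  ultimately show ?thesis using that by blast
qed

text \<open>
  After the substitution of \<open>x + t\<close> by \<open>x\<close> the double sum factors. The right-hand side is the squared
  absolute value of the coefficient, which is what makes autocorrelations useful below.
\<close>

lemma finite_fourier_autocorrelation:
  assumes K: "add_subgroup K" "finite K" and c: "\<xi> \<in> subgroup_chars K"
  shows "finite_fourier K (\<lambda>x. (\<Sum>t\<in>K. h (x + t) * cnj (h t)) / of_nat (card K)) \<xi>
       = finite_fourier K h \<xi> * cnj (finite_fourier K h \<xi>)"
proof -
  let ?N = "of_nat (card K) :: complex"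
  have "(\<Sum>x\<in>K. \<Sum>t\<in>K. h (x + t) * cnj (h t) * cnj (\<xi> x))
      = (\<Sum>t\<in>K. \<Sum>x\<in>K. (h (x + t) * cnj (\<xi> (x + t))) * (cnj (h t) * \<xi> t))"
    by (subst sum.swap, intro sum.cong refl)
       (use subgroup_char_mult_cnj[OF c] in \<open>simp add: subgroup_charsD(2)[OF c] mult_ac\<close>)
  also have "\<dots> = (\<Sum>t\<in>K. (\<Sum>x\<in>K. h (x + t) * cnj (\<xi> (x + t))) * (cnj (h t) * \<xi> t))"
    by (simp add: sum_distrib_right)
  also have "\<dots> = (\<Sum>t\<in>K. (\<Sum>x\<in>K. h x * cnj (\<xi> x)) * (cnj (h t) * \<xi> t))"
  proof (rule sum.cong[OF refl])
    fix t assume "t \<in> K"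
    then show "(\<Sum>x\<in>K. h (x + t) * cnj (\<xi> (x + t))) * (cnj (h t) * \<xi> t)
        = (\<Sum>x\<in>K. h x * cnj (\<xi> x)) * (cnj (h t) * \<xi> t)"
      using sum_subgroup_translate[OF K(1), of t "\<lambda>x. h x * cnj (\<xi> x)"] by simp
  qed
  also have "\<dots> = (\<Sum>x\<in>K. h x * cnj (\<xi> x)) * (\<Sum>t\<in>K. cnj (h t) * \<xi> t)"
    by (simp add: sum_distrib_left)
  finally have e: "(\<Sum>x\<in>K. \<Sum>t\<in>K. h (x + t) * cnj (h t) * cnj (\<xi> x))
      = (\<Sum>x\<in>K. h x * cnj (\<xi> x)) * (\<Sum>t\<in>K. cnj (h t) * \<xi> t)" .
  have "finite_fourier K (\<lambda>x. (\<Sum>t\<in>K. h (x + t) * cnj (h t)) / ?N) \<xi>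
      = (\<Sum>x\<in>K. (\<Sum>t\<in>K. h (x + t) * cnj (h t) * cnj (\<xi> x)) / ?N) / ?N"
    unfolding finite_fourier_def by (simp add: sum_distrib_right)
  also have "\<dots> = (\<Sum>x\<in>K. \<Sum>t\<in>K. h (x + t) * cnj (h t) * cnj (\<xi> x)) / ?N / ?N"
    by (simp only: sum_divide_distrib)
  also have "\<dots> = finite_fourier K h \<xi> * cnj (finite_fourier K h \<xi>)"
    unfolding e by (simp add: finite_fourier_def)
  finally show ?thesis .
qed

lemma norm_finite_fourier_le:
  assumes K: "add_subgroup K" "finite K" and c: "\<xi> \<in> subgroup_chars K" and f: "\<And>x. norm (f x) \<le> 1"
  shows "norm (finite_fourier K f \<xi>) \<le> 1"
proof -
  have "norm (\<Sum>x\<in>K. f x * cnj (\<xi> x)) \<le> (\<Sum>x\<in>K. 1)"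
    by (rule sum_norm_le) (use subgroup_charsD(1)[OF c] f in \<open>simp add: norm_mult\<close>)
  moreover have "card K > 0" using K add_subgroup_zero by (auto simp: card_gt_0_iff)
  ultimately show ?thesis by (simp add: finite_fourier_def norm_divide divide_le_eq_1)
qed

lemma finite_fourier_difference:
  assumes K: "add_subgroup K" "finite K" and c: "\<xi> \<in> subgroup_chars K" and a: "a \<in> K"
  shows "finite_fourier K (\<lambda>x. f x - f (x - a)) \<xi> = finite_fourier K f \<xi> * (1 - cnj (\<xi> a))"
proof -
  have "(\<Sum>x\<in>K. f (x - a) * cnj (\<xi> x)) = (\<Sum>x\<in>K. f (x + a - a) * cnj (\<xi> (x + a)))"
    by (rule sum_subgroup_translate[OF K(1) a, symmetric])
  also have "\<dots> = (\<Sum>x\<in>K. f x * cnj (\<xi> x)) * cnj (\<xi> a)"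
    unfolding sum_distrib_right by (intro sum.cong) (auto simp: subgroup_charsD(2)[OF c] a)
  finally show ?thesis
    by (simp add: finite_fourier_def algebra_simps sum_subtractf diff_divide_distrib)
qed

text \<open>
  Let \<open>h x = f x - f (x - a)\<close>, a function bounded by \<open>1\<close>. Plancherel for \<open>h\<close> and for its
  autocorrelation \<open>g\<close> shows that the mean square of \<open>g\<close> is the sum of the fourth powers of the
  coefficients of \<open>h\<close>, hence at most the square of the largest one. Both \<open>h\<close> and \<open>g\<close> are bounded away
  from zero on sets of almost periods of \<open>f\<close>, and the densities of these sets in a finite subgroup
  have lower bounds that do not depend on the subgroup. A coefficient of \<open>h\<close> is the coefficient of
  \<open>f\<close> times \<open>1 - cnj (\<xi> a)\<close>, so both factors, being bounded, are bounded below.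
\<close>

lemma subgroup_char_large_coefficient:
  fixes f :: "'a::{topological_ab_group_add, t2_space} \<Rightarrow> real"
  assumes G: "compact (UNIV :: 'a set)" and f: "continuous_on UNIV f"
    and f01: "\<And>x. 0 \<le> f x" "\<And>x. f x \<le> 1" "f 0 = 1"
  obtains \<delta> where "\<delta> > 0"
    "\<And>K a. add_subgroup K \<Longrightarrow> finite K \<Longrightarrow> a \<in> K \<Longrightarrow> f (- a) \<le> 1/4 \<Longrightarrow>
      \<exists>\<xi>\<in>subgroup_chars K. \<delta> \<le> norm (1 - \<xi> a) \<and> \<delta> \<le> norm (finite_fourier K (\<lambda>x. of_real (f x)) \<xi>)"
proof -
  obtain n1 where n1: "n1 > 0"
    "\<And>K. add_subgroup K \<Longrightarrow> finite K \<Longrightarrow> card K \<le> n1 * card (K \<inter> almost_periods f (1/8))"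
    using almost_periods_density[OF G f, of "1/8"] by auto
  \<comment> \<open>\<open>s\<close> will be a lower bound for the mean square of \<open>h\<close>, because \<open>h \<ge> 1/2\<close> on \<open>1/8\<close>-almost periods of \<open>f\<close>.\<close>
  define s where "s = 1 / (4 * real n1)"
  have s: "s > 0" using n1 by (simp add: s_def)
  obtain n2 where n2: "n2 > 0"
    "\<And>K. add_subgroup K \<Longrightarrow> finite K \<Longrightarrow> card K \<le> n2 * card (K \<inter> almost_periods f (s/4))"
    using almost_periods_density[OF G f, of "s/4"] s by auto
  \<comment> \<open>The mean square of \<open>g\<close> will be at least \<open>s\<^sup>2 / (4 * n2)\<close>, which exceeds \<open>d\<^sup>2\<close>.\<close>
  define d where "d = s / (4 * real n2)"
  have d: "d > 0" using s n2 by (simp add: d_def)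
  have "\<exists>\<xi>\<in>subgroup_chars K. d/2 \<le> norm (1 - \<xi> a) \<and> d/2 \<le> norm (finite_fourier K (\<lambda>x. of_real (f x)) \<xi>)"
    if K: "add_subgroup K" "finite K" and a: "a \<in> K" "f (- a) \<le> 1/4" for K a
  proof -
    let ?X = "subgroup_chars K" and ?N = "real (card K)"
    have N: "?N > 0" using K add_subgroup_zero by (auto simp: card_gt_0_iff)
    define h where "h = (\<lambda>x. f x - f (x - a))"
    define hc where "hc = (\<lambda>x. complex_of_real (f x) - complex_of_real (f (x - a)))"
    define g where "g = (\<lambda>x. (\<Sum>t\<in>K. h (x + t) * h t) / ?N)"
    define gc where "gc = (\<lambda>x. (\<Sum>t\<in>K. hc (x + t) * cnj (hc t)) / of_nat (card K))"
    have hc: "hc x = of_real (h x)" for x by (simp add: hc_def h_def)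
    have gc: "gc x = of_real (g x)" for x by (simp add: gc_def g_def hc)
    have h1: "\<bar>h x\<bar> \<le> 1" for x using f01(1,2)[of x] f01(1,2)[of "x - a"] by (simp add: h_def abs_le_iff)
    define S where "S = (\<Sum>x\<in>K. (h x)\<^sup>2) / ?N"
    have hbig: "h x \<ge> 1/2" if "x \<in> almost_periods f (1/8)" for x
    proof -
      have "\<bar>f x - f 0\<bar> \<le> 1/8" "\<bar>f (x - a) - f (- a)\<bar> \<le> 1/8"
        using almost_periodsD[OF that, of 0] almost_periodsD[OF that, of "- a"] by simp_all
      then show ?thesis using f01(3) a(2) unfolding h_def by linarith
    qed
    have S: "S \<ge> s"
    proof -
      have "?N \<le> real n1 * real (card (K \<inter> almost_periods f (1/8)))"
        using n1(2)[OF K] by (metis of_nat_le_iff of_nat_mult)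
      then have "s * ?N \<le> 1/4 * real (card (K \<inter> almost_periods f (1/8)))"
        using n1(1) by (simp add: s_def field_simps)
      also have "\<dots> = (\<Sum>x\<in>K \<inter> almost_periods f (1/8). (1/2)\<^sup>2)" by (simp add: power2_eq_square)
      also have "\<dots> \<le> (\<Sum>x\<in>K \<inter> almost_periods f (1/8). (h x)\<^sup>2)"
        by (intro sum_mono power_mono) (use hbig in auto)
      also have "\<dots> \<le> (\<Sum>x\<in>K. (h x)\<^sup>2)" using K by (intro sum_mono2) auto
      finally show ?thesis using N by (simp add: S_def field_simps)
    qed
    have S1: "S \<le> 1"
    proof -
      have "(\<Sum>x\<in>K. (h x)\<^sup>2) \<le> (\<Sum>x\<in>K. 1)" by (intro sum_mono) (simp add: h1 abs_square_le_1)
      then show ?thesis using N by (simp add: S_def)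
    qed
    have gbig: "g x \<ge> s/2" if x: "x \<in> almost_periods f (s/4)" for x
    proof -
      have "(h t)\<^sup>2 - s/2 \<le> h (x + t) * h t" for t
      proof -
        have "\<bar>h (x + t) - h t\<bar> \<le> s/2"
        proof -
          have "\<bar>f (x + t) - f t\<bar> \<le> s/4" "\<bar>f (x + t - a) - f (t - a)\<bar> \<le> s/4"
            using almost_periodsD[OF x, of t] almost_periodsD[OF x, of "t - a"]
            by (simp_all add: algebra_simps)
          then show ?thesis unfolding h_def by linarith
        qed
        then have "\<bar>(h (x + t) - h t) * h t\<bar> \<le> s/2 * 1" unfolding abs_mult using h1 s by (intro mult_mono) auto
        then have "- ((h (x + t) - h t) * h t) \<le> s/2" by (simp only: abs_le_iff mult_1_right)
        then show ?thesis by (simp add: power2_eq_square algebra_simps)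
      qed
      then have "(\<Sum>t\<in>K. (h t)\<^sup>2 - s/2) \<le> (\<Sum>t\<in>K. h (x + t) * h t)" by (intro sum_mono)
      then have "(\<Sum>t\<in>K. (h t)\<^sup>2) - ?N * (s/2) \<le> g x * ?N" using N by (simp add: sum_subtractf g_def)
      moreover have "(\<Sum>t\<in>K. (h t)\<^sup>2) = S * ?N" using N by (simp add: S_def)
      ultimately have "(S - s/2) * ?N \<le> g x * ?N" by (simp add: algebra_simps)
      then show ?thesis using N S by simp
    qed
    have Q: "s\<^sup>2 / (4 * real n2) \<le> (\<Sum>x\<in>K. (g x)\<^sup>2) / ?N"
    proof -
      have "?N \<le> real n2 * real (card (K \<inter> almost_periods f (s/4)))"
        using n2(2)[OF K] by (metis of_nat_le_iff of_nat_mult)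
      then have "1 / real n2 * ?N \<le> real (card (K \<inter> almost_periods f (s/4)))"
        using n2(1) by (simp add: field_simps)
      then have "s\<^sup>2/4 * (1 / real n2 * ?N) \<le> s\<^sup>2/4 * real (card (K \<inter> almost_periods f (s/4)))"
        by (rule mult_left_mono) simp
      also have "\<dots> = (\<Sum>x\<in>K \<inter> almost_periods f (s/4). (s/2)\<^sup>2)" by (simp add: power2_eq_square)
      also have "\<dots> \<le> (\<Sum>x\<in>K \<inter> almost_periods f (s/4). (g x)\<^sup>2)"
        using s by (intro sum_mono power_mono) (use gbig in auto)
      also have "\<dots> \<le> (\<Sum>x\<in>K. (g x)\<^sup>2)" using K by (intro sum_mono2) auto
      finally show ?thesis using N by (simp add: field_simps)
    qed
    have "\<exists>\<xi>\<in>?X. d \<le> norm (finite_fourier K hc \<xi>)"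
    proof (rule ccontr)
      assume "\<not> ?thesis"
      then have lt: "norm (finite_fourier K hc \<xi>) \<le> d" if "\<xi> \<in> ?X" for \<xi> using that by force
      have "(\<Sum>x\<in>K. (g x)\<^sup>2) / ?N = (\<Sum>\<xi>\<in>?X. (norm (finite_fourier K gc \<xi>))\<^sup>2)"
        using finite_plancherel[OF K, of gc] by (simp add: gc)
      also have "\<dots> = (\<Sum>\<xi>\<in>?X. (norm (finite_fourier K hc \<xi>))\<^sup>2 * (norm (finite_fourier K hc \<xi>))\<^sup>2)"
        unfolding gc_def
        by (intro sum.cong refl)
           (simp add: finite_fourier_autocorrelation[OF K] norm_mult power2_eq_square)
      also have "\<dots> \<le> (\<Sum>\<xi>\<in>?X. d\<^sup>2 * (norm (finite_fourier K hc \<xi>))\<^sup>2)"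
        by (intro sum_mono mult_right_mono power_mono lt) auto
      also have "\<dots> = d\<^sup>2 * S"
        using finite_plancherel[OF K, of hc] by (simp add: sum_distrib_left[symmetric] S_def hc)
      also have "\<dots> \<le> d\<^sup>2" using S1 by (simp add: mult_left_le)
      finally have "s\<^sup>2 / (4 * real n2) \<le> s\<^sup>2 / (16 * (real n2)\<^sup>2)"
        using Q by (simp add: d_def power_divide power_mult_distrib)
      then have "s\<^sup>2 * (1 / (4 * real n2)) \<le> s\<^sup>2 * (1 / (16 * (real n2)\<^sup>2))" by simp
      then have "1 / (4 * real n2) \<le> 1 / (16 * (real n2)\<^sup>2)"
        using s mult_le_cancel_left_pos zero_less_power by blast
      then have "16 * (real n2 * real n2) \<le> 4 * real n2" using n2(1) by (simp add: divide_simps power2_eq_square)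
      then have "4 * real n2 \<le> 1" using n2(1) by simp
      then show False using n2(1) by simp
    qed
    then obtain \<xi> where xi: "\<xi> \<in> ?X" "d \<le> norm (finite_fourier K hc \<xi>)" by blast
    let ?F = "norm (finite_fourier K (\<lambda>x. complex_of_real (f x)) \<xi>)" and ?D = "norm (1 - \<xi> a)"
    have "norm (1 - cnj (\<xi> a)) = ?D" by (metis complex_cnj_diff complex_cnj_one complex_mod_cnj)
    then have dle: "d \<le> ?F * ?D"
      using xi finite_fourier_difference[OF K xi(1) a(1), of "\<lambda>x. complex_of_real (f x)"]
      by (simp add: hc_def norm_mult)
    have F1: "?F \<le> 1" using f01 by (intro norm_finite_fourier_le K xi) auto
    have D2: "?D \<le> 2" using norm_triangle_ineq4[of 1 "\<xi> a"] subgroup_charsD(1)[OF xi(1) a(1)] by simp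
    have "?F * ?D \<le> 1 * ?D" "?F * ?D \<le> ?F * 2" using F1 D2 by (intro mult_mono; simp)+
    then show ?thesis using dle d xi(1) by (intro bexI[of _ \<xi>]) auto
  qed
  then show ?thesis using that[of "d/2"] d by auto
qed

text \<open>
  A character \<open>\<xi>\<close> of \<open>K\<close> is an eigenfunction of convolution with \<open>f\<close> over \<open>K\<close>, the eigenvalue being the
  coefficient of \<open>f\<close> at \<open>\<xi>\<close>. The convolution of \<open>f\<close> and \<open>\<xi>\<close> makes sense on the whole group and inherits the
  modulus of continuity of \<open>f\<close>, so division by a coefficient that is bounded below gives an
  extension of \<open>\<xi>\<close> with a controlled modulus of continuity.
\<close>

lemma subgroup_char_smooth_extension:
  fixes f :: "'a::ab_group_add \<Rightarrow> real"
  assumes K: "add_subgroup K" "finite K" and c: "\<xi> \<in> subgroup_chars K"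
    and d: "\<delta> > 0" "\<delta> \<le> norm (finite_fourier K (\<lambda>x. of_real (f x)) \<xi>)"
    and f01: "\<And>x. 0 \<le> f x" "\<And>x. f x \<le> 1"
  obtains \<zeta> where "\<And>x. x \<in> K \<Longrightarrow> \<zeta> x = \<xi> x" "\<And>x. norm (\<zeta> x) \<le> 1/\<delta>"
    "\<And>x y e. x - y \<in> almost_periods f e \<Longrightarrow> norm (\<zeta> x - \<zeta> y) \<le> 1/\<delta> * e"
proof -
  let ?N = "of_nat (card K) :: complex"
  have Nr: "real (card K) > 0" using K add_subgroup_zero by (auto simp: card_gt_0_iff)
  define F where "F = finite_fourier K (\<lambda>x. of_real (f x)) \<xi>"
  have F: "norm F \<ge> \<delta>" "F \<noteq> 0" using d by (auto simp: F_def)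
  define \<zeta> where "\<zeta> = (\<lambda>x. (\<Sum>t\<in>K. of_real (f (x - t)) * \<xi> t) / (?N * F))"
  have bound: "norm (\<Sum>t\<in>K. c t * \<xi> t) / norm (?N * F) \<le> 1/\<delta> * e"
    if "\<And>t. norm (c t) \<le> e" "e \<ge> 0" for c e
  proof -
    have "norm (\<Sum>t\<in>K. c t * \<xi> t) \<le> (\<Sum>t\<in>K. e)"
      by (rule sum_norm_le) (use subgroup_charsD(1)[OF c] that in \<open>simp add: norm_mult\<close>)
    then have "norm (\<Sum>t\<in>K. c t * \<xi> t) / norm (?N * F) \<le> (real (card K) * e) / (real (card K) * norm F)"
      unfolding norm_mult norm_of_nat by (intro divide_right_mono) simp_all
    also have "\<dots> = e / norm F" using Nr by simp
    also have "\<dots> \<le> e / \<delta>" using F d that by (intro divide_left_mono) auto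
    finally show ?thesis by simp
  qed
  show ?thesis
  proof
    fix x assume x: "x \<in> K"
    have "(\<Sum>t\<in>K. of_real (f (x - t)) * \<xi> t) = (\<Sum>s\<in>K. of_real (f s) * \<xi> (x - s))"
      by (rule sum.reindex_bij_witness[where i = "\<lambda>s. x - s" and j = "\<lambda>s. x - s"])
         (auto simp: add_subgroup_diff K x)
    also have "\<dots> = \<xi> x * (\<Sum>s\<in>K. of_real (f s) * cnj (\<xi> s))"
      unfolding sum_distrib_left
      by (intro sum.cong refl) (simp add: subgroup_char_diff[OF c K(1) x])
    also have "(\<Sum>s\<in>K. of_real (f s) * cnj (\<xi> s)) = ?N * F"
      using Nr by (simp add: F_def finite_fourier_def)
    finally show "\<zeta> x = \<xi> x" using F Nr by (simp add: \<zeta>_def)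
  next
    fix x show "norm (\<zeta> x) \<le> 1/\<delta>"
      using bound[of "\<lambda>t. of_real (f (x - t))" 1] f01 by (simp add: \<zeta>_def norm_divide)
  next
    fix x y e assume *: "x - y \<in> almost_periods f e"
    have "\<bar>f (x - t) - f (y - t)\<bar> \<le> e" for t
      using almost_periodsD[OF *, of "y - t"] by (simp add: algebra_simps)
    then have le: "norm (complex_of_real (f (x - t) - f (y - t))) \<le> e" for t
      by (simp only: norm_of_real)
    then have "e \<ge> 0" using norm_ge_zero order_trans by blast
    with le have "norm (\<Sum>t\<in>K. of_real (f (x - t) - f (y - t)) * \<xi> t) / norm (?N * F) \<le> 1/\<delta> * e"
      by (rule bound)
    moreover have "\<zeta> x - \<zeta> y = (\<Sum>t\<in>K. of_real (f (x - t) - f (y - t)) * \<xi> t) / (?N * F)"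
      by (simp add: \<zeta>_def diff_divide_distrib[symmetric] sum_subtractf[symmetric] algebra_simps)
    ultimately show "norm (\<zeta> x - \<zeta> y) \<le> 1/\<delta> * e" by (simp add: norm_divide)
  qed
qed

lemma compact_bounded_functions: "compact {\<zeta>::'a \<Rightarrow> complex. \<forall>x. norm (\<zeta> x) \<le> C}"
proof -
  have "compactin (product_topology (\<lambda>i::'a. euclidean :: complex topology) UNIV) (PiE UNIV (\<lambda>_. cball 0 C))"
    unfolding compactin_PiE by (auto simp: compactin_euclidean_iff)
  moreover have "PiE UNIV (\<lambda>_::'a. cball (0::complex) C) = {\<zeta>. \<forall>x. norm (\<zeta> x) \<le> C}" by (auto simp: PiE_iff)
  ultimately show ?thesis by (simp add: euclidean_product_topology compactin_euclidean_iff)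
qed

text \<open>
  The extensions just constructed live in a compact product of discs and satisfy closed conditions
  that become stronger along the chain of subgroups, so they have a common accumulation point.
\<close>

lemma char_on_dense_union:
  fixes f :: "'a::{topological_ab_group_add, t2_space} \<Rightarrow> real" and K :: "nat \<Rightarrow> 'a set"
  assumes K: "\<And>j. add_subgroup (K j)" "\<And>j. finite (K j)" "mono K"
    and f01: "\<And>x. 0 \<le> f x" "\<And>x. f x \<le> 1" and d: "\<delta> > 0"
    and large: "\<And>j. j0 \<le> j \<Longrightarrow>
      \<exists>\<xi>\<in>subgroup_chars (K j). \<delta> \<le> norm (1 - \<xi> a) \<and> \<delta> \<le> norm (finite_fourier (K j) (\<lambda>x. of_real (f x)) \<xi>)"
    and a: "a \<in> K j0"
  obtains \<zeta> :: "'a \<Rightarrow> complex" where "\<delta> \<le> norm (1 - \<zeta> a)"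
    "\<And>x y e. x - y \<in> almost_periods f e \<Longrightarrow> norm (\<zeta> x - \<zeta> y) \<le> 1/\<delta> * e"
    "\<And>j x. x \<in> K j \<Longrightarrow> norm (\<zeta> x) = 1" "\<And>j x y. x \<in> K j \<Longrightarrow> y \<in> K j \<Longrightarrow> \<zeta> (x + y) = \<zeta> x * \<zeta> y"
proof -
  define F where "F = (\<lambda>j. {\<zeta>::'a \<Rightarrow> complex. \<delta> \<le> norm (1 - \<zeta> a) \<and>
     (\<forall>x y e. x - y \<in> almost_periods f e \<longrightarrow> norm (\<zeta> x - \<zeta> y) \<le> 1/\<delta> * e) \<and>
     (\<forall>x. x \<in> K j \<longrightarrow> norm (\<zeta> x) = 1) \<and> (\<forall>x y. x \<in> K j \<longrightarrow> y \<in> K j \<longrightarrow> \<zeta> (x + y) = \<zeta> x * \<zeta> y)})"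
  define S where "S = {\<zeta>::'a \<Rightarrow> complex. \<forall>x. norm (\<zeta> x) \<le> 1/\<delta>}"
  have cl: "closed (F j)" for j
    unfolding F_def
    by (intro closed_Collect_conj closed_Collect_all closed_Collect_imp open_Collect_const
        closed_Collect_le closed_Collect_eq continuous_intros continuous_on_product_coordinates)
  have ne: "S \<inter> (\<Inter>j\<in>I. F j) \<noteq> {}" if I: "finite I" for I
  proof -
    define m where "m = Max (insert j0 I)"
    have m: "j0 \<le> m" "\<And>i. i \<in> I \<Longrightarrow> i \<le> m" using I by (auto simp: m_def)
    obtain \<xi> where xi: "\<xi> \<in> subgroup_chars (K m)" "\<delta> \<le> norm (1 - \<xi> a)"
      "\<delta> \<le> norm (finite_fourier (K m) (\<lambda>x. of_real (f x)) \<xi>)" using large[OF m(1)] by blast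
    obtain \<zeta> where z: "\<And>x. x \<in> K m \<Longrightarrow> \<zeta> x = \<xi> x" "\<And>x. norm (\<zeta> x) \<le> 1/\<delta>"
      "\<And>x y e. x - y \<in> almost_periods f e \<Longrightarrow> norm (\<zeta> x - \<zeta> y) \<le> 1/\<delta> * e"
      using subgroup_char_smooth_extension[OF K(1) K(2) xi(1) d xi(3) f01] by metis
    have Km: "K i \<subseteq> K m" if "i \<le> m" for i using K(3) that by (auto dest: monoD)
    have "\<zeta> \<in> F i" if "i \<in> I" for i
      unfolding F_def
    proof (intro CollectI conjI allI impI)
      show "\<delta> \<le> norm (1 - \<zeta> a)" using z(1)[of a] xi(2) a Km[OF m(1)] by auto
    next
      fix x assume "x \<in> K i" then show "norm (\<zeta> x) = 1"
        using Km[OF m(2)[OF that]] z(1) subgroup_charsD(1)[OF xi(1)] by auto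
    next
      fix x y assume "x \<in> K i" "y \<in> K i"
      then have "x \<in> K m" "y \<in> K m" "x + y \<in> K m" using Km[OF m(2)[OF that]] K(1) add_subgroup_add by blast+
      then show "\<zeta> (x + y) = \<zeta> x * \<zeta> y" using z(1) subgroup_charsD(2)[OF xi(1)] by simp
    qed (rule z(3))
    then show ?thesis using z(2) by (auto simp: S_def)
  qed
  have "S \<inter> (\<Inter>j\<in>UNIV. F j) \<noteq> {}"
    by (rule compact_imp_fip_image) (use compact_bounded_functions cl ne in \<open>auto simp: S_def\<close>)
  then obtain \<zeta> where "\<And>j. \<zeta> \<in> F j" by auto
  then show ?thesis using that[of \<zeta>] unfolding F_def by blast
qed

lemma dual_groupD:
  assumes "\<xi> \<in> dual_group"
  shows "continuous_on UNIV \<xi>" "norm (\<xi> x) = 1" "\<xi> (x + y) = \<xi> x * \<xi> y"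
  using assms by (auto simp: dual_group_def)

text \<open>
  Multiplicativity and absolute value one are closed conditions and pass from the dense union to the
  whole group.
\<close>

lemma equicontinuous_char_in_dual:
  fixes f :: "'a::{topological_ab_group_add, t2_space} \<Rightarrow> real" and K :: "nat \<Rightarrow> 'a set"
    and \<zeta> :: "'a \<Rightarrow> complex"
  assumes G: "compact (UNIV :: 'a set)" and f: "continuous_on UNIV f"
    and K: "mono K" "closure (\<Union>j. K j) = UNIV"
    and C: "C > 0" "\<And>x y e. x - y \<in> almost_periods f e \<Longrightarrow> norm (\<zeta> x - \<zeta> y) \<le> C * e"
    and z: "\<And>j x. x \<in> K j \<Longrightarrow> norm (\<zeta> x) = 1" "\<And>j x y. x \<in> K j \<Longrightarrow> y \<in> K j \<Longrightarrow> \<zeta> (x + y) = \<zeta> x * \<zeta> y"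
  shows "\<zeta> \<in> dual_group"
proof -
  have cont: "continuous_on UNIV \<zeta>"
    unfolding continuous_on_def
  proof (intro ballI tendstoI)
    fix x and e :: real assume "e > 0"
    let ?U = "interior (almost_periods f (e / (2 * C)))"
    have "0 \<in> ?U" using almost_periods_nhds[OF G f, of "e / (2 * C)"] \<open>e > 0\<close> C(1) by simp
    moreover have "open ((\<lambda>y. y - x) -` ?U)" by (intro open_vimage continuous_intros) auto
    ultimately have "\<forall>\<^sub>F y in nhds x. y - x \<in> ?U"
      using eventually_nhds_in_open[of "(\<lambda>y. y - x) -` ?U" x] by simp
    then have "\<forall>\<^sub>F y in nhds x. dist (\<zeta> y) (\<zeta> x) < e"
    proof eventually_elim
      case (elim y)
      then have "norm (\<zeta> y - \<zeta> x) \<le> C * (e / (2 * C))" using C(2) interior_subset by blast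
      also have "\<dots> < e" using C(1) \<open>e > 0\<close> by simp
      finally show ?case by (simp add: dist_norm)
    qed
    then show "\<forall>\<^sub>F y in at x within UNIV. dist (\<zeta> y) (\<zeta> x) < e"
      by (simp add: eventually_nhds_conv_at)
  qed
  let ?D = "\<Union>j. K j"
  have "closed {x. norm (\<zeta> x) = 1}" by (intro closed_Collect_eq continuous_intros cont)
  then have "closure ?D \<subseteq> {x. norm (\<zeta> x) = 1}" using z(1) by (intro closure_minimal) auto
  then have n: "norm (\<zeta> x) = 1" for x using K(2) by auto
  have "closed {u::'a \<times> 'a. \<zeta> (fst u + snd u) = \<zeta> (fst u) * \<zeta> (snd u)}"
    by (intro closed_Collect_eq continuous_intros continuous_on_compose2[OF cont]) auto
  moreover have "?D \<times> ?D \<subseteq> {u. \<zeta> (fst u + snd u) = \<zeta> (fst u) * \<zeta> (snd u)}"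
  proof clarsimp
    fix x y i j assume "x \<in> K i" "y \<in> K j"
    then have "x \<in> K (max i j)" "y \<in> K (max i j)" using K(1) by (meson in_mono max.cobounded1 max.cobounded2 monoD)+
    then show "\<zeta> (x + y) = \<zeta> x * \<zeta> y" by (rule z(2))
  qed
  ultimately have sub: "closure (?D \<times> ?D) \<subseteq> {u. \<zeta> (fst u + snd u) = \<zeta> (fst u) * \<zeta> (snd u)}"
    by (rule closure_minimal[rotated])
  have "\<zeta> (x + y) = \<zeta> x * \<zeta> y" for x y
  proof -
    have "(x, y) \<in> closure (?D \<times> ?D)" by (simp add: closure_Times K(2))
    then show ?thesis using sub by auto
  qed
  then show ?thesis using cont n by (simp add: dual_group_def)
qed

lemma normal_space_compact_t2:
  assumes "compact (UNIV :: 'a::t2_space set)"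
  shows "normal_space (euclidean :: 'a::t2_space topology)"
proof (rule compact_Hausdorff_or_regular_imp_normal_space)
  show "compact_space (euclidean :: 'a topology)" using assms by (simp add: compact_space_def compactin_euclidean_iff)
  have "Hausdorff_space (euclidean :: 'a topology)"
    unfolding Hausdorff_space_def disjnt_def by simp (metis hausdorff)
  then show "Hausdorff_space (euclidean :: 'a topology) \<or> regular_space (euclidean :: 'a topology)" ..
qed

lemma Urysohn_compact_t2:
  fixes S T :: "'a::t2_space set"
  assumes "compact (UNIV :: 'a set)" "closed S" "closed T" "S \<inter> T = {}"
  obtains f :: "'a \<Rightarrow> real" where "continuous_on UNIV f" "\<And>x. 0 \<le> f x" "\<And>x. f x \<le> 1"
    "\<And>x. x \<in> S \<Longrightarrow> f x = 0" "\<And>x. x \<in> T \<Longrightarrow> f x = 1"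
proof -
  obtain f where "continuous_map (euclidean :: 'a topology) (top_of_set {0..1::real}) f" "f ` S \<subseteq> {0}" "f ` T \<subseteq> {1}"
    using Urysohn_lemma[OF normal_space_compact_t2[OF assms(1)], of S T 0 1] assms(2-)
    by (auto simp: disjnt_def)
  then have "continuous_on UNIV f" "f ` UNIV \<subseteq> {0..1}" "f ` S \<subseteq> {0}" "f ` T \<subseteq> {1}"
    by (auto simp: continuous_map_in_subtopology)
  then show ?thesis by (intro that[of f]) (auto simp: image_subset_iff)
qed

text \<open>
  A continuous \<open>f\<close> that is \<open>1\<close> at \<open>0\<close> and \<open>0\<close> at \<open>- a\<close> provides characters of the finite subgroups whose values
  near \<open>a\<close> stay away from \<open>1\<close>; their limit along the chain is the required character of the group.
\<close>

theorem dual_group_separates: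
  fixes a :: "'a::{topological_ab_group_add, t2_space}"
    and K :: "nat \<Rightarrow> 'a set"
  assumes G: "compact (UNIV :: 'a set)"
    and K: "\<And>j. add_subgroup (K j)" "\<And>j. finite (K j)" "mono K" "closure (\<Union>j. K j) = UNIV"
    and a: "a \<noteq> 0"
  obtains \<xi> where "\<xi> \<in> dual_group" "\<xi> a \<noteq> 1"
proof -
  obtain f :: "'a \<Rightarrow> real" where f: "continuous_on UNIV f" "\<And>x. 0 \<le> f x" "\<And>x. f x \<le> 1" "f (- a) = 0" "f 0 = 1"
    using Urysohn_compact_t2[OF G, of "{- a}" "{0}"] a by auto
  obtain \<delta> where d: "\<delta> > 0"
    "\<And>K a. add_subgroup K \<Longrightarrow> finite K \<Longrightarrow> a \<in> K \<Longrightarrow> f (- a) \<le> 1/4 \<Longrightarrow>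
      \<exists>\<xi>\<in>subgroup_chars K. \<delta> \<le> norm (1 - \<xi> a) \<and> \<delta> \<le> norm (finite_fourier K (\<lambda>x. of_real (f x)) \<xi>)"
    using subgroup_char_large_coefficient[OF G f(1,2,3,5)] by metis
  \<comment> \<open>The point need not lie in the dense union; it is replaced by a point \<open>b\<close> that does and is so
    close to \<open>a\<close> that the limit character changes by less than \<open>\<delta>\<close> between them.\<close>
  define W where "W = {b. f (- b) < 1/4} \<inter> (\<lambda>b. b - a) -` interior (almost_periods f (\<delta>\<^sup>2 / 2))"
  have "open W" unfolding W_def
    by (intro open_Int open_Collect_less open_vimage continuous_intros continuous_on_compose2[OF f(1)]) auto
  moreover have "a \<in> W" using f(4) almost_periods_nhds[OF G f(1), of "\<delta>\<^sup>2 / 2"] d(1) by (simp add: W_def)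
  ultimately have "W \<inter> (\<Union>j. K j) \<noteq> {}"
    using open_Int_closure_eq_empty[of W "\<Union>j. K j"] K(4) by auto
  then obtain b j0 where b: "b \<in> W" "b \<in> K j0" by blast
  have large: "\<exists>\<xi>\<in>subgroup_chars (K j). \<delta> \<le> norm (1 - \<xi> b) \<and> \<delta> \<le> norm (finite_fourier (K j) (\<lambda>x. of_real (f x)) \<xi>)"
    if "j0 \<le> j" for j
    using b monoD[OF K(3) that] by (intro d(2) K) (auto simp: W_def)
  show ?thesis
  proof (rule char_on_dense_union[OF K(1,2,3) f(2,3) d(1) large b(2)])
    fix \<zeta> :: "'a \<Rightarrow> complex"
    assume z: "\<delta> \<le> norm (1 - \<zeta> b)"
      "\<And>x y e. x - y \<in> almost_periods f e \<Longrightarrow> norm (\<zeta> x - \<zeta> y) \<le> 1/\<delta> * e"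
      "\<And>j x. x \<in> K j \<Longrightarrow> norm (\<zeta> x) = 1" "\<And>j x y. x \<in> K j \<Longrightarrow> y \<in> K j \<Longrightarrow> \<zeta> (x + y) = \<zeta> x * \<zeta> y"
    have "\<zeta> \<in> dual_group"
      by (rule equicontinuous_char_in_dual[OF G f(1) K(3,4) _ z(2,3,4)]) (use d(1) in simp)
    moreover have "b - a \<in> almost_periods f (\<delta>\<^sup>2 / 2)"
      using b(1) interior_subset unfolding W_def by blast
    from z(2)[OF this] have "norm (\<zeta> b - \<zeta> a) < \<delta>" using d(1) by (simp add: power2_eq_square)
    then have "\<zeta> a \<noteq> 1" using z(1) by (auto simp: norm_minus_commute)
    ultimately show ?thesis by (rule that)
  qed
qed


section \<open>Trigonometric polynomials\<close>

lemma char_zero_in_dual: "char_zero \<in> dual_group"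
  by (simp add: dual_group_def char_zero_def)

lemma dual_group_mult:
  fixes \<xi> \<eta> :: "'a::topological_ab_group_add \<Rightarrow> complex"
  assumes "\<xi> \<in> dual_group" "\<eta> \<in> dual_group" shows "(\<lambda>x. \<xi> x * \<eta> x) \<in> dual_group"
  using assms by (auto simp: dual_group_def norm_mult intro!: continuous_intros)

lemma dual_group_cnj:
  assumes "\<xi> \<in> dual_group" shows "(\<lambda>x. cnj (\<xi> x)) \<in> dual_group"
  using assms by (auto simp: dual_group_def intro!: continuous_intros)

lemma dual_group_mult_cnj: "\<xi> \<in> dual_group \<Longrightarrow> \<xi> x * cnj (\<xi> x) = 1"
  using dual_groupD(2)[of \<xi> x] by (simp add: complex_norm_square[symmetric])

lemma dual_group_zero:
  assumes "\<xi> \<in> dual_group" shows "\<xi> 0 = 1"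
proof -
  have "\<xi> 0 = \<xi> 0 * \<xi> 0" using dual_groupD(3)[OF assms, of 0 0] by simp
  moreover have "\<xi> 0 \<noteq> 0" using dual_groupD(2)[OF assms, of 0] by auto
  ultimately show ?thesis by simp
qed

lemma dual_group_uminus:
  assumes "\<xi> \<in> dual_group" shows "\<xi> (- x) = cnj (\<xi> x)"
proof -
  have "\<xi> x * \<xi> (- x) = \<xi> x * cnj (\<xi> x)"
    using dual_groupD(3)[OF assms, of x "- x"] dual_group_zero[OF assms] dual_group_mult_cnj[OF assms] by simp
  moreover have "\<xi> x \<noteq> 0" using dual_groupD(2)[OF assms, of x] by auto
  ultimately show ?thesis by simp
qed

lemma dual_group_diff: "\<xi> \<in> dual_group \<Longrightarrow> \<xi> (x - y) = \<xi> x * cnj (\<xi> y)"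
  using dual_groupD(3)[of \<xi> x "- y"] by (simp add: dual_group_uminus)

text \<open>
  An inductive definition rather than explicit finite sums, so that statements about trigonometric
  polynomials reduce by linearity to statements about characters.
\<close>

inductive trig_poly :: "('a::topological_ab_group_add \<Rightarrow> complex) \<Rightarrow> bool" where
  char: "\<xi> \<in> dual_group \<Longrightarrow> trig_poly \<xi>"
| scale: "trig_poly f \<Longrightarrow> trig_poly (\<lambda>x. c * f x)"
| add: "trig_poly f \<Longrightarrow> trig_poly g \<Longrightarrow> trig_poly (\<lambda>x. f x + g x)"

lemma trig_poly_const: "trig_poly (\<lambda>x. c)"
  using trig_poly.scale[OF trig_poly.char[OF char_zero_in_dual], of c] by (simp add: char_zero_def)

lemma trig_poly_diff: "trig_poly f \<Longrightarrow> trig_poly g \<Longrightarrow> trig_poly (\<lambda>x. f x - g x)"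
  using trig_poly.add[of f "\<lambda>x. - 1 * g x"] trig_poly.scale[of g "- 1"] by simp

lemma trig_poly_char_mult:
  assumes "trig_poly g" "\<xi> \<in> dual_group" shows "trig_poly (\<lambda>x. \<xi> x * g x)"
  using assms(1)
proof induction
  case (char \<eta>) then show ?case using trig_poly.char dual_group_mult assms(2) by blast
next
  case (scale f c) then show ?case using trig_poly.scale[of "\<lambda>x. \<xi> x * f x" c] by (simp add: mult_ac)
next
  case (add f g) then show ?case
    using trig_poly.add[of "\<lambda>x. \<xi> x * f x" "\<lambda>x. \<xi> x * g x"] by (simp add: algebra_simps)
qed

lemma trig_poly_mult:
  assumes "trig_poly f" "trig_poly g" shows "trig_poly (\<lambda>x. f x * g x)"
  using assms(1)
proof induction
  case (char \<eta>) then show ?case using trig_poly_char_mult assms(2) by blast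
next
  case (scale f c) then show ?case using trig_poly.scale[of "\<lambda>x. f x * g x" c] by (simp add: mult_ac)
next
  case (add f h) then show ?case
    using trig_poly.add[of "\<lambda>x. f x * g x" "\<lambda>x. h x * g x"] by (simp add: algebra_simps)
qed

lemma trig_poly_continuous: "trig_poly f \<Longrightarrow> continuous_on UNIV f"
  by (induction rule: trig_poly.induct) (auto intro!: continuous_intros dest: dual_groupD(1))

text \<open>
  The real-valued trigonometric polynomials form an algebra of functions; it separates points
  because it contains the real and imaginary parts of characters.
\<close>

lemma trig_poly_uniformly_dense_real:
  fixes f :: "'a::{topological_ab_group_add, t2_space} \<Rightarrow> real"
  assumes G: "compact (UNIV :: 'a set)" and sep: "\<And>a::'a. a \<noteq> 0 \<Longrightarrow> \<exists>\<xi>\<in>dual_group. \<xi> a \<noteq> 1"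
    and f: "continuous_on UNIV f" and e: "e > 0"
  obtains g where "trig_poly (\<lambda>x. complex_of_real (g x))" "\<And>x. \<bar>f x - g x\<bar> < e"
proof -
  let ?P = "\<lambda>g::'a \<Rightarrow> real. trig_poly (\<lambda>x. complex_of_real (g x))"
  have "\<exists>g. ?P g \<and> (\<forall>x\<in>UNIV. \<bar>f x - g x\<bar> < e)"
  proof (rule Stone_Weierstrass_HOL[OF G])
    show "?P (\<lambda>x. c)" for c by (rule trig_poly_const)
    show "continuous_on UNIV g" if "?P g" for g
      using continuous_on_Re[OF trig_poly_continuous[OF that]] by simp
    show "?P (\<lambda>x. g x + h x)" if "?P g \<and> ?P h" for g h
      using trig_poly.add[of "\<lambda>x. of_real (g x)" "\<lambda>x. of_real (h x)"] that by simp
    show "?P (\<lambda>x. g x * h x)" if "?P g \<and> ?P h" for g h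
      using trig_poly_mult[of "\<lambda>x. of_real (g x)" "\<lambda>x. of_real (h x)"] that by simp
    show "\<exists>g. ?P g \<and> g x \<noteq> g y" if xy: "x \<in> UNIV \<and> y \<in> UNIV \<and> x \<noteq> y" for x y
    proof -
      obtain \<xi> where xi: "\<xi> \<in> dual_group" "\<xi> (x - y) \<noteq> 1" using sep[of "x - y"] xy by auto
      have "\<xi> x \<noteq> \<xi> y" using xi dual_group_diff[OF xi(1), of x y] dual_group_mult_cnj[OF xi(1)] by auto
      moreover have "?P (\<lambda>x. Re (\<xi> x))"
        using trig_poly.scale[OF trig_poly.add[OF trig_poly.char[OF xi(1)] trig_poly.char[OF dual_group_cnj[OF xi(1)]]], of "1/2"]
        by (simp add: complex_add_cnj)
      moreover have "?P (\<lambda>x. Im (\<xi> x))"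
      proof -
        have "(\<lambda>x. - (\<i> / 2) * (\<xi> x - cnj (\<xi> x))) = (\<lambda>x. complex_of_real (Im (\<xi> x)))"
          by (simp add: fun_eq_iff complex_eq_iff)
        then show ?thesis
          using trig_poly.scale[OF trig_poly_diff[OF trig_poly.char[OF xi(1)]
              trig_poly.char[OF dual_group_cnj[OF xi(1)]]], of "- (\<i> / 2)"] by simp
      qed
      ultimately show ?thesis by (metis complex_eqI)
    qed
  qed (use f e in auto)
  then show ?thesis using that by auto
qed

lemma trig_poly_uniformly_dense:
  fixes f :: "'a::{topological_ab_group_add, t2_space} \<Rightarrow> complex"
  assumes G: "compact (UNIV :: 'a set)" and sep: "\<And>a::'a. a \<noteq> 0 \<Longrightarrow> \<exists>\<xi>\<in>dual_group. \<xi> a \<noteq> 1"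
    and f: "continuous_on UNIV f" and e: "e > 0"
  obtains q where "trig_poly q" "\<And>x. norm (f x - q x) < e"
proof -
  obtain g where g: "trig_poly (\<lambda>x. complex_of_real (g x))" "\<And>x. \<bar>Re (f x) - g x\<bar> < e/2"
    using trig_poly_uniformly_dense_real[OF G sep, of "\<lambda>x. Re (f x)" "e/2"] f e
    by (auto intro!: continuous_intros)
  obtain h where h: "trig_poly (\<lambda>x. complex_of_real (h x))" "\<And>x. \<bar>Im (f x) - h x\<bar> < e/2"
    using trig_poly_uniformly_dense_real[OF G sep, of "\<lambda>x. Im (f x)" "e/2"] f e
    by (auto intro!: continuous_intros)
  define q where "q = (\<lambda>x. complex_of_real (g x) + \<i> * complex_of_real (h x))"
  have "norm (f x - q x) < e" for x
  proof -
    have "norm (f x - q x) \<le> \<bar>Re (f x - q x)\<bar> + \<bar>Im (f x - q x)\<bar>" by (rule cmod_le)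
    then show ?thesis using g(2)[of x] h(2)[of x] by (simp add: q_def)
  qed
  moreover have "trig_poly q" unfolding q_def using g(1) h(1) by (intro trig_poly.add trig_poly.scale)
  ultimately show ?thesis using that by blast
qed


section \<open>Density of trigonometric polynomials in \<open>L\<^sup>p\<close>\<close>

text \<open>
  The \<open>p\<close>-th power of the seminorm. It is subadditive up to a constant by an elementary inequality and is
  compatible with dominated convergence, and smallness of the power and of the seminorm are
  equivalent.
\<close>

definition Lp_power :: "'a measure \<Rightarrow> real \<Rightarrow> ('a \<Rightarrow> complex) \<Rightarrow> real" where
  "Lp_power M p f = (LINT x|M. norm (f x) powr p)"

lemma Lp_power_nonneg: "Lp_power M p f \<ge> 0"
  by (simp add: Lp_power_def)

lemma Lp_norm_less_iff:
  assumes "p \<ge> 1" "e > 0" shows "Lp_norm M p f < e \<longleftrightarrow> Lp_power M p f < e powr p"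
proof -
  have "Lp_power M p f = Lp_norm M p f powr p"
    using assms Lp_power_nonneg[of M p f] by (simp add: Lp_norm_def Lp_power_def powr_powr)
  moreover have "Lp_norm M p f \<ge> 0" by (simp add: Lp_norm_def)
  ultimately show ?thesis
    using assms powr_less_mono2[of p "Lp_norm M p f" e] powr_mono2[of p e "Lp_norm M p f"]
    by (cases "Lp_norm M p f < e") auto
qed

lemma LpD: "f \<in> Lp M p \<Longrightarrow> f \<in> borel_measurable M" "f \<in> Lp M p \<Longrightarrow> integrable M (\<lambda>x. norm (f x) powr p)"
  by (auto simp: Lp_def)

lemma norm_add_powr_le:
  fixes a b :: complex
  assumes "p \<ge> 1" shows "norm (a + b) powr p \<le> 2 powr p * (norm a powr p + norm b powr p)"
proof -
  have "norm (a + b) powr p \<le> (2 * max (norm a) (norm b)) powr p"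
    using assms by (intro powr_mono2) (auto intro: order_trans[OF norm_triangle_ineq])
  also have "\<dots> = 2 powr p * max (norm a) (norm b) powr p" by (simp add: powr_mult)
  also have "\<dots> \<le> 2 powr p * (norm a powr p + norm b powr p)" by (auto simp: max_def)
  finally show ?thesis .
qed

lemma Lp_add:
  assumes p: "p \<ge> 1" and f: "f \<in> Lp M p" and g: "g \<in> Lp M p"
  shows "(\<lambda>x. f x + g x) \<in> Lp M p"
    and "Lp_power M p (\<lambda>x. f x + g x) \<le> 2 powr p * (Lp_power M p f + Lp_power M p g)"
proof -
  note [measurable] = LpD(1)[OF f] LpD(1)[OF g]
  have i: "integrable M (\<lambda>x. 2 powr p * (norm (f x) powr p + norm (g x) powr p))"
    using LpD(2)[OF f] LpD(2)[OF g] by simp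
  have j: "integrable M (\<lambda>x. norm (f x + g x) powr p)"
    by (rule Bochner_Integration.integrable_bound[OF i])
       (use norm_add_powr_le[OF p] in \<open>auto intro!: AE_I2 intro: order_trans[OF _ abs_ge_self]\<close>)
  then show "(\<lambda>x. f x + g x) \<in> Lp M p" by (simp add: Lp_def)
  have "Lp_power M p (\<lambda>x. f x + g x) \<le> (LINT x|M. 2 powr p * (norm (f x) powr p + norm (g x) powr p))"
    unfolding Lp_power_def by (rule integral_mono[OF j i]) (rule norm_add_powr_le[OF p])
  then show "Lp_power M p (\<lambda>x. f x + g x) \<le> 2 powr p * (Lp_power M p f + Lp_power M p g)"
    using LpD(2)[OF f] LpD(2)[OF g] by (simp add: Lp_power_def)
qed

lemma Lp_scale:
  assumes f: "f \<in> Lp M p"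
  shows "(\<lambda>x. c * f x) \<in> Lp M p" "Lp_power M p (\<lambda>x. c * f x) = norm c powr p * Lp_power M p f"
  using LpD[OF f] by (auto simp: Lp_def Lp_power_def norm_mult powr_mult)

lemma Lp_uminus: "f \<in> Lp M p \<Longrightarrow> (\<lambda>x. - f x) \<in> Lp M p"
  using Lp_scale(1)[of f M p "-1"] by simp

lemma Lp_power_minus_commute: "Lp_power M p (\<lambda>x. f x - g x) = Lp_power M p (\<lambda>x. g x - f x)"
  by (simp add: Lp_power_def norm_minus_commute)

lemma Lp_diff:
  assumes "p \<ge> 1" "f \<in> Lp M p" "g \<in> Lp M p" shows "(\<lambda>x. f x - g x) \<in> Lp M p"
  using Lp_add(1)[OF assms(1,2) Lp_uminus[OF assms(3)]] by simp

lemma Lp_sum: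
  assumes p: "p \<ge> 1" and "finite I" "\<And>i. i \<in> I \<Longrightarrow> f i \<in> Lp M p"
  shows "(\<lambda>x. \<Sum>i\<in>I. f i x) \<in> Lp M p"
  using assms(2,3)
proof (induction I rule: finite_induct)
  case empty then show ?case by (simp add: Lp_def)
next
  case (insert i I) then show ?case using Lp_add(1)[OF p, of "f i" M "\<lambda>x. \<Sum>i\<in>I. f i x"] by simp
qed

lemma Lp_bounded:
  assumes "finite_measure M" "f \<in> borel_measurable M" "\<And>x. norm (f x) \<le> B" "p \<ge> 1"
  shows "f \<in> Lp M p"
proof -
  interpret finite_measure M by fact
  have "integrable M (\<lambda>x. norm (f x) powr p)"
    by (rule integrable_const_bound[where B = "B powr p"])
       (use assms in \<open>auto intro!: AE_I2 powr_mono2\<close>)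
  then show ?thesis using assms by (simp add: Lp_def)
qed

lemma continuous_in_Lp:
  fixes f :: "'a::topological_space \<Rightarrow> complex"
  assumes "compact (UNIV :: 'a set)" "finite_measure N" "sets N = sets borel" "continuous_on UNIV f" "p \<ge> 1"
  shows "f \<in> Lp N p"
proof -
  have "compact (range f)" using assms by (intro compact_continuous_image) auto
  then obtain B where "\<And>x. norm (f x) \<le> B" using compact_imp_bounded bounded_iff by (metis rangeI)
  moreover have "f \<in> borel_measurable N"
    using borel_measurable_continuous_onI[OF assms(4)] measurable_cong_sets[OF assms(3) refl] by blast
  ultimately show ?thesis using Lp_bounded assms by blast
qed

definition Lp_limits :: "'a measure \<Rightarrow> real \<Rightarrow> ('a \<Rightarrow> complex) set \<Rightarrow> ('a \<Rightarrow> complex) set" where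
  "Lp_limits M p S = {f \<in> Lp M p. \<forall>e>0. \<exists>g\<in>S. Lp_power M p (\<lambda>x. f x - g x) < e}"

lemma Lp_closure_eq_limits:
  assumes p: "p \<ge> 1" shows "Lp_closure M p S = Lp_limits M p S"
proof -
  have "(\<forall>e>0. \<exists>g\<in>S. Lp_norm M p (\<lambda>x. f x - g x) < e)
      \<longleftrightarrow> (\<forall>e>0. \<exists>g\<in>S. Lp_power M p (\<lambda>x. f x - g x) < e)" (is "?norm \<longleftrightarrow> ?power") for f
  proof
    assume *: ?norm
    show ?power
    proof (intro allI impI)
      fix e :: real assume e: "e > 0"
      then have d: "e powr (1 / p) > 0" "(e powr (1 / p)) powr p = e" using p by (auto simp: powr_powr)
      show "\<exists>g\<in>S. Lp_power M p (\<lambda>x. f x - g x) < e"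
        using * d(1) Lp_norm_less_iff[OF p d(1)] unfolding d(2) by blast
    qed
  next
    assume *: ?power
    show ?norm
    proof (intro allI impI)
      fix e :: real assume e: "e > 0"
      then have "e powr p > 0" by simp
      then show "\<exists>g\<in>S. Lp_norm M p (\<lambda>x. f x - g x) < e"
        using * Lp_norm_less_iff[OF p e] by blast
    qed
  qed
  then show ?thesis by (simp add: Lp_closure_def Lp_limits_def)
qed

lemma Lp_limits_add:
  assumes p: "p \<ge> 1" and S: "S \<subseteq> Lp M p" "\<And>u v. u \<in> S \<Longrightarrow> v \<in> S \<Longrightarrow> (\<lambda>x. u x + v x) \<in> S"
    and f: "f \<in> Lp_limits M p S" and g: "g \<in> Lp_limits M p S"
  shows "(\<lambda>x. f x + g x) \<in> Lp_limits M p S"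
proof -
  have L: "f \<in> Lp M p" "g \<in> Lp M p" using f g by (auto simp: Lp_limits_def)
  have "\<exists>h\<in>S. Lp_power M p (\<lambda>x. f x + g x - h x) < e" if "e > 0" for e
  proof -
    let ?e = "e / (2 * 2 powr p)"
    have e: "?e > 0" using that by simp
    obtain u where u: "u \<in> S" "Lp_power M p (\<lambda>x. f x - u x) < ?e"
      using f e unfolding Lp_limits_def by blast
    obtain v where v: "v \<in> S" "Lp_power M p (\<lambda>x. g x - v x) < ?e"
      using g e unfolding Lp_limits_def by blast
    have uv: "u \<in> Lp M p" "v \<in> Lp M p" using S(1) u v by auto
    have "Lp_power M p (\<lambda>x. f x + g x - (u x + v x)) = Lp_power M p (\<lambda>x. (f x - u x) + (g x - v x))"
      by (simp add: algebra_simps)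
    also have "\<dots> \<le> 2 powr p * (Lp_power M p (\<lambda>x. f x - u x) + Lp_power M p (\<lambda>x. g x - v x))"
      by (rule Lp_add(2)[OF p Lp_diff[OF p L(1) uv(1)] Lp_diff[OF p L(2) uv(2)]])
    also have "\<dots> < 2 powr p * (?e + ?e)" using u v by (intro mult_strict_left_mono) auto
    also have "\<dots> = e" by simp
    finally have "Lp_power M p (\<lambda>x. f x + g x - (u x + v x)) < e" .
    then show ?thesis by (intro bexI[of _ "\<lambda>x. u x + v x"] S(2) u v)
  qed
  then show ?thesis using Lp_add(1)[OF p L] by (simp add: Lp_limits_def)
qed

lemma Lp_limits_scale:
  assumes p: "p \<ge> 1" and S: "S \<subseteq> Lp M p" "\<And>c u. u \<in> S \<Longrightarrow> (\<lambda>x. c * u x) \<in> S"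
    and f: "f \<in> Lp_limits M p S"
  shows "(\<lambda>x. c * f x) \<in> Lp_limits M p S"
proof -
  have L: "f \<in> Lp M p" using f by (simp add: Lp_limits_def)
  have "\<exists>h\<in>S. Lp_power M p (\<lambda>x. c * f x - h x) < e" if "e > 0" for e
  proof -
    let ?e = "e / (norm c powr p + 1)"
    have pos: "norm c powr p + 1 > 0" by (simp add: add_nonneg_pos)
    then have "?e > 0" using \<open>e > 0\<close> by (intro divide_pos_pos)
    then obtain u where u: "u \<in> S" "Lp_power M p (\<lambda>x. f x - u x) < ?e"
      using f unfolding Lp_limits_def by blast
    have uL: "u \<in> Lp M p" using S(1) u by auto
    have "Lp_power M p (\<lambda>x. c * f x - c * u x) = norm c powr p * Lp_power M p (\<lambda>x. f x - u x)"
      using Lp_scale(2)[OF Lp_diff[OF p L uL], of c] by (simp add: algebra_simps)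
    also have "\<dots> \<le> (norm c powr p + 1) * Lp_power M p (\<lambda>x. f x - u x)"
      by (intro mult_right_mono) (auto simp: Lp_power_nonneg)
    also have "\<dots> < (norm c powr p + 1) * ?e" using u pos by (intro mult_strict_left_mono)
    also have "\<dots> = e" using pos by simp
    finally have "Lp_power M p (\<lambda>x. c * f x - c * u x) < e" .
    then show ?thesis by (intro bexI[of _ "\<lambda>x. c * u x"] S(2) u)
  qed
  then show ?thesis using Lp_scale(1)[OF L] by (simp add: Lp_limits_def)
qed

lemma Lp_limits_closed:
  assumes p: "p \<ge> 1" and S: "S \<subseteq> Lp M p" and f: "f \<in> Lp M p"
    and lim: "\<And>e. e > 0 \<Longrightarrow> \<exists>g\<in>Lp_limits M p S. Lp_power M p (\<lambda>x. f x - g x) < e"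
  shows "f \<in> Lp_limits M p S"
proof -
  have "\<exists>h\<in>S. Lp_power M p (\<lambda>x. f x - h x) < e" if "e > 0" for e
  proof -
    let ?e = "e / (2 * 2 powr p)"
    have e: "?e > 0" using that by simp
    then obtain g where g: "g \<in> Lp_limits M p S" "Lp_power M p (\<lambda>x. f x - g x) < ?e" using lim by blast
    then obtain h where h: "h \<in> S" "Lp_power M p (\<lambda>x. g x - h x) < ?e"
      using e unfolding Lp_limits_def by blast
    have gL: "g \<in> Lp M p" and hL: "h \<in> Lp M p" using g h S by (auto simp: Lp_limits_def)
    have "Lp_power M p (\<lambda>x. f x - h x) = Lp_power M p (\<lambda>x. (f x - g x) + (g x - h x))" by simp
    also have "\<dots> \<le> 2 powr p * (Lp_power M p (\<lambda>x. f x - g x) + Lp_power M p (\<lambda>x. g x - h x))"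
      by (rule Lp_add(2)[OF p Lp_diff[OF p f gL] Lp_diff[OF p gL hL]])
    also have "\<dots> < 2 powr p * (?e + ?e)" using h g by (intro mult_strict_left_mono) auto
    also have "\<dots> = e" by simp
    finally show ?thesis using h by blast
  qed
  then show ?thesis using f by (simp add: Lp_limits_def)
qed

text \<open>
  Density holds in the \<open>L\<^sup>p\<close> space of every finite Borel measure, not only of Haar measure; the
  uniqueness theorem for Fourier coefficients below depends on this generality.
\<close>

locale compact_group_measure = finite_measure N
  for N :: "'a::{topological_ab_group_add, second_countable_topology, t2_space} measure" and p :: real +
  assumes compact_group: "compact (UNIV :: 'a set)"
    and separates: "\<And>a::'a. a \<noteq> 0 \<Longrightarrow> \<exists>\<xi>\<in>dual_group. \<xi> a \<noteq> 1"
    and sets_eq_borel: "sets N = sets borel"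
    and p_ge_1: "p \<ge> 1"
begin

lemma measurable_N_iff: "f \<in> borel_measurable N \<longleftrightarrow> f \<in> borel_measurable borel"
  using measurable_cong_sets[OF sets_eq_borel refl] by blast

lemma space_N: "space N = UNIV"
  using sets_eq_imp_space_eq[OF sets_eq_borel] by simp

lemma continuous_Lp: "continuous_on UNIV f \<Longrightarrow> f \<in> Lp N p"
  by (rule continuous_in_Lp[OF compact_group finite_measure_axioms sets_eq_borel _ p_ge_1])

lemma trig_poly_Lp: "trig_poly q \<Longrightarrow> q \<in> Lp N p"
  by (intro continuous_Lp trig_poly_continuous)

abbreviation trig_closure :: "('a \<Rightarrow> complex) set" where
  "trig_closure \<equiv> Lp_limits N p {q. trig_poly q}"

lemma trig_poly_subset_Lp: "{q. trig_poly q} \<subseteq> Lp N p"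
  using trig_poly_Lp by blast

lemma trig_closure_add: "f \<in> trig_closure \<Longrightarrow> g \<in> trig_closure \<Longrightarrow> (\<lambda>x. f x + g x) \<in> trig_closure"
  by (rule Lp_limits_add[OF p_ge_1 trig_poly_subset_Lp]) (auto intro: trig_poly.add)

lemma trig_closure_scale: "f \<in> trig_closure \<Longrightarrow> (\<lambda>x. c * f x) \<in> trig_closure"
  by (rule Lp_limits_scale[OF p_ge_1 trig_poly_subset_Lp]) (auto intro: trig_poly.scale)

lemma trig_closure_sum:
  assumes "finite I" "\<And>i. i \<in> I \<Longrightarrow> f i \<in> trig_closure"
  shows "(\<lambda>x. \<Sum>i\<in>I. f i x) \<in> trig_closure"
  using assms
proof (induction I rule: finite_induct)
  case empty
  have "(\<lambda>x. 0::complex) \<in> Lp N p" "trig_poly (\<lambda>x::'a. 0)" by (simp_all add: Lp_def trig_poly_const)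
  then show ?case by (auto simp: Lp_limits_def Lp_power_def intro!: exI[of _ "\<lambda>x. 0"])
next
  case (insert i I) then show ?case using trig_closure_add[of "f i" "\<lambda>x. \<Sum>i\<in>I. f i x"] by simp
qed

lemma trig_closure_dominated:
  assumes f: "f \<in> Lp N p" and s: "\<And>n::nat. s n \<in> trig_closure"
    and lim: "\<And>x. (\<lambda>n. s n x) \<longlonglongrightarrow> f x"
    and w: "integrable N (\<lambda>x. w x powr p)" "\<And>n x. norm (f x - s n x) \<le> w x"
  shows "f \<in> trig_closure"
proof (rule Lp_limits_closed[OF p_ge_1 trig_poly_subset_Lp f])
  fix e :: real assume e: "e > 0"
  have sL: "s n \<in> Lp N p" for n using s by (auto simp: Lp_limits_def)
  have d: "(\<lambda>x. f x - s n x) \<in> Lp N p" for n by (rule Lp_diff[OF p_ge_1 f sL])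
  have "(\<lambda>n. LINT x|N. norm (f x - s n x) powr p) \<longlonglongrightarrow> (LINT x|N. 0)"
  proof (rule integral_dominated_convergence[where w = "\<lambda>x. w x powr p"])
    show "(\<lambda>x. norm (f x - s n x) powr p) \<in> borel_measurable N" for n
      using LpD(2)[OF d] by auto
    show "AE x in N. (\<lambda>n. norm (f x - s n x) powr p) \<longlonglongrightarrow> 0"
    proof (rule AE_I2)
      fix x
      have "(\<lambda>n. norm (f x - s n x)) \<longlonglongrightarrow> norm (f x - f x)"
        by (intro tendsto_intros lim)
      then show "(\<lambda>n. norm (f x - s n x) powr p) \<longlonglongrightarrow> 0"
        using p_ge_1 by (intro tendsto_zero_powrI[where b = p]) auto
    qed
    show "AE x in N. norm (norm (f x - s n x) powr p) \<le> w x powr p" for n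
      using w(2) p_ge_1 by (auto intro!: AE_I2 powr_mono2)
  qed (use w in auto)
  then have "(\<lambda>n. Lp_power N p (\<lambda>x. f x - s n x)) \<longlonglongrightarrow> 0" by (simp add: Lp_power_def)
  then have "\<forall>\<^sub>F n in sequentially. Lp_power N p (\<lambda>x. f x - s n x) < e" using e by (rule order_tendstoD(2))
  then show "\<exists>g\<in>trig_closure. Lp_power N p (\<lambda>x. f x - g x) < e"
    using s by (auto simp: eventually_sequentially)
qed

lemma trig_closure_continuous:
  assumes f: "continuous_on UNIV f" shows "f \<in> trig_closure"
proof -
  have "\<exists>q. trig_poly q \<and> Lp_power N p (\<lambda>x. f x - q x) < e" if "e > 0" for e
  proof -
    let ?m = "measure N (space N)"
    define d where "d = (e / (?m + 1)) powr (1/p)"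
    have m: "?m + 1 > 0" by (simp add: add_nonneg_pos)
    have d: "d > 0" "d powr p = e / (?m + 1)" using m that p_ge_1 by (auto simp: d_def powr_powr)
    obtain q where q: "trig_poly q" "\<And>x. norm (f x - q x) < d"
      using trig_poly_uniformly_dense[OF compact_group separates f d(1)] by blast
    have "Lp_power N p (\<lambda>x. f x - q x) \<le> (LINT x|N. d powr p)"
      unfolding Lp_power_def
      using LpD(2)[OF Lp_diff[OF p_ge_1 continuous_Lp[OF f] trig_poly_Lp[OF q(1)]]]
        less_imp_le[OF q(2)] p_ge_1
      by (intro integral_mono) (auto intro!: powr_mono2)
    also have "\<dots> = e * (?m / (?m + 1))" using d by simp
    also have "\<dots> < e * 1" using that m by (intro mult_strict_left_mono) auto
    finally show ?thesis using q by auto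
  qed
  then show ?thesis using continuous_Lp[OF f] by (simp add: Lp_limits_def)
qed

lemma bounded_Lp: "f \<in> borel_measurable borel \<Longrightarrow> (\<And>x. norm (f x) \<le> B) \<Longrightarrow> f \<in> Lp N p"
  using Lp_bounded[OF finite_measure_axioms _ _ p_ge_1, of f B] by (simp add: measurable_N_iff)

text \<open>An open set is a countable union of cozero sets, hence a limit of continuous functions.\<close>

lemma trig_closure_open:
  assumes U: "open U" shows "(\<lambda>x. indicator U x :: complex) \<in> trig_closure"
proof (cases "U = {}")
  case True
  then show ?thesis using trig_closure_continuous[of "\<lambda>x. 0"] by simp
next
  case False
  have "\<exists>f::'a \<Rightarrow> real. continuous_on UNIV f \<and> (\<forall>y. 0 \<le> f y) \<and> (\<forall>y. y \<notin> U \<longrightarrow> f y = 0) \<and> f x = 1" if "x \<in> U" for x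
  proof -
    obtain f :: "'a \<Rightarrow> real" where "continuous_on UNIV f" "\<And>y. 0 \<le> f y" "\<And>y. f y \<le> 1"
      "\<And>y. y \<in> - U \<Longrightarrow> f y = 0" "\<And>y. y \<in> {x} \<Longrightarrow> f y = 1"
      using Urysohn_compact_t2[OF compact_group, of "- U" "{x}"] U \<open>x \<in> U\<close> by (auto simp: closed_Compl)
    then show ?thesis by (intro exI[of _ f]) auto
  qed
  then obtain F :: "'a \<Rightarrow> 'a \<Rightarrow> real" where F: "\<And>x. x \<in> U \<Longrightarrow> continuous_on UNIV (F x)" "\<And>x y. x \<in> U \<Longrightarrow> 0 \<le> F x y"
    "\<And>x y. x \<in> U \<Longrightarrow> y \<notin> U \<Longrightarrow> F x y = 0" "\<And>x. x \<in> U \<Longrightarrow> F x x = 1" by metis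
  define Z where "Z = (\<lambda>x. {y. 0 < F x y})"
  have "open (Z x)" if "x \<in> U" for x unfolding Z_def using F(1)[OF that] by (intro open_Collect_less continuous_intros)
  then have opn: "\<And>S. S \<in> Z ` U \<Longrightarrow> open S" by auto
  obtain \<F>' where F': "\<F>' \<subseteq> Z ` U" "countable \<F>'" "\<Union>\<F>' = \<Union>(Z ` U)"
    by (rule Lindelof[OF opn])
  then have "\<exists>C. countable C \<and> C \<subseteq> U \<and> \<F>' = Z ` C"
    using countable_subset_image[of \<F>' Z U] by simp
  then obtain C where C: "C \<subseteq> U" "countable C" "\<Union>(Z ` C) = \<Union>(Z ` U)"
    using F'(3) by auto
  have ZU: "U \<subseteq> \<Union>(Z ` U)" using F(4) by (force simp: Z_def)
  then have "C \<noteq> {}" using C(3) False by auto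
  then have c: "range (from_nat_into C) = C" "\<And>n. from_nat_into C n \<in> U"
    using C by (auto intro: range_from_nat_into from_nat_into)
  define s where "s = (\<lambda>n y. min 1 (real n * (\<Sum>i<n. F (from_nat_into C i) y)))"
  have s0: "0 \<le> s n y" "s n y \<le> 1" for n y
    unfolding s_def using F(2) c(2) by (auto intro!: mult_nonneg_nonneg sum_nonneg)
  have cs: "continuous_on UNIV (\<lambda>y. complex_of_real (s n y))" for n
    unfolding s_def by (intro continuous_intros F(1) c(2))
  have lim: "(\<lambda>n. complex_of_real (s n y)) \<longlonglongrightarrow> indicator U y" for y
  proof (cases "y \<in> U")
    case True
    then have "y \<in> \<Union>(Z ` C)" using ZU C(3) by blast
    then obtain x where x: "x \<in> C" "F x y > 0" by (auto simp: Z_def)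
    then obtain i where i: "F (from_nat_into C i) y > 0" using c(1) by (metis rangeE)
    let ?t = "F (from_nat_into C i) y"
    have "s n y = 1" if n: "n > i" "real n \<ge> 1 / ?t" for n
    proof -
      have "?t \<le> (\<Sum>i<n. F (from_nat_into C i) y)"
        using n(1) F(2)[OF c(2)] by (intro member_le_sum) auto
      then have "real n * ?t \<le> real n * (\<Sum>i<n. F (from_nat_into C i) y)" by (intro mult_left_mono) auto
      moreover have "1 \<le> real n * ?t" using n(2) i by (simp add: field_simps)
      ultimately show ?thesis by (simp add: s_def)
    qed
    note s1 = this
    have "\<forall>\<^sub>F n in sequentially. complex_of_real (s n y) = indicator U y"
      using eventually_gt_at_top[of i] eventually_ge_at_top[of "nat \<lceil>1 / ?t\<rceil>"]
    proof eventually_elim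
      case (elim n)
      then show ?case using s1[of n] True by (simp add: nat_ceiling_le_eq)
    qed
    then show ?thesis by (rule tendsto_eventually)
  next
    case False
    then have "s n y = 0" for n using F(3)[OF c(2)] by (simp add: s_def)
    then show ?thesis using False by simp
  qed
  show ?thesis
  proof (rule trig_closure_dominated[where s = "\<lambda>n y. complex_of_real (s n y)" and w = "\<lambda>x. 2"])
    show "(\<lambda>x. indicator U x :: complex) \<in> Lp N p"
    proof (rule bounded_Lp[where B = 1])
      show "(\<lambda>x. indicator U x :: complex) \<in> borel_measurable borel"
        using U by (intro borel_measurable_indicator) auto
    qed (simp add: indicator_def)
    show "norm (indicator U y - complex_of_real (s n y)) \<le> 2" for n y
      using norm_triangle_ineq4[of "indicator U y" "complex_of_real (s n y)"] s0[of n y]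
      by (auto simp: indicator_def split: if_splits)
  qed (use lim trig_closure_continuous[OF cs] in auto)
qed

lemma trig_closure_borel_set:
  assumes B: "B \<in> sets borel" shows "(\<lambda>x. indicator B x :: complex) \<in> trig_closure"
proof -
  have "B \<in> sigma_sets UNIV {S::'a set. open S}" using B by (simp add: borel_def)
  show ?thesis
  proof (rule sigma_sets_induct_disjoint[OF _ _ \<open>B \<in> sigma_sets UNIV {S. open S}\<close>,
        where P = "\<lambda>B. (\<lambda>x. indicator B x :: complex) \<in> trig_closure"])
    show "Int_stable {S::'a set. open S}" by (auto simp: Int_stable_def)
    show "(\<lambda>x. indicator {} x :: complex) \<in> trig_closure" by (rule trig_closure_open) simp
    show "(\<lambda>x. indicator B x :: complex) \<in> trig_closure" if "B \<in> {S. open S}" for B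
      by (rule trig_closure_open) (use that in simp)
  next
    fix B assume *: "(\<lambda>x. indicator B x :: complex) \<in> trig_closure"
    have "(\<lambda>x. 1 + (-1) * indicator B x :: complex) \<in> trig_closure"
      by (intro trig_closure_add trig_closure_scale * trig_closure_continuous continuous_intros)
    moreover have "(\<lambda>x. 1 + (-1) * indicator B x :: complex) = (\<lambda>x. indicator (UNIV - B) x)"
      by (auto simp: indicator_def)
    ultimately show "(\<lambda>x. indicator (UNIV - B) x :: complex) \<in> trig_closure" by simp
  next
    fix B :: "nat \<Rightarrow> 'a set"
    assume dis: "disjoint_family B" and sub: "range B \<subseteq> sigma_sets UNIV {S. open S}"
      and *: "\<And>i. (\<lambda>x. indicator (B i) x :: complex) \<in> trig_closure"
    have meas: "B i \<in> sets borel" for i using sub by (auto simp: borel_def)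
    show "(\<lambda>x. indicator (\<Union>i. B i) x :: complex) \<in> trig_closure"
    proof (rule trig_closure_dominated[where s = "\<lambda>n x. indicator (\<Union>i<n. B i) x" and w = "\<lambda>x. 2"])
      show "(\<lambda>x. indicator (\<Union>i. B i) x :: complex) \<in> Lp N p"
        by (rule bounded_Lp[where B = 1]) (use meas in \<open>auto simp: indicator_def\<close>)
      have "(\<lambda>x. indicator (\<Union>i<n. B i) x :: complex) = (\<lambda>x. \<Sum>i<n. indicator (B i) x)" for n
        using dis by (intro ext indicator_UN_disjoint) (auto intro: disjoint_family_on_mono)
      then show "(\<lambda>x. indicator (\<Union>i<n. B i) x :: complex) \<in> trig_closure" for n
        using trig_closure_sum[of "{..<n}" "\<lambda>i x. indicator (B i) x"] * by simp
      show "(\<lambda>n. indicator (\<Union>i<n. B i) x :: complex) \<longlonglongrightarrow> indicator (\<Union>i. B i) x" for x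
        by (rule LIMSEQ_indicator_UN)
    qed (auto simp: indicator_def)
  qed simp
qed

lemma trig_closure_simple:
  fixes s :: "'a \<Rightarrow> complex"
  assumes s: "simple_function N s" shows "s \<in> trig_closure"
proof -
  have fin: "finite (range s)" using simple_functionD(1)[OF s] by (simp add: space_N)
  have eq: "s = (\<lambda>x. \<Sum>y\<in>range s. y * indicator (s -` {y}) x)"
  proof
    fix x
    have "(\<Sum>y\<in>range s. y * indicator (s -` {y}) x) = (\<Sum>y\<in>range s. if y = s x then y else 0)"
      by (intro sum.cong) (auto simp: indicator_def)
    then show "s x = (\<Sum>y\<in>range s. y * indicator (s -` {y}) x)" using fin by simp
  qed
  have "s -` {y} \<in> sets borel" for y
    using simple_functionD(2)[OF s, of "{y}"] by (simp add: space_N sets_eq_borel)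
  then show ?thesis
    by (subst eq) (intro trig_closure_sum fin trig_closure_scale trig_closure_borel_set)
qed

text \<open>
  The closure of the trigonometric polynomials contains the continuous functions by
  Stone--Weierstrass, indicators of open and then of Borel sets by dominated convergence and a
  Dynkin class argument, simple functions by linearity, and all of \<open>L\<^sup>p\<close> by dominated convergence.
\<close>

theorem trig_poly_dense:
  assumes f: "f \<in> Lp N p" and e: "e > 0"
  obtains q where "trig_poly q" "Lp_power N p (\<lambda>x. f x - q x) < e"
proof -
  obtain s where s: "\<And>i. simple_function N (s i)" "\<And>x. (\<lambda>i. s i x) \<longlonglongrightarrow> f x"
    "\<And>i x. dist (s i x) 0 \<le> 2 * dist (f x) 0"
    using borel_measurable_implies_sequence_metric[OF LpD(1)[OF f], of 0] by (auto simp: space_N)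
  have "f \<in> trig_closure"
  proof (rule trig_closure_dominated[where s = s and w = "\<lambda>x. 3 * norm (f x)"])
    show "integrable N (\<lambda>x. (3 * norm (f x)) powr p)" using LpD(2)[OF f] by (simp add: powr_mult)
    show "norm (f x - s n x) \<le> 3 * norm (f x)" for n x
      using norm_triangle_ineq4[of "f x" "s n x"] s(3)[of n x] by (simp add: dist_norm)
  qed (use f s trig_closure_simple in auto)
  then show ?thesis using e that by (auto simp: Lp_limits_def)
qed

end

text \<open>
  Uniqueness of Fourier coefficients follows from density in a different space: approximate the
  conjugate sign of \<open>f\<close> in \<open>L\<^sup>1\<close> of the weighted measure \<open>(1 + \<bar>f\<bar>) dx\<close>.
\<close>

theorem fourier_unique:
  fixes M :: "'a::{topological_ab_group_add, second_countable_topology, t2_space} measure"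
  assumes G: "compact (UNIV :: 'a set)" and sep: "\<And>a::'a. a \<noteq> 0 \<Longrightarrow> \<exists>\<xi>\<in>dual_group. \<xi> a \<noteq> 1"
    and M: "finite_measure M" "sets M = sets borel"
    and f: "integrable M f" and zero: "\<And>\<xi>. \<xi> \<in> dual_group \<Longrightarrow> fourier M f \<xi> = 0"
  shows "AE x in M. f x = 0"
proof -
  interpret M: finite_measure M by fact
  have fm[measurable]: "f \<in> borel_measurable M" using f by auto
  have bm: "q \<in> borel_measurable M" if "continuous_on UNIV q" for q :: "'a \<Rightarrow> complex"
    using borel_measurable_continuous_onI[OF that] measurable_cong_sets[OF M(2) refl] by blast
  have fq: "integrable M (\<lambda>x. f x * q x)" if q: "continuous_on UNIV q" for q
  proof -
    have "compact (range q)" using q G by (intro compact_continuous_image) auto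
    then obtain B where "\<And>x. norm (q x) \<le> B" using compact_imp_bounded bounded_iff by (metis rangeI)
    then have "norm (f x * q x) \<le> norm (norm (f x) * B)" for x
      unfolding norm_mult by (intro mult_mono) (auto intro: order_trans[OF _ abs_ge_self])
    then show ?thesis
      by (intro Bochner_Integration.integrable_bound[OF integrable_mult_left[OF integrable_norm[OF f], of B]])
         (use bm[OF q] in auto)
  qed
  have ortho: "(LINT x|M. f x * q x) = 0" if "trig_poly q" for q
    using that
  proof induction
    case (char \<xi>)
    then show ?case using zero[OF dual_group_cnj[OF char]] by (simp add: fourier_def)
  next
    case (scale q c)
    have "(LINT x|M. f x * (c * q x)) = (LINT x|M. c * (f x * q x))" by (simp add: mult_ac)
    then show ?case using scale by simp
  next
    case (add q r)
    then show ?case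
      using fq[OF trig_poly_continuous[OF add(1)]] fq[OF trig_poly_continuous[OF add(2)]]
      by (simp add: distrib_left)
  qed
  define w where "w = (\<lambda>x. 1 + norm (f x))"
  have wm[measurable]: "w \<in> borel_measurable M" by (simp add: w_def)
  have wi: "integrable M w" using f by (simp add: w_def)
  define N where "N = density M (\<lambda>x. ennreal (w x))"
  have "emeasure N (space N) < \<infinity>"
    using wi by (simp add: N_def emeasure_density integrable_iff_bounded w_def)
  then interpret N: finite_measure N by (intro finite_measureI) auto
  interpret compact_group_measure N 1
    by unfold_locales (use G sep M in \<open>auto simp: N_def\<close>)
  define h where "h = (\<lambda>x. cnj (sgn (f x)))"
  have [measurable]: "(\<lambda>x. cnj (f x)) \<in> borel_measurable M"
    by (rule measurable_compose[OF fm]) (intro borel_measurable_continuous_onI continuous_intros)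
  have hm[measurable]: "h \<in> borel_measurable M"
    unfolding h_def sgn_div_norm complex_cnj_scaleR by measurable
  have "h \<in> borel_measurable N" by (simp add: N_def)
  then have hL: "h \<in> Lp N 1"
    by (rule Lp_bounded[OF N.finite_measure_axioms, where B = 1]) (auto simp: h_def norm_sgn)
  have fh: "f x * h x = of_real (norm (f x))" for x
  proof (cases "f x = 0")
    case False
    have "f x * h x = f x * cnj (f x) / of_real (norm (f x))"
      by (simp add: h_def sgn_div_norm scaleR_conv_of_real divide_inverse mult_ac)
    also have "f x * cnj (f x) = of_real (norm (f x)) * of_real (norm (f x))"
      by (simp add: complex_norm_square[symmetric] power2_eq_square)
    finally show ?thesis using False by simp
  qed simp
  have small: "(LINT x|M. norm (f x)) \<le> e" if e: "e > 0" for e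
  proof -
    obtain q where q: "trig_poly q" "Lp_power N 1 (\<lambda>x. h x - q x) < e" using trig_poly_dense[OF hL e] by blast
    have hq: "(\<lambda>x. h x - q x) \<in> Lp N 1" by (intro Lp_diff hL trig_poly_Lp q) simp
    have qm[measurable]: "q \<in> borel_measurable M" by (rule bm[OF trig_poly_continuous[OF q(1)]])
    have e1: "Lp_power N 1 (\<lambda>x. h x - q x) = (LINT x|M. w x * norm (h x - q x))"
      unfolding Lp_power_def N_def by (subst integral_density) (auto simp: w_def)
    have i1: "integrable M (\<lambda>x. w x * norm (h x - q x))"
      using LpD(2)[OF hq] unfolding N_def by (subst (asm) integrable_density) (auto simp: w_def)
    have ifh: "integrable M (\<lambda>x. f x * h x)" using f by (simp add: fh)
    have "complex_of_real (LINT x|M. norm (f x)) = (LINT x|M. f x * h x)" by (simp add: fh)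
    also have "\<dots> = (LINT x|M. f x * h x - f x * q x)"
      using ortho[OF q(1)] ifh fq[OF trig_poly_continuous[OF q(1)]] by simp
    finally have "\<bar>LINT x|M. norm (f x)\<bar> = norm (LINT x|M. f x * h x - f x * q x)" by (metis norm_of_real)
    also have "\<dots> \<le> (LINT x|M. norm (f x * h x - f x * q x))" by (rule integral_norm_bound)
    also have "\<dots> \<le> (LINT x|M. w x * norm (h x - q x))"
    proof (rule integral_mono)
      show "integrable M (\<lambda>x. norm (f x * h x - f x * q x))"
        using ifh fq[OF trig_poly_continuous[OF q(1)]] by simp
      show "norm (f x * h x - f x * q x) \<le> w x * norm (h x - q x)" for x
      proof -
        have "norm (f x * h x - f x * q x) = norm (f x) * norm (h x - q x)"
          by (metis norm_mult right_diff_distrib)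
        then show ?thesis by (simp add: w_def distrib_right)
      qed
    qed (rule i1)
    finally show ?thesis using q(2) e1 by linarith
  qed
  have "(LINT x|M. norm (f x)) \<le> 0" by (rule field_le_epsilon) (use small in simp)
  then have "(LINT x|M. norm (f x)) = 0" by (intro antisym) auto
  then show ?thesis
    using integral_nonneg_eq_0_iff_AE[of M "\<lambda>x. norm (f x)"] f by simp
qed


section \<open>Haar measure\<close>

lemma haarD:
  assumes "normalized_haar M"
  shows "prob_space M" "sets M = sets borel" "space M = UNIV"
    "B \<in> sets borel \<Longrightarrow> emeasure M ((\<lambda>x. a + x) ` B) = emeasure M B"
  using assms sets_eq_imp_space_eq[of M borel] by (auto simp: normalized_haar_def)

lemma borel_measurable_haar_iff:
  assumes "normalized_haar M" shows "f \<in> measurable M N \<longleftrightarrow> f \<in> measurable borel N"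
  using measurable_cong_sets[OF haarD(2)[OF assms] refl] by blast

lemma distr_haar_translate:
  fixes M :: "'a::{topological_ab_group_add, t2_space} measure"
  assumes M: "normalized_haar M" shows "distr M borel (\<lambda>x. x + a) = M"
proof (rule measure_eqI)
  show "sets (distr M borel (\<lambda>x. x + a)) = sets M" by (simp add: haarD(2)[OF M])
  fix B assume "B \<in> sets (distr M borel (\<lambda>x. x + a))"
  then have B: "B \<in> sets borel" by simp
  have m: "(\<lambda>x. x + a) \<in> borel_measurable M"
    unfolding borel_measurable_haar_iff[OF M] by (intro borel_measurable_continuous_onI continuous_intros)
  have "(\<lambda>x. x + a) -` B = (\<lambda>x. - a + x) ` B"
    by (auto simp: image_iff algebra_simps intro!: bexI[of _ "_ + a"])
  then show "emeasure (distr M borel (\<lambda>x. x + a)) B = emeasure M B"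
    using B haarD(4)[OF M B, of "- a"] by (simp add: emeasure_distr[OF m] haarD(3)[OF M])
qed

text \<open>
  The left-hand side is the convolution of the two measures. A Haar measure is thus reproduced by
  convolution with any probability measure, and two Haar measures are both equal to their
  convolution by Fubini.
\<close>

lemma haar_absorbs_translations:
  fixes M N :: "'a::{topological_ab_group_add, second_countable_topology, t2_space} measure"
  assumes M: "normalized_haar M" and N: "prob_space N" "sets N = sets borel" and B: "B \<in> sets borel"
  shows "(\<integral>\<^sup>+y. (\<integral>\<^sup>+x. indicator B (x + y) \<partial>M) \<partial>N) = emeasure M B"
proof -
  interpret N: prob_space N by fact
  have "(\<integral>\<^sup>+x. indicator B (x + y) \<partial>M) = emeasure M B" for y
  proof -
    have m: "(\<lambda>x. x + y) \<in> borel_measurable M"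
      unfolding borel_measurable_haar_iff[OF M] by (intro borel_measurable_continuous_onI continuous_intros)
    have "emeasure M B = emeasure (distr M borel (\<lambda>x. x + y)) B" by (simp add: distr_haar_translate[OF M])
    also have "\<dots> = (\<integral>\<^sup>+x. indicator B x \<partial>distr M borel (\<lambda>x. x + y))" using B by simp
    also have "\<dots> = (\<integral>\<^sup>+x. indicator B (x + y) \<partial>M)" using B m by (subst nn_integral_distr) auto
    finally show ?thesis by simp
  qed
  then show ?thesis by (simp add: N.emeasure_space_1)
qed

lemma normalized_haar_unique:
  fixes M N :: "'a::{topological_ab_group_add, second_countable_topology, t2_space} measure"
  assumes M: "normalized_haar M" and N: "normalized_haar N" shows "M = N"
proof (rule measure_eqI)
  show "sets M = sets N" by (simp add: haarD(2) M N)
  fix B assume "B \<in> sets M"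
  then have B: "B \<in> sets borel" by (simp add: haarD(2)[OF M])
  interpret M: prob_space M by (rule haarD(1)[OF M])
  interpret N: prob_space N by (rule haarD(1)[OF N])
  interpret pair_sigma_finite M N ..
  have "sets (M \<Otimes>\<^sub>M N) = sets (borel :: ('a \<times> 'a) measure)"
    using sets_pair_measure_cong[OF haarD(2)[OF M] haarD(2)[OF N]] unfolding borel_prod .
  moreover have "(\<lambda>z::'a \<times> 'a. fst z + snd z) \<in> borel_measurable borel"
    by (intro borel_measurable_continuous_onI continuous_intros)
  ultimately have "(\<lambda>z. fst z + snd z) \<in> borel_measurable (M \<Otimes>\<^sub>M N)"
    using measurable_cong_sets by blast
  then have m: "(\<lambda>z. indicator B (fst z + snd z) :: ennreal) \<in> borel_measurable (M \<Otimes>\<^sub>M N)"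
    using B by (intro measurable_compose[OF _ borel_measurable_indicator])
  have "emeasure M B = (\<integral>\<^sup>+y. (\<integral>\<^sup>+x. indicator B (x + y) \<partial>M) \<partial>N)"
    using haar_absorbs_translations[OF M haarD(1,2)[OF N] B] by simp
  also have "\<dots> = (\<integral>\<^sup>+x. (\<integral>\<^sup>+y. indicator B (x + y) \<partial>N) \<partial>M)"
    using Fubini[OF m] by simp
  also have "\<dots> = (\<integral>\<^sup>+x. (\<integral>\<^sup>+y. indicator B (y + x) \<partial>N) \<partial>M)" by (simp add: add.commute)
  also have "\<dots> = emeasure N B" by (rule haar_absorbs_translations[OF N haarD(1,2)[OF M] B])
  finally show "emeasure M B = emeasure N B" .
qed

lemma convex_on_powr_nonneg:
  fixes p :: real assumes p: "p \<ge> 1" shows "convex_on {0..} (\<lambda>x. x powr p)"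
proof (rule convex_onI)
  fix t x y :: real assume t: "0 < t" "t < 1" and xy: "x \<in> {0..}" "y \<in> {0..}"
  have small: "(s * z) powr p \<le> s * z powr p" if "0 < s" "s < 1" "0 \<le> z" for s z :: real
  proof -
    have "s powr p \<le> s powr 1" using that p by (intro powr_mono') auto
    then show ?thesis using that by (simp add: powr_mult mult_right_mono)
  qed
  show "((1 - t) *\<^sub>R x + t *\<^sub>R y) powr p \<le> (1 - t) * x powr p + t * y powr p"
  proof (cases "x = 0 \<or> y = 0")
    case True
    then show ?thesis using small[of t y] small[of "1 - t" x] t xy p by auto
  next
    case False
    then show ?thesis using convex_onD[OF powr_convex[OF p], of t x y] t xy by auto
  qed
qed simp


section \<open>Fourier analysis on a group with an expanding endomorphism\<close>

locale expanding_endomorphism =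
  fixes A :: "'a::{topological_ab_group_add, second_countable_topology, t2_space} \<Rightarrow> 'a"
    and M :: "'a measure"
  assumes compact_group: "compact (UNIV :: 'a set)"
    and haar: "normalized_haar M"
    and continuous_A: "continuous_on UNIV A"
    and surj_A: "surj A"
    and hom_A: "group_hom_add A"
    and finite_ker: "finite (ker A)"
    and dense_kers: "closure (\<Union>j::nat. ker (A ^^ j)) = UNIV"
begin

abbreviation K :: "nat \<Rightarrow> 'a set" where "K j \<equiv> ker (A ^^ j)"

lemma A_add: "A (x + y) = A x + A y"
  using hom_A by (simp add: group_hom_add_def)

lemma A_zero: "A 0 = 0"
  using A_add[of 0 0] by simp

lemma A_diff: "A (x - y) = A x - A y"
  using A_add[of "x - y" y] by simp

lemma funpow_A_zero: "(A ^^ j) 0 = 0"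
  by (induction j) (simp_all add: A_zero)

lemma funpow_A_diff: "(A ^^ j) (x - y) = (A ^^ j) x - (A ^^ j) y"
  by (induction j) (simp_all add: A_diff)

lemma subgroup_K: "add_subgroup (K j)"
  by (simp add: add_subgroup_def ker_def funpow_A_zero funpow_A_diff)

lemma finite_K: "finite (K j)"
  by (rule finite_ker_funpow[OF hom_A finite_ker])

lemma card_K_pos: "card (K j) > 0"
  using finite_K add_subgroup_zero[OF subgroup_K] by (auto simp: card_gt_0_iff)

lemma mono_K: "mono K"
  by (rule mono_iff_le_Suc[THEN iffD2]) (auto simp: ker_def A_zero)

lemma ker_subset_K_Suc: "ker A \<subseteq> K (Suc j)"
  using monoD[OF mono_K, of 1 "Suc j"] by simp

lemma A_in_K: "x \<in> K (Suc j) \<Longrightarrow> A x \<in> K j"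
  by (simp add: ker_def funpow_swap1)

lemma K_lift: "x \<in> K j \<Longrightarrow> A y = x \<Longrightarrow> y \<in> K (Suc j)"
  by (simp add: ker_def funpow_swap1)

lemma separates: "(a :: 'a) \<noteq> 0 \<Longrightarrow> \<exists>\<xi>\<in>dual_group. \<xi> a \<noteq> 1"
  using dual_group_separates[OF compact_group subgroup_K finite_K mono_K dense_kers, of a] by blast

lemma char_eqI:
  assumes "\<xi> \<in> dual_group" "\<eta> \<in> dual_group" "\<And>j a. a \<in> K j \<Longrightarrow> \<xi> a = \<eta> a" shows "\<xi> = \<eta>"
proof -
  have "closed {x. \<xi> x = \<eta> x}" using assms by (intro closed_Collect_eq) (auto dest: dual_groupD(1))
  then have "closure (\<Union>j. K j) \<subseteq> {x. \<xi> x = \<eta> x}" using assms(3) by (intro closure_minimal) auto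
  then show ?thesis unfolding dense_kers by auto
qed

sublocale prob_space M by (rule haarD(1)[OF haar])

lemma space_M: "space M = UNIV" and sets_M: "sets M = sets borel"
  using haarD[OF haar] by auto

lemma measurable_M_iff: "f \<in> measurable M N \<longleftrightarrow> f \<in> measurable borel N"
  by (rule borel_measurable_haar_iff[OF haar])

lemma measurable_continuous: "continuous_on UNIV f \<Longrightarrow> f \<in> borel_measurable M"
  unfolding measurable_M_iff by (rule borel_measurable_continuous_onI)

lemma measurable_char: "\<xi> \<in> dual_group \<Longrightarrow> \<xi> \<in> borel_measurable M"
  by (intro measurable_continuous dual_groupD)

lemma compact_group_measure: "p \<ge> 1 \<Longrightarrow> compact_group_measure M p"
  by unfold_locales (auto simp: compact_group separates sets_M)

lemma measurable_translate: "f \<in> measurable M N \<Longrightarrow> (\<lambda>x. f (x + a)) \<in> measurable M N"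
  unfolding measurable_M_iff
  by (rule measurable_compose[where N = borel]) (intro borel_measurable_continuous_onI continuous_intros)

lemma integral_translate:
  fixes f :: "'a \<Rightarrow> 'c::{banach, second_countable_topology}"
  assumes "f \<in> borel_measurable M"
  shows "(LINT x|M. f (x + a)) = (LINT x|M. f x)"
    and "integrable M (\<lambda>x. f (x + a)) \<longleftrightarrow> integrable M f"
proof -
  have m: "(\<lambda>x. x + a) \<in> borel_measurable M" by (intro measurable_continuous continuous_intros)
  show "(LINT x|M. f (x + a)) = (LINT x|M. f x)" "integrable M (\<lambda>x. f (x + a)) \<longleftrightarrow> integrable M f"
    using integral_distr[OF m, of f] integrable_distr_eq[OF m, of f] assms
    by (simp_all add: distr_haar_translate[OF haar] measurable_M_iff)
qed

text \<open>
  The image of Haar measure under a surjective homomorphism is again translation invariant, and Haar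
  measure is unique.
\<close>

lemma distr_A: "distr M borel A = M"
proof -
  let ?N = "distr M borel A"
  have mA: "A \<in> borel_measurable M" by (rule measurable_continuous[OF continuous_A])
  have "emeasure ?N ((\<lambda>x. a + x) ` B) = emeasure ?N B" if B: "B \<in> sets borel" for a B
  proof -
    obtain c where c: "A c = a" using surj_A by (metis surjD)
    have im: "(\<lambda>x. a + x) ` B = (\<lambda>x. x + (- a)) -` B"
      by (auto simp: image_iff algebra_simps intro!: bexI[of _ "_ - a"])
    have "(\<lambda>x. x + (- a)) \<in> borel_measurable borel"
      by (intro borel_measurable_continuous_onI continuous_intros)
    from measurable_sets[OF this B] have Bm: "(\<lambda>x. x + (- a)) -` B \<in> sets borel" by simp
    have AB: "A -` B \<in> sets borel" using measurable_sets[OF mA B] by (simp add: space_M sets_M)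
    have "A -` ((\<lambda>x. x + (- a)) -` B) = (\<lambda>x. c + x) ` (A -` B)"
    proof (intro equalityI subsetI)
      fix x assume "x \<in> A -` ((\<lambda>x. x + (- a)) -` B)"
      then have "x - c \<in> A -` B" by (simp add: A_diff c)
      then show "x \<in> (\<lambda>x. c + x) ` (A -` B)" by (intro rev_image_eqI[of "x - c"]) auto
    qed (auto simp: A_add c)
    then show ?thesis
      unfolding im using haarD(4)[OF haar AB, of c] B Bm mA by (simp add: emeasure_distr space_M)
  qed
  then have "normalized_haar ?N"
    unfolding normalized_haar_def using prob_space_distr[OF mA] by simp
  then show ?thesis using normalized_haar_unique haar by blast
qed

lemma measurable_comp_A: "f \<in> measurable M N \<Longrightarrow> (\<lambda>x. f (A x)) \<in> measurable M N"
  unfolding measurable_M_iff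
  by (rule measurable_compose[where N = borel]) (intro borel_measurable_continuous_onI continuous_A)

lemma integral_comp_A:
  fixes f :: "'a \<Rightarrow> 'c::{banach, second_countable_topology}"
  assumes "f \<in> borel_measurable M"
  shows "(LINT x|M. f (A x)) = (LINT x|M. f x)"
    and "integrable M (\<lambda>x. f (A x)) \<longleftrightarrow> integrable M f"
proof -
  have m: "A \<in> borel_measurable M" by (intro measurable_continuous continuous_A)
  show "(LINT x|M. f (A x)) = (LINT x|M. f x)" "integrable M (\<lambda>x. f (A x)) \<longleftrightarrow> integrable M f"
    using integral_distr[OF m, of f] integrable_distr_eq[OF m, of f] assms
    by (simp_all add: distr_A measurable_M_iff)
qed

lemma translate_Lp:
  assumes f: "f \<in> Lp M p"
  shows "translate a f \<in> Lp M p" "Lp_power M p (translate a f) = Lp_power M p f"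
proof -
  note f1 = LpD(1)[OF f] and f2 = LpD(2)[OF f]
  have g: "(\<lambda>x. norm (f x) powr p) \<in> borel_measurable M" by (rule borel_measurable_integrable[OF f2])
  show "translate a f \<in> Lp M p"
    using measurable_translate[OF f1, of "- a"] integral_translate(2)[OF g, of "- a"] f2
    by (simp add: Lp_def translate_def)
  show "Lp_power M p (translate a f) = Lp_power M p f"
    using integral_translate(1)[OF g, of "- a"] by (simp add: Lp_power_def translate_def)
qed

lemma comp_A_Lp: "f \<in> Lp M p \<Longrightarrow> (\<lambda>x. f (A x)) \<in> Lp M p"
  using measurable_comp_A[of f borel] integral_comp_A(2)[of "\<lambda>x. norm (f x) powr p"] LpD(2)[of f M p]
  by (auto simp: Lp_def)

subsection \<open>Fourier coefficients\<close>

lemma Lp_integrable: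
  assumes p: "p \<ge> 1" and f: "f \<in> Lp M p" shows "integrable M f"
proof (rule Bochner_Integration.integrable_bound)
  show "integrable M (\<lambda>x. 1 + norm (f x) powr p)" using LpD(2)[OF f] by simp
  have "norm (f x) \<le> 1 + norm (f x) powr p" for x
  proof (cases "norm (f x) \<le> 1")
    case False
    then have "norm (f x) powr 1 \<le> norm (f x) powr p" using p by (intro powr_mono) auto
    then show ?thesis using False by simp
  qed (simp add: add_increasing2)
  then show "AE x in M. norm (f x) \<le> norm (1 + norm (f x) powr p)" by (auto intro: order_trans[OF _ abs_ge_self])
qed (rule LpD(1)[OF f])

text \<open>
  The pointwise bound \<open>t \<le> e + e powr (1 - p) * t powr p\<close> for \<open>t \<ge> 0\<close> makes convergence in \<open>L\<^sup>p\<close> imply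
  convergence in \<open>L\<^sup>1\<close>, and with it convergence of Fourier coefficients.
\<close>

lemma integral_norm_small:
  assumes p: "p \<ge> 1" and f: "f \<in> Lp M p" and e: "e > 0" and small: "Lp_power M p f < e powr p"
  shows "(LINT x|M. norm (f x)) < 2 * e"
proof -
  have b: "norm (f x) \<le> e + e powr (1 - p) * norm (f x) powr p" for x
  proof (cases "norm (f x) \<le> e")
    case False
    then have pos: "norm (f x) > 0" using e by linarith
    have "norm (f x) = norm (f x) powr (1 - p) * norm (f x) powr p"
      using pos by (simp add: powr_add[symmetric])
    also have "\<dots> \<le> e powr (1 - p) * norm (f x) powr p"
      using False e p by (intro mult_right_mono powr_mono2') auto
    finally show ?thesis using e by simp
  qed (simp add: add_increasing2)
  have "(LINT x|M. norm (f x)) \<le> (LINT x|M. e + e powr (1 - p) * norm (f x) powr p)"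
    using Lp_integrable[OF p f] LpD(2)[OF f] by (intro integral_mono b) auto
  also have "\<dots> = e + e powr (1 - p) * Lp_power M p f"
    using LpD(2)[OF f] by (simp add: Lp_power_def prob_space)
  also have "\<dots> < e + e powr (1 - p) * e powr p" using small e by (intro add_strict_left_mono mult_strict_left_mono) auto
  also have "\<dots> = 2 * e" using e by (simp add: powr_add[symmetric])
  finally show ?thesis .
qed

lemma integrable_mult_char:
  assumes f: "integrable M f" and xi: "\<xi> \<in> dual_group" shows "integrable M (\<lambda>x. f x * cnj (\<xi> x))"
  by (rule Bochner_Integration.integrable_bound[OF f])
     (use f measurable_char[OF dual_group_cnj[OF xi]] dual_groupD(2)[OF xi] in \<open>auto simp: norm_mult\<close>)

lemma fourier_add:
  "integrable M f \<Longrightarrow> integrable M g \<Longrightarrow> \<xi> \<in> dual_group \<Longrightarrow>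
    fourier M (\<lambda>x. f x + g x) \<xi> = fourier M f \<xi> + fourier M g \<xi>"
  by (simp add: fourier_def distrib_right integrable_mult_char)

lemma fourier_diff:
  "integrable M f \<Longrightarrow> integrable M g \<Longrightarrow> \<xi> \<in> dual_group \<Longrightarrow>
    fourier M (\<lambda>x. f x - g x) \<xi> = fourier M f \<xi> - fourier M g \<xi>"
  by (simp add: fourier_def left_diff_distrib integrable_mult_char)

lemma fourier_scale: "fourier M (\<lambda>x. c * f x) \<xi> = c * fourier M f \<xi>"
  by (simp add: fourier_def mult.assoc)

lemma fourier_sum:
  assumes "finite I" "\<And>i. i \<in> I \<Longrightarrow> integrable M (f i)" "\<xi> \<in> dual_group"
  shows "fourier M (\<lambda>x. \<Sum>i\<in>I. c i * f i x) \<xi> = (\<Sum>i\<in>I. c i * fourier M (f i) \<xi>)"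
  using assms by (simp add: fourier_def sum_distrib_right mult.assoc integrable_mult_char)

lemma fourier_cong_AE:
  assumes "AE x in M. f x = g x" "f \<in> borel_measurable M" "g \<in> borel_measurable M" "\<xi> \<in> dual_group"
  shows "fourier M f \<xi> = fourier M g \<xi>"
  unfolding fourier_def
  by (rule integral_cong_AE) (use assms measurable_char[OF dual_group_cnj[OF assms(4)]] in auto)

lemma norm_fourier_le:
  assumes "\<xi> \<in> dual_group" shows "norm (fourier M f \<xi>) \<le> (LINT x|M. norm (f x))"
  unfolding fourier_def
  by (rule order_trans[OF integral_norm_bound]) (simp add: norm_mult dual_groupD(2)[OF assms])

lemma fourier_close:
  assumes p: "p \<ge> 1" and fg: "f \<in> Lp M p" "g \<in> Lp M p" and e: "e > 0"
    and small: "Lp_power M p (\<lambda>x. f x - g x) < e powr p" and xi: "\<xi> \<in> dual_group"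
  shows "norm (fourier M f \<xi> - fourier M g \<xi>) < 2 * e"
proof -
  have "norm (fourier M f \<xi> - fourier M g \<xi>) = norm (fourier M (\<lambda>x. f x - g x) \<xi>)"
    using fourier_diff[OF Lp_integrable[OF p fg(1)] Lp_integrable[OF p fg(2)] xi] by simp
  also have "\<dots> \<le> (LINT x|M. norm (f x - g x))" by (rule norm_fourier_le[OF xi])
  also have "\<dots> < 2 * e" by (rule integral_norm_small[OF p Lp_diff[OF p fg] e small])
  finally show ?thesis .
qed

lemma fourier_inj:
  assumes p: "p \<ge> 1" and fg: "f \<in> Lp M p" "g \<in> Lp M p"
    and eq: "\<And>\<xi>. \<xi> \<in> dual_group \<Longrightarrow> fourier M f \<xi> = fourier M g \<xi>"
  shows "AE x in M. f x = g x"
proof -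
  have i: "integrable M f" "integrable M g" using Lp_integrable[OF p] fg by auto
  have "AE x in M. f x - g x = 0"
    by (rule fourier_unique[OF compact_group separates finite_measure_axioms sets_M])
       (use i eq in \<open>auto simp: fourier_diff\<close>)
  then show ?thesis by simp
qed

lemma fourier_translate:
  assumes f: "f \<in> borel_measurable M" and xi: "\<xi> \<in> dual_group"
  shows "fourier M (translate a f) \<xi> = cnj (\<xi> a) * fourier M f \<xi>"
proof -
  have m: "(\<lambda>x. translate a f x * cnj (\<xi> x)) \<in> borel_measurable M"
    using measurable_translate[OF f, of "- a"] measurable_char[OF dual_group_cnj[OF xi]]
    by (simp add: translate_def)
  have "fourier M (translate a f) \<xi> = (LINT x|M. translate a f (x + a) * cnj (\<xi> (x + a)))"
    unfolding fourier_def using integral_translate(1)[OF m, of a] by simp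
  also have "\<dots> = (LINT x|M. cnj (\<xi> a) * (f x * cnj (\<xi> x)))"
    by (simp add: translate_def dual_groupD(3)[OF xi] mult_ac)
  finally show ?thesis by (simp add: fourier_def)
qed

lemma integral_char:
  assumes xi: "\<xi> \<in> dual_group" shows "(LINT x|M. \<xi> x) = (if \<xi> = char_zero then 1 else 0)"
proof (cases "\<xi> = char_zero")
  case True then show ?thesis by (simp add: char_zero_def prob_space)
next
  case False
  then obtain a where a: "\<xi> a \<noteq> 1" by (auto simp: char_zero_def fun_eq_iff)
  have "(LINT x|M. \<xi> x) = (LINT x|M. \<xi> (x + a))"
    by (rule integral_translate(1)[OF measurable_char[OF xi], symmetric])
  also have "\<dots> = (LINT x|M. \<xi> x) * \<xi> a" by (simp add: dual_groupD(3)[OF xi])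
  finally have "(LINT x|M. \<xi> x) * (\<xi> a - 1) = 0" by (simp add: algebra_simps)
  then show ?thesis using a False by simp
qed

lemma fourier_char:
  assumes "\<eta> \<in> dual_group" "\<xi> \<in> dual_group" shows "fourier M \<eta> \<xi> = (if \<xi> = \<eta> then 1 else 0)"
proof -
  have eq: "(\<lambda>x. \<eta> x * cnj (\<xi> x)) = char_zero \<longleftrightarrow> \<xi> = \<eta>"
  proof
    assume *: "(\<lambda>x. \<eta> x * cnj (\<xi> x)) = char_zero"
    show "\<xi> = \<eta>"
    proof
      fix x
      have "\<eta> x * cnj (\<xi> x) = 1" using fun_cong[OF *, of x] by (simp add: char_zero_def)
      then have "\<eta> x * (\<xi> x * cnj (\<xi> x)) = \<xi> x" by (simp add: mult_ac)
      then show "\<xi> x = \<eta> x" using dual_group_mult_cnj[OF assms(2)] by simp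
    qed
  next
    assume "\<xi> = \<eta>"
    then show "(\<lambda>x. \<eta> x * cnj (\<xi> x)) = char_zero" by (simp add: char_zero_def dual_group_mult_cnj[OF assms(1)])
  qed
  show ?thesis
    unfolding fourier_def
    using integral_char[OF dual_group_mult[OF assms(1) dual_group_cnj[OF assms(2)]]] eq by simp
qed

lemma trig_poly_Lp: "trig_poly q \<Longrightarrow> p \<ge> 1 \<Longrightarrow> q \<in> Lp M p"
  using compact_group_measure.trig_poly_Lp compact_group_measure by blast

lemma trig_poly_integrable: "trig_poly q \<Longrightarrow> integrable M q"
  using Lp_integrable[of 1] trig_poly_Lp[of q 1] by simp

lemma char_Lp: "\<xi> \<in> dual_group \<Longrightarrow> p \<ge> 1 \<Longrightarrow> \<xi> \<in> Lp M p"
  by (intro trig_poly_Lp trig_poly.char)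

lemma trig_poly_finite_spectrum: "trig_poly q \<Longrightarrow> finite {\<xi>\<in>dual_group. fourier M q \<xi> \<noteq> 0}"
proof (induction rule: trig_poly.induct)
  case (char \<eta>)
  have "{\<xi>\<in>dual_group. fourier M \<eta> \<xi> \<noteq> 0} \<subseteq> {\<eta>}" using char by (auto simp: fourier_char split: if_splits)
  then show ?case by (rule finite_subset) simp
next
  case (scale f c)
  have "{\<xi>\<in>dual_group. fourier M (\<lambda>x. c * f x) \<xi> \<noteq> 0} \<subseteq> {\<xi>\<in>dual_group. fourier M f \<xi> \<noteq> 0}"
    by (auto simp: fourier_scale)
  then show ?case using scale finite_subset by blast
next
  case (add f g)
  have "{\<xi>\<in>dual_group. fourier M (\<lambda>x. f x + g x) \<xi> \<noteq> 0}
      \<subseteq> {\<xi>\<in>dual_group. fourier M f \<xi> \<noteq> 0} \<union> {\<xi>\<in>dual_group. fourier M g \<xi> \<noteq> 0}"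
    using add(1,2) by (auto simp: fourier_add trig_poly_integrable)
  then show ?case using add by (meson finite_UnI finite_subset)
qed

text \<open>
  A trigonometric polynomial has finite spectrum, and approximation of \<open>f\<close> in \<open>L\<^sup>p\<close> changes all
  coefficients by a uniformly small amount.
\<close>

lemma riemann_lebesgue:
  assumes p: "p \<ge> 1" and f: "f \<in> Lp M p" and e: "e > 0"
  shows "finite {\<xi>\<in>dual_group. norm (fourier M f \<xi>) \<ge> e}"
proof -
  have "(e/2) powr p > 0" using e by simp
  then obtain q where q: "trig_poly q" "Lp_power M p (\<lambda>x. f x - q x) < (e/2) powr p"
    using compact_group_measure.trig_poly_dense[OF compact_group_measure[OF p] f] by metis
  have "{\<xi>\<in>dual_group. norm (fourier M f \<xi>) \<ge> e} \<subseteq> {\<xi>\<in>dual_group. fourier M q \<xi> \<noteq> 0}"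
  proof safe
    fix \<xi> assume xi: "\<xi> \<in> dual_group" "e \<le> norm (fourier M f \<xi>)" "fourier M q \<xi> = 0"
    have "norm (fourier M f \<xi> - fourier M q \<xi>) < 2 * (e/2)"
      by (rule fourier_close[OF p f trig_poly_Lp[OF q(1) p] _ q(2) xi(1)]) (use e in simp)
    then show False using xi by simp
  qed
  then show ?thesis using trig_poly_finite_spectrum[OF q(1)] finite_subset by blast
qed

subsection \<open>Fourier coefficients and the endomorphism\<close>

lemma comp_A_in_dual: "\<xi> \<in> dual_group \<Longrightarrow> (\<lambda>x. \<xi> (A x)) \<in> dual_group"
  unfolding dual_group_def
  by (auto simp: A_add intro: continuous_on_compose2[OF _ continuous_A])

lemma adjoint_in_dual: "\<xi> \<in> dual_group \<Longrightarrow> adjoint_hom A \<xi> \<in> dual_group"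
  using comp_A_in_dual by (simp add: adjoint_hom_def comp_def)

lemma adjoint_inj: "adjoint_hom A \<xi> = adjoint_hom A \<eta> \<Longrightarrow> \<xi> = \<eta>"
  using surj_A by (auto simp: adjoint_hom_def fun_eq_iff) (metis surjD)

lemma fourier_comp_A_adjoint:
  assumes f: "f \<in> borel_measurable M" and xi: "\<xi> \<in> dual_group"
  shows "fourier M (\<lambda>x. f (A x)) (adjoint_hom A \<xi>) = fourier M f \<xi>"
  using integral_comp_A(1)[of "\<lambda>x. f x * cnj (\<xi> x)"] f measurable_char[OF dual_group_cnj[OF xi]]
  by (simp add: fourier_def adjoint_hom_def)

text \<open>
  The dilate is invariant under translation by \<open>k\<close>, which multiplies its coefficient by \<open>cnj (\<xi> k)\<close>.
\<close>

lemma fourier_comp_A_zero: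
  assumes f: "f \<in> borel_measurable M" and xi: "\<xi> \<in> dual_group" and k: "k \<in> ker A" "\<xi> k \<noteq> 1"
  shows "fourier M (\<lambda>x. f (A x)) \<xi> = 0"
proof -
  have "translate k (\<lambda>x. f (A x)) = (\<lambda>x. f (A x))" using k(1) by (simp add: translate_def A_diff ker_def)
  then have "fourier M (\<lambda>x. f (A x)) \<xi> = cnj (\<xi> k) * fourier M (\<lambda>x. f (A x)) \<xi>"
    using fourier_translate[OF measurable_comp_A[OF f] xi, of k] by simp
  then have "(1 - cnj (\<xi> k)) * fourier M (\<lambda>x. f (A x)) \<xi> = 0" by (simp add: algebra_simps)
  moreover have "cnj (\<xi> k) \<noteq> 1" using k(2) by (metis complex_cnj_cnj complex_cnj_one)
  ultimately show ?thesis by simp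
qed

text \<open>
  The factorization exists because \<open>A\<close> is surjective; the factor is continuous because \<open>A\<close> is a closed map
  by compactness.
\<close>

lemma char_factor:
  assumes eta: "\<eta> \<in> dual_group" and triv: "\<And>k. k \<in> ker A \<Longrightarrow> \<eta> k = 1"
  obtains \<xi> where "\<xi> \<in> dual_group" "adjoint_hom A \<xi> = \<eta>"
proof -
  define s where "s = inv A"
  have As: "A (s x) = x" for x using surj_A by (simp add: s_def surj_f_inv_f)
  have wd: "\<eta> x = \<eta> y" if "A x = A y" for x y
  proof -
    have "\<eta> (x - y) = 1" using that by (intro triv) (simp add: ker_def A_diff)
    then have "\<eta> x * (\<eta> y * cnj (\<eta> y)) = \<eta> y" by (simp add: dual_group_diff[OF eta] mult_ac)
    then show ?thesis by (simp add: dual_group_mult_cnj[OF eta])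
  qed
  define \<xi> where "\<xi> = (\<lambda>x. \<eta> (s x))"
  have xA: "\<xi> (A x) = \<eta> x" for x unfolding \<xi>_def by (rule wd) (simp add: As)
  have "closed (\<xi> -` B)" if B: "closed B" for B
  proof -
    have "\<xi> -` B = A ` (\<eta> -` B)"
    proof (intro equalityI subsetI)
      fix x assume "x \<in> \<xi> -` B"
      then show "x \<in> A ` (\<eta> -` B)" by (intro rev_image_eqI[of "s x"]) (auto simp: As \<xi>_def)
    qed (auto simp: xA)
    moreover have "closed (\<eta> -` B)" by (rule closed_vimage[OF B dual_groupD(1)[OF eta]])
    then have "compact (\<eta> -` B)" using compact_group compact_Int_closed[of UNIV "\<eta> -` B"] by simp
    then have "compact (A ` (\<eta> -` B))"
      by (intro compact_continuous_image continuous_on_subset[OF continuous_A]) auto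
    ultimately show ?thesis by (simp add: compact_imp_closed)
  qed
  then have "continuous_on UNIV \<xi>" by (simp add: continuous_on_closed_vimage)
  moreover have "\<xi> (x + y) = \<xi> x * \<xi> y" for x y
  proof -
    have "\<xi> (x + y) = \<xi> (A (s x + s y))" by (simp add: A_add As)
    also have "\<dots> = \<xi> x * \<xi> y" unfolding xA by (simp add: dual_groupD(3)[OF eta] \<xi>_def)
    finally show ?thesis .
  qed
  ultimately have "\<xi> \<in> dual_group" unfolding dual_group_def using dual_groupD(2)[OF eta] by (auto simp: \<xi>_def)
  moreover have "adjoint_hom A \<xi> = \<eta>" by (auto simp: adjoint_hom_def xA)
  ultimately show ?thesis by (rule that)
qed

subsection \<open>Periodization\<close>

text \<open>
  The finite kernel makes \<open>A\<close> locally injective, and the local inverses are continuous by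
  compactness. This gives a piecewise continuous section of \<open>A\<close>, from which periodizations inherit
  Borel measurability.
\<close>

lemma finite_injective_cover:
  obtains \<C> where "finite \<C>" "\<Union>\<C> = (UNIV :: 'a set)" "\<And>C. C \<in> \<C> \<Longrightarrow> closed C" "\<And>C. C \<in> \<C> \<Longrightarrow> inj_on A C"
proof -
  let ?S = "ker A - {0}"
  have "\<forall>k::'a. \<exists>\<xi>. k \<noteq> 0 \<longrightarrow> \<xi> \<in> dual_group \<and> \<xi> k \<noteq> 1" using separates by blast
  from choice[OF this] obtain X :: "'a \<Rightarrow> 'a \<Rightarrow> complex"
    where "\<forall>k. k \<noteq> 0 \<longrightarrow> X k \<in> dual_group \<and> X k k \<noteq> 1" ..
  then have X: "\<And>k. k \<noteq> 0 \<Longrightarrow> X k \<in> dual_group" "\<And>k. k \<noteq> 0 \<Longrightarrow> X k k \<noteq> 1" by auto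
  define \<delta> where "\<delta> = Min (insert 1 ((\<lambda>k. norm (X k k - 1)) ` ?S))"
  have d: "\<delta> > 0" "\<And>k. k \<in> ?S \<Longrightarrow> \<delta> \<le> norm (X k k - 1)"
    using finite_ker X(2) by (auto simp: \<delta>_def Min_gr_iff intro!: Min_le)
  \<comment> \<open>Points of \<open>C x\<close> with the same image differ by some \<open>k\<close> in the kernel, at which \<open>X k\<close> would be within
    \<open>2 * \<delta>/3\<close> of \<open>1\<close>.\<close>
  define C where "C = (\<lambda>x. {y. \<forall>k\<in>?S. norm (X k y - X k x) \<le> \<delta>/3})"
  define O' where "O' = (\<lambda>x. {y. \<forall>k\<in>?S. norm (X k y - X k x) < \<delta>/3})"
  have Xc: "continuous_on UNIV (X k)" if "k \<in> ?S" for k using X(1) that dual_groupD(1) by auto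
  have "O' x = (\<Inter>k\<in>?S. {y. norm (X k y - X k x) < \<delta>/3})" for x by (auto simp: O'_def)
  then have op: "open (O' x)" for x
    using finite_ker by (auto intro!: open_INT open_Collect_less continuous_intros Xc)
  have "C x = (\<Inter>k\<in>?S. {y. norm (X k y - X k x) \<le> \<delta>/3})" for x by (auto simp: C_def)
  then have cl: "closed (C x)" for x
    by (auto intro!: closed_INT closed_Collect_le continuous_intros Xc)
  have inj: "inj_on A (C x)" for x
  proof (rule inj_onI, rule ccontr)
    fix y z assume yz: "y \<in> C x" "z \<in> C x" "A y = A z" "y \<noteq> z"
    let ?k = "y - z"
    have k: "?k \<in> ?S" using yz by (simp add: ker_def A_diff)
    then have Xk: "X ?k \<in> dual_group" using X(1) by auto
    have "norm (X ?k y - X ?k x) \<le> \<delta>/3" "norm (X ?k z - X ?k x) \<le> \<delta>/3" using yz(1,2) k unfolding C_def by blast+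
    then have "norm (X ?k y - X ?k z) \<le> \<delta>/3 + \<delta>/3"
      using norm_triangle_ineq4[of "X ?k y - X ?k x" "X ?k z - X ?k x"] by simp
    moreover have "X ?k ?k - 1 = (X ?k y - X ?k z) * cnj (X ?k z)"
      using dual_group_mult_cnj[OF Xk] by (simp add: dual_group_diff[OF Xk] algebra_simps)
    then have "norm (X ?k ?k - 1) = norm (X ?k y - X ?k z)" by (simp add: norm_mult dual_groupD(2)[OF Xk])
    ultimately show False using d(1) d(2)[OF k] by simp
  qed
  have "x \<in> O' x" for x using d(1) by (simp add: O'_def)
  then have "(UNIV::'a set) \<subseteq> (\<Union>x\<in>UNIV. O' x)" by blast
  then obtain D where D: "finite D" "(UNIV::'a set) \<subseteq> (\<Union>x\<in>D. O' x)"
    using compactE_image[OF compact_group, of UNIV O'] op by metis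
  have "O' x \<subseteq> C x" for x unfolding O'_def C_def using less_imp_le by blast
  then have "\<Union>(C ` D) = UNIV" using D(2) by blast
  then show ?thesis using that[of "C ` D"] D(1) cl inj by auto
qed

lemma periodization_A: "periodization A f (A y) = (\<Sum>a\<in>ker A. f (y + a))"
  by (rule periodization_eq[OF hom_A refl])

lemma measurable_periodization:
  assumes f: "f \<in> borel_measurable M" shows "periodization A f \<in> borel_measurable M"
proof -
  obtain \<C> where C: "finite \<C>" "\<Union>\<C> = (UNIV :: 'a set)" "\<And>C. C \<in> \<C> \<Longrightarrow> closed C" "\<And>C. C \<in> \<C> \<Longrightarrow> inj_on A C"
    using finite_injective_cover by metis
  have cpt: "compact C" if "C \<in> \<C>" for C using compact_Int_closed[OF compact_group C(3)[OF that]] by simp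
  have "periodization A f \<in> borel_measurable borel"
  proof (rule measurable_piecewise_restrict[where C = "(\<lambda>C. A ` C) ` \<C>"])
    show "countable ((\<lambda>C. A ` C) ` \<C>)" using C(1) by (intro countable_finite finite_imageI)
    show "space borel \<subseteq> \<Union>((\<lambda>C. A ` C) ` \<C>)" using C(2) surj_A by (auto simp: surj_def) (metis UNIV_I UnionE image_eqI)
  next
    fix \<Omega> assume "\<Omega> \<in> (\<lambda>C. A ` C) ` \<C>"
    then obtain D where D: "D \<in> \<C>" "\<Omega> = A ` D" by auto
    have co: "compact (A ` D)"
      by (intro compact_continuous_image continuous_on_subset[OF continuous_A] cpt D) auto
    then show "\<Omega> \<inter> space borel \<in> sets borel" using D by (simp add: compact_imp_closed borel_closed)
    define s where "s = the_inv_into D A"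
    have sA: "s (A x) = x" if "x \<in> D" for x using the_inv_into_f_f[OF C(4)[OF D(1)] that] by (simp add: s_def)
    have "continuous_on (A ` D) s"
      by (intro continuous_on_inv continuous_on_subset[OF continuous_A] cpt D) (auto simp: sA)
    then have sm: "s \<in> borel_measurable (restrict_space borel \<Omega>)"
      unfolding D(2) by (rule borel_measurable_continuous_on_restrict)
    have "(\<lambda>x. f (x + a)) \<in> borel_measurable borel" for a
      using measurable_translate[OF f] measurable_M_iff by blast
    then have "(\<lambda>x. f (s x + a)) \<in> borel_measurable (restrict_space borel \<Omega>)" for a
      using measurable_compose[OF sm] by blast
    then have "(\<lambda>x. \<Sum>a\<in>ker A. f (s x + a)) \<in> borel_measurable (restrict_space borel \<Omega>)"
      by (intro borel_measurable_sum)
    moreover have "periodization A f x = (\<Sum>a\<in>ker A. f (s x + a))" if "x \<in> \<Omega>" for x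
      using that D(2) sA by (auto simp: periodization_A)
    ultimately show "periodization A f \<in> borel_measurable (restrict_space borel \<Omega>)"
      by (subst measurable_cong[where g = "\<lambda>x. \<Sum>a\<in>ker A. f (s x + a)"]) (auto simp: space_restrict_space)
  qed
  then show ?thesis by (simp add: measurable_M_iff)
qed

lemma periodization_Lp:
  assumes p: "p \<ge> 1" and f: "f \<in> Lp M p" shows "periodization A f \<in> Lp M p"
proof -
  have m: "periodization A f \<in> borel_measurable M" by (rule measurable_periodization[OF LpD(1)[OF f]])
  have "(\<lambda>y. f (y + a)) \<in> Lp M p" for a using translate_Lp(1)[OF f, of "- a"] by (simp add: translate_def)
  then have "(\<lambda>y. \<Sum>a\<in>ker A. f (y + a)) \<in> Lp M p" by (intro Lp_sum p finite_ker)
  then have "(\<lambda>y. periodization A f (A y)) \<in> Lp M p" by (simp add: periodization_A)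
  then show ?thesis
    using m integral_comp_A(2)[of "\<lambda>x. norm (periodization A f x) powr p"] by (simp add: Lp_def)
qed

text \<open>
  Composed with \<open>A\<close>, the periodization is the sum of the translates of \<open>f\<close> by the kernel, and these all
  have the same coefficient at a character that is trivial on the kernel.
\<close>

lemma fourier_periodization:
  assumes p: "p \<ge> 1" and f: "f \<in> Lp M p" and xi: "\<xi> \<in> dual_group"
  shows "fourier M (periodization A f) \<xi> = of_nat (card (ker A)) * fourier M f (adjoint_hom A \<xi>)"
proof -
  note m = measurable_periodization[OF LpD(1)[OF f]] and ad = adjoint_in_dual[OF xi]
  have i: "integrable M (translate a f)" for a by (rule Lp_integrable[OF p translate_Lp(1)[OF f]])
  have "fourier M (periodization A f) \<xi> = fourier M (\<lambda>y. \<Sum>a\<in>ker A. 1 * translate (- a) f y) (adjoint_hom A \<xi>)"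
    using fourier_comp_A_adjoint[OF m xi] by (simp add: periodization_A translate_def)
  also have "\<dots> = (\<Sum>a\<in>ker A. 1 * fourier M (translate (- a) f) (adjoint_hom A \<xi>))"
    by (rule fourier_sum[OF finite_ker i ad])
  also have "\<dots> = (\<Sum>a\<in>ker A. fourier M f (adjoint_hom A \<xi>))"
  proof (rule sum.cong[OF refl])
    fix a assume "a \<in> ker A"
    then have "adjoint_hom A \<xi> (- a) = 1"
      using dual_group_zero[OF xi] dual_group_uminus[OF ad, of a] by (simp add: adjoint_hom_def ker_def)
    then show "1 * fourier M (translate (- a) f) (adjoint_hom A \<xi>) = fourier M f (adjoint_hom A \<xi>)"
      using fourier_translate[OF LpD(1)[OF f] ad, of "- a"] by simp
  qed
  finally show ?thesis by simp
qed

subsection \<open>Averages over the kernels\<close>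

text \<open>
  Membership in a coset of the annihilator of \<open>K j\<close>, expressed by values on \<open>K j\<close>: see
  \<open>mem_char_coset_iff\<close>.
\<close>

definition same_coset :: "nat \<Rightarrow> ('a \<Rightarrow> complex) \<Rightarrow> ('a \<Rightarrow> complex) \<Rightarrow> bool" where
  "same_coset j \<xi> \<eta> \<longleftrightarrow> (\<forall>a\<in>K j. \<xi> a = \<eta> a)"

lemma same_coset_refl: "same_coset j \<xi> \<xi>"
  by (simp add: same_coset_def)

lemma same_coset_mono: "same_coset j \<xi> \<eta> \<Longrightarrow> i \<le> j \<Longrightarrow> same_coset i \<xi> \<eta>"
  using monoD[OF mono_K, of i j] by (auto simp: same_coset_def)

lemma mem_char_coset_iff:
  assumes eta: "\<eta> \<in> dual_group"
  shows "\<xi> \<in> char_coset (annihilator (K j)) \<eta> \<longleftrightarrow> \<xi> \<in> dual_group \<and> same_coset j \<xi> \<eta>"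
proof
  assume "\<xi> \<in> char_coset (annihilator (K j)) \<eta>"
  then show "\<xi> \<in> dual_group \<and> same_coset j \<xi> \<eta>"
    using eta by (auto simp: char_coset_def annihilator_def char_add_def same_coset_def dual_group_mult)
next
  assume *: "\<xi> \<in> dual_group \<and> same_coset j \<xi> \<eta>"
  then have "(\<lambda>x. \<xi> x * cnj (\<eta> x)) \<in> annihilator (K j)"
    using dual_group_mult[OF _ dual_group_cnj[OF eta]]
    by (auto simp: annihilator_def same_coset_def dual_group_mult_cnj[OF eta])
  moreover have "\<xi> = char_add (\<lambda>x. \<xi> x * cnj (\<eta> x)) \<eta>"
    using dual_group_mult_cnj[OF eta] by (simp add: char_add_def fun_eq_iff mult_ac)
  ultimately show "\<xi> \<in> char_coset (annihilator (K j)) \<eta>" unfolding char_coset_def by blast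
qed

lemma sum_char_mult_cnj:
  assumes "\<eta> \<in> dual_group" "\<xi> \<in> dual_group"
  shows "(\<Sum>a\<in>K j. \<eta> a * cnj (\<xi> a)) = (if same_coset j \<xi> \<eta> then of_nat (card (K j)) else 0)"
proof (cases "same_coset j \<xi> \<eta>")
  case True
  then have "(\<Sum>a\<in>K j. \<eta> a * cnj (\<xi> a)) = (\<Sum>a\<in>K j. 1)"
    by (intro sum.cong) (auto simp: same_coset_def dual_group_mult_cnj[OF assms(1)])
  then show ?thesis using True by simp
next
  case False
  then obtain b where b: "b \<in> K j" "\<xi> b \<noteq> \<eta> b" by (auto simp: same_coset_def)
  have "\<eta> b * cnj (\<xi> b) \<noteq> 1"
  proof
    assume "\<eta> b * cnj (\<xi> b) = 1"
    then have "\<eta> b * (\<xi> b * cnj (\<xi> b)) = \<xi> b" by (simp add: mult_ac)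
    then show False using b dual_group_mult_cnj[OF assms(2)] by simp
  qed
  then show ?thesis
    using False sum_nontrivial_char[OF subgroup_K, of j "\<lambda>a. \<eta> a * cnj (\<xi> a)" b] b(1)
    by (simp add: dual_groupD(3)[OF assms(1)] dual_groupD(3)[OF assms(2)])
qed

text \<open>
  Convolution of \<open>f\<close> with the measure \<open>\<eta>\<close> times normalized counting measure on \<open>K j\<close>: the projection to the
  coefficients in the coset of \<open>\<eta>\<close>.
\<close>

definition char_average :: "nat \<Rightarrow> ('a \<Rightarrow> complex) \<Rightarrow> ('a \<Rightarrow> complex) \<Rightarrow> 'a \<Rightarrow> complex" where
  "char_average j \<eta> f = (\<lambda>x. \<Sum>a\<in>K j. (\<eta> a / of_nat (card (K j))) * translate a f x)"

lemma fourier_sum_translates: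
  assumes p: "p \<ge> 1" and f: "f \<in> Lp M p" and xi: "\<xi> \<in> dual_group"
  shows "fourier M (\<lambda>x. \<Sum>a\<in>K j. c a * translate a f x) \<xi> = (\<Sum>a\<in>K j. c a * cnj (\<xi> a)) * fourier M f \<xi>"
  using fourier_sum[OF finite_K[of j] _ xi, of "\<lambda>a. translate a f" c] Lp_integrable[OF p translate_Lp(1)[OF f]]
  by (simp add: fourier_translate[OF LpD(1)[OF f] xi] sum_distrib_right mult.assoc)

lemma sum_translates_Lp:
  assumes "p \<ge> 1" "f \<in> Lp M p"
  shows "(\<lambda>x. \<Sum>a\<in>K j. c a * translate a f x) \<in> Lp M p"
  by (intro Lp_sum Lp_scale translate_Lp assms finite_K)

lemma char_average_Lp: "p \<ge> 1 \<Longrightarrow> f \<in> Lp M p \<Longrightarrow> char_average j \<eta> f \<in> Lp M p"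
  unfolding char_average_def by (rule sum_translates_Lp)

lemma fourier_char_average:
  assumes p: "p \<ge> 1" and f: "f \<in> Lp M p" and dual: "\<xi> \<in> dual_group" "\<eta> \<in> dual_group"
  shows "fourier M (char_average j \<eta> f) \<xi> = (if same_coset j \<xi> \<eta> then fourier M f \<xi> else 0)"
  using card_K_pos[of j] sum_char_mult_cnj[OF dual(2,1), of j]
  unfolding char_average_def fourier_sum_translates[OF p f dual(1)]
  by (simp add: sum_divide_distrib[symmetric])

text \<open>
  Pointwise, the average is dominated by a convex combination of absolute values of translates, and
  the \<open>p\<close>-th power is convex.
\<close>

lemma Lp_power_char_average_le:
  assumes p: "p \<ge> 1" and f: "f \<in> Lp M p" and eta: "\<eta> \<in> dual_group"
  shows "Lp_power M p (char_average j \<eta> f) \<le> Lp_power M p f"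
proof -
  let ?N = "real (card (K j))"
  have N: "?N > 0" using card_K_pos by simp
  have i: "integrable M (\<lambda>x. norm (translate a f x) powr p)" for a by (rule LpD(2)[OF translate_Lp(1)[OF f]])
  have pw: "norm (char_average j \<eta> f x) powr p \<le> (\<Sum>a\<in>K j. 1 / ?N * norm (translate a f x) powr p)" for x
  proof -
    have "norm (char_average j \<eta> f x) \<le> (\<Sum>a\<in>K j. 1 / ?N * norm (translate a f x))"
      unfolding char_average_def
      by (rule sum_norm_le) (simp add: norm_mult norm_divide dual_groupD(2)[OF eta])
    then have "norm (char_average j \<eta> f x) powr p \<le> (\<Sum>a\<in>K j. 1 / ?N * norm (translate a f x)) powr p"
      using p by (intro powr_mono2) auto
    also have "\<dots> \<le> (\<Sum>a\<in>K j. 1 / ?N * norm (translate a f x) powr p)"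
      using convex_on_sum[OF finite_K _ convex_on_powr_nonneg[OF p], of j "\<lambda>_. 1 / ?N" "\<lambda>a. norm (translate a f x)"] N
        add_subgroup_zero[OF subgroup_K] by auto
    finally show ?thesis .
  qed
  have "Lp_power M p (char_average j \<eta> f) \<le> (LINT x|M. (\<Sum>a\<in>K j. 1 / ?N * norm (translate a f x) powr p))"
    unfolding Lp_power_def
    by (rule integral_mono[OF LpD(2)[OF char_average_Lp[OF p f]] _ pw]) (use i in simp)
  also have "\<dots> = (\<Sum>a\<in>K j. 1 / ?N * Lp_power M p (translate a f))"
    unfolding Lp_power_def by (subst Bochner_Integration.integral_sum) (use i in auto)
  also have "\<dots> = Lp_power M p f" using N by (simp add: translate_Lp(2)[OF f])
  finally show ?thesis .
qed

lemma char_average_add: "char_average j \<eta> (\<lambda>x. f x + g x) x = char_average j \<eta> f x + char_average j \<eta> g x"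
  and char_average_diff: "char_average j \<eta> (\<lambda>x. f x - g x) x = char_average j \<eta> f x - char_average j \<eta> g x"
  and char_average_scale: "char_average j \<eta> (\<lambda>x. c * f x) x = c * char_average j \<eta> f x"
  by (simp_all add: char_average_def translate_def distrib_left right_diff_distrib sum.distrib
      sum_subtractf sum_distrib_left mult_ac add_divide_distrib diff_divide_distrib)

text \<open>
  By density of the kernels, two distinct characters eventually differ on \<open>K j\<close>, and from then on the
  average of one against the other vanishes.
\<close>

lemma char_average_trig_poly:
  assumes eta: "\<eta> \<in> dual_group" and q: "trig_poly q"
  shows "\<forall>\<^sub>F j in sequentially. \<forall>x. char_average j \<eta> q x = fourier M q \<eta> * \<eta> x"
  using q
proof induction
  case (char \<xi>)
  have *: "char_average j \<eta> \<xi> x = (\<Sum>a\<in>K j. \<eta> a * cnj (\<xi> a)) / of_nat (card (K j)) * \<xi> x" for j x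
    unfolding char_average_def translate_def
    by (simp add: dual_group_diff[OF char] sum_distrib_left sum_divide_distrib mult_ac)
  have ex: "\<exists>i. \<xi> = \<eta> \<or> \<not> same_coset i \<xi> \<eta>"
    using char_eqI[OF char eta] by (auto simp: same_coset_def)
  then obtain i where i: "\<xi> = \<eta> \<or> \<not> same_coset i \<xi> \<eta>" by blast
  show ?case
    using eventually_ge_at_top[of i]
  proof eventually_elim
    case (elim j)
    then have "same_coset j \<xi> \<eta> \<longleftrightarrow> \<xi> = \<eta>" using i same_coset_mono same_coset_refl by blast
    then show ?case
      unfolding * sum_char_mult_cnj[OF eta char] fourier_char[OF char eta]
      using card_K_pos[of j] by auto
  qed
next
  case (scale f c)
  from scale.IH show ?case by eventually_elim (simp add: char_average_scale fourier_scale)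
next
  case (add f g)
  from add.IH show ?case
    by eventually_elim
       (simp add: char_average_add fourier_add trig_poly_integrable add.hyps eta distrib_right)
qed

text \<open>
  Approximation by trigonometric polynomials, for which the average is eventually exact, together with
  the uniform bound on the averages.
\<close>

lemma char_average_tendsto:
  assumes p: "p \<ge> 1" and f: "f \<in> Lp M p" and eta: "\<eta> \<in> dual_group" and e: "e > 0"
  shows "\<forall>\<^sub>F j in sequentially. Lp_power M p (\<lambda>x. char_average j \<eta> f x - fourier M f \<eta> * \<eta> x) < e"
proof -
  \<comment> \<open>An approximation error of \<open>t powr p\<close> contributes at most \<open>C * t powr p = e\<close>.\<close>
  define C where "C = 2 powr p * (1 + 2 powr p)"
  define t where "t = (e / C) powr (1 / p)"
  have C: "C > 0" by (simp add: C_def add_pos_pos)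
  have t: "t > 0" "t powr p = e / C" using C e p by (auto simp: t_def powr_powr)
  then have "t powr p > 0" using C e by simp
  then obtain q where q: "trig_poly q" "Lp_power M p (\<lambda>x. f x - q x) < t powr p"
    using compact_group_measure.trig_poly_dense[OF compact_group_measure[OF p] f] by metis
  note qL = trig_poly_Lp[OF q(1) p]
  let ?d = "fourier M q \<eta> - fourier M f \<eta>"
  have d: "norm ?d < 2 * t"
    using fourier_close[OF p f qL t(1) q(2) eta] by (simp add: norm_minus_commute)
  have dL: "(\<lambda>x. ?d * \<eta> x) \<in> Lp M p" by (rule Lp_scale(1)[OF char_Lp[OF eta p]])
  have "Lp_power M p (\<lambda>x. ?d * \<eta> x) = norm ?d powr p"
    by (simp add: Lp_power_def norm_mult dual_groupD(2)[OF eta] prob_space)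
  also have "\<dots> \<le> (2 * t) powr p" using d p by (intro powr_mono2) auto
  also have "\<dots> = 2 powr p * t powr p" using t by (simp add: powr_mult)
  finally have d2: "Lp_power M p (\<lambda>x. ?d * \<eta> x) \<le> 2 powr p * t powr p" .
  show ?thesis
    using char_average_trig_poly[OF eta q(1)]
  proof eventually_elim
    case (elim j)
    have fq: "(\<lambda>x. f x - q x) \<in> Lp M p" by (rule Lp_diff[OF p f qL])
    have "Lp_power M p (\<lambda>x. char_average j \<eta> f x - fourier M f \<eta> * \<eta> x)
        = Lp_power M p (\<lambda>x. char_average j \<eta> (\<lambda>x. f x - q x) x + ?d * \<eta> x)"
      using elim by (simp add: char_average_diff algebra_simps)
    also have "\<dots> \<le> 2 powr p * (Lp_power M p (char_average j \<eta> (\<lambda>x. f x - q x)) + Lp_power M p (\<lambda>x. ?d * \<eta> x))"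
      by (rule Lp_add(2)[OF p char_average_Lp[OF p fq] dL])
    also have "\<dots> \<le> 2 powr p * (Lp_power M p (\<lambda>x. f x - q x) + 2 powr p * t powr p)"
      using d2 Lp_power_char_average_le[OF p fq eta] by (intro mult_left_mono add_mono) auto
    also have "\<dots> < 2 powr p * (t powr p + 2 powr p * t powr p)"
      using q(2) by (intro mult_strict_left_mono add_strict_right_mono) auto
    also have "\<dots> = C * t powr p" by (simp add: C_def algebra_simps)
    also have "\<dots> = e" using t C by simp
    finally show ?case .
  qed
qed

end


section \<open>Scaling sequences satisfy the coefficient conditions\<close>

locale scaling_mra = expanding_endomorphism A M
  for A :: "'a::{topological_ab_group_add, second_countable_topology, t2_space} \<Rightarrow> 'a" and M +
  fixes p :: real and \<phi> :: "nat \<Rightarrow> 'a \<Rightarrow> complex" and V :: "nat \<Rightarrow> ('a \<Rightarrow> complex) set"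
  assumes p: "1 \<le> p" and phi: "\<phi> j \<in> Lp M p"
    and MRA: "MRA M p A V" and scaling: "scaling_sequence M A V \<phi>"
begin

lemma V_subset_Lp: "V j \<subseteq> Lp M p" and V_mono_Suc: "V j \<subseteq> V (Suc j)"
  and V_dense: "Lp_closure M p (\<Union>j. V j) = Lp M p"
  and V_dilate: "f \<in> V j \<Longrightarrow> (\<lambda>x. f (A x)) \<in> V (Suc j)"
  using MRA by (auto simp: MRA_def closed_subspace_def)

lemma phi_in_V: "\<phi> j \<in> V j"
  and basis: "is_basis M (K j) (\<lambda>a. translate a (\<phi> j)) (V j)"
  using scaling by (auto simp: scaling_sequence_def)

text \<open>
  The factor depends on \<open>\<xi>\<close> only through its restriction to \<open>K j\<close>; refinement and dilation relations are
  instances of this formula.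
\<close>

lemma V_fourier:
  assumes f: "f \<in> V j"
  obtains c where "\<And>\<xi>. \<xi> \<in> dual_group \<Longrightarrow>
    fourier M f \<xi> = (\<Sum>a\<in>K j. c a * cnj (\<xi> a)) * fourier M (\<phi> j) \<xi>"
proof -
  obtain c where c: "AE x in M. f x = (\<Sum>a\<in>K j. c a * translate a (\<phi> j) x)"
    using basis[of j] f by (auto simp: is_basis_def)
  have fL: "f \<in> Lp M p" using f V_subset_Lp by blast
  have "fourier M f \<xi> = (\<Sum>a\<in>K j. c a * cnj (\<xi> a)) * fourier M (\<phi> j) \<xi>" if xi: "\<xi> \<in> dual_group" for \<xi>
    using fourier_cong_AE[OF c LpD(1)[OF fL] LpD(1)[OF sum_translates_Lp[OF p phi]] xi]
    by (simp add: fourier_sum_translates[OF p phi xi])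
  then show ?thesis by (rule that)
qed

lemma sum_cnj_same_coset: "same_coset j \<xi> \<eta> \<Longrightarrow> (\<Sum>a\<in>K j. c a * cnj (\<xi> a)) = (\<Sum>a\<in>K j. c a * cnj (\<eta> a))"
  by (rule sum.cong) (auto simp: same_coset_def)

text \<open>
  If the coefficients vanished on a coset, the average of the translates of \<open>\<phi> j\<close> against the
  character would be a nontrivial relation among basis vectors.
\<close>

lemma nonvanishing_on_coset:
  assumes eta: "\<eta> \<in> dual_group"
  shows "\<exists>\<xi>\<in>dual_group. same_coset j \<xi> \<eta> \<and> fourier M (\<phi> j) \<xi> \<noteq> 0"
proof (rule ccontr)
  assume *: "\<not> ?thesis"
  have z: "(\<lambda>x. 0) \<in> Lp M p" by (simp add: Lp_def)
  have "AE x in M. char_average j \<eta> (\<phi> j) x = 0"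
    by (rule fourier_inj[OF p char_average_Lp[OF p phi] z])
       (use * eta in \<open>auto simp: fourier_char_average[OF p phi] fourier_def[of M "\<lambda>x. 0"]\<close>)
  moreover have "\<forall>c. (AE x in M. (\<Sum>a\<in>K j. c a * translate a (\<phi> j) x) = 0) \<longrightarrow> (\<forall>a\<in>K j. c a = 0)"
    using basis[of j] by (simp add: is_basis_def)
  from spec[OF this, of "\<lambda>a. \<eta> a / of_nat (card (K j))"]
  have "(AE x in M. char_average j \<eta> (\<phi> j) x = 0) \<longrightarrow> (\<forall>a\<in>K j. \<eta> a / of_nat (card (K j)) = 0)"
    by (simp only: char_average_def)
  ultimately have "\<forall>a\<in>K j. \<eta> a / of_nat (card (K j)) = 0" by blast
  then have "\<eta> 0 = 0" using card_K_pos[of j] add_subgroup_zero[OF subgroup_K, of j] by auto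
  then show False using dual_group_zero[OF eta] by simp
qed

text \<open>A coefficient vanishing for all \<open>\<phi> j\<close> would vanish on the whole of \<open>L\<^sup>p\<close>, even for the character itself.\<close>

lemma nonvanishing_at_level:
  assumes xi: "\<xi> \<in> dual_group" shows "\<exists>j. fourier M (\<phi> j) \<xi> \<noteq> 0"
proof (rule ccontr)
  assume *: "\<not> ?thesis"
  have "\<xi> \<in> Lp_closure M p (\<Union>j. V j)" unfolding V_dense by (rule char_Lp[OF xi p])
  then obtain g j where g: "g \<in> V j" "Lp_norm M p (\<lambda>x. \<xi> x - g x) < 1/2"
    unfolding Lp_closure_def by (force dest: spec[of _ "1/2"])
  have gL: "g \<in> Lp M p" using g V_subset_Lp by blast
  have "norm (fourier M \<xi> \<xi> - fourier M g \<xi>) < 2 * (1/2)"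
    using g(2) Lp_norm_less_iff[OF p, of "1/2"] by (intro fourier_close[OF p char_Lp[OF xi p] gL _ _ xi]) auto
  moreover have "fourier M g \<xi> = 0" using V_fourier[OF g(1)] xi * by (metis mult_zero_right)
  ultimately show False by (simp add: fourier_char[OF xi xi])
qed

lemma refinement_coefficient:
  assumes eta: "\<eta> \<in> dual_group"
  shows "\<exists>\<mu>. \<forall>\<xi>\<in>dual_group. same_coset (Suc j) \<xi> \<eta> \<longrightarrow> fourier M (\<phi> j) \<xi> = \<mu> * fourier M (\<phi> (Suc j)) \<xi>"
proof -
  obtain c where c: "\<And>\<xi>. \<xi> \<in> dual_group \<Longrightarrow>
    fourier M (\<phi> j) \<xi> = (\<Sum>a\<in>K (Suc j). c a * cnj (\<xi> a)) * fourier M (\<phi> (Suc j)) \<xi>"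
    using V_fourier[of "\<phi> j" "Suc j"] phi_in_V[of j] V_mono_Suc[of j] by blast
  show ?thesis
    by (rule exI[of _ "\<Sum>a\<in>K (Suc j). c a * cnj (\<eta> a)"]) (use c sum_cnj_same_coset in metis)
qed

text \<open>
  The dilate of \<open>\<phi> j\<close> is a combination of translates of the next function, which gives the inverse \<open>m\<close> of
  the required factor; \<open>m\<close> is nonzero because \<open>\<phi> j\<close> does not vanish on the coset.
\<close>

lemma dilation_coefficient:
  assumes eta: "\<eta> \<in> dual_group"
  shows "\<exists>\<gamma>. \<gamma> \<noteq> 0 \<and> (\<forall>\<xi>\<in>dual_group. same_coset j \<xi> \<eta> \<longrightarrow>
    fourier M (\<phi> (Suc j)) (adjoint_hom A \<xi>) = \<gamma> * fourier M (\<phi> j) \<xi>)"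
proof -
  obtain c where c: "\<And>\<xi>. \<xi> \<in> dual_group \<Longrightarrow>
    fourier M (\<lambda>x. \<phi> j (A x)) \<xi> = (\<Sum>a\<in>K (Suc j). c a * cnj (\<xi> a)) * fourier M (\<phi> (Suc j)) \<xi>"
    using V_fourier[OF V_dilate[OF phi_in_V[of j]]] by blast
  define m where "m = (\<Sum>a\<in>K (Suc j). c a * cnj (\<eta> (A a)))"
  have eq: "fourier M (\<phi> j) \<xi> = m * fourier M (\<phi> (Suc j)) (adjoint_hom A \<xi>)"
    if xi: "\<xi> \<in> dual_group" "same_coset j \<xi> \<eta>" for \<xi>
  proof -
    have "fourier M (\<phi> j) \<xi> = fourier M (\<lambda>x. \<phi> j (A x)) (adjoint_hom A \<xi>)"
      by (rule fourier_comp_A_adjoint[OF LpD(1)[OF phi] xi(1), symmetric])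
    also have "\<dots> = (\<Sum>a\<in>K (Suc j). c a * cnj (adjoint_hom A \<xi> a)) * fourier M (\<phi> (Suc j)) (adjoint_hom A \<xi>)"
      by (rule c[OF adjoint_in_dual[OF xi(1)]])
    also have "(\<Sum>a\<in>K (Suc j). c a * cnj (adjoint_hom A \<xi> a)) = m"
      unfolding m_def by (rule sum.cong) (use xi(2) A_in_K in \<open>auto simp: same_coset_def adjoint_hom_def\<close>)
    finally show ?thesis .
  qed
  obtain \<xi>0 where "\<xi>0 \<in> dual_group" "same_coset j \<xi>0 \<eta>" "fourier M (\<phi> j) \<xi>0 \<noteq> 0"
    using nonvanishing_on_coset[OF eta] by blast
  then have "m \<noteq> 0" using eq[of \<xi>0] by auto
  then show ?thesis using eq by (intro exI[of _ "1 / m"]) auto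
qed

lemma adjoint_power: "(adjoint_hom A ^^ n) \<xi> = (\<lambda>x. \<xi> ((A ^^ n) x))"
  by (induction n) (auto simp: adjoint_hom_def funpow_swap1)

lemma adjoint_power_in_dual: "\<xi> \<in> dual_group \<Longrightarrow> (adjoint_hom A ^^ n) \<xi> \<in> dual_group"
  by (induction n) (auto simp: adjoint_in_dual)

text \<open>A character with a periodic orbit is trivial on every kernel, hence on a dense set.\<close>

lemma adjoint_orbit_inj:
  assumes xi: "\<xi> \<in> dual_group" "\<xi> \<noteq> char_zero" shows "inj (\<lambda>n. (adjoint_hom A ^^ n) \<xi>)"
proof -
  have no_period: False if per: "(adjoint_hom A ^^ k) \<xi> = \<xi>" and k: "k > 0" for k
  proof -
    have iter: "(adjoint_hom A ^^ (n * k)) \<xi> = \<xi>" for n by (induction n) (simp_all add: funpow_add per)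
    have "\<xi> a = char_zero a" if a: "a \<in> K j" for j a
    proof -
      have "K j \<subseteq> K (j * k)" using k by (intro monoD[OF mono_K]) simp
      then have "(A ^^ (j * k)) a = 0" using a by (auto simp: ker_def)
      then have "\<xi> a = \<xi> 0" using fun_cong[OF iter[of j], of a] by (simp add: adjoint_power)
      then show ?thesis using dual_group_zero[OF xi(1)] by (simp add: char_zero_def)
    qed
    then have "\<xi> = char_zero" by (rule char_eqI[OF xi(1) char_zero_in_dual])
    then show False using xi by simp
  qed
  have cancel: "(adjoint_hom A ^^ k) \<xi> = \<xi>" if "(adjoint_hom A ^^ (m + k)) \<xi> = (adjoint_hom A ^^ m) \<xi>" for m k
    using that by (induction m) (auto dest: adjoint_inj)
  have lt: "(adjoint_hom A ^^ m) \<xi> \<noteq> (adjoint_hom A ^^ n) \<xi>" if "m < n" for m n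
  proof
    assume "(adjoint_hom A ^^ m) \<xi> = (adjoint_hom A ^^ n) \<xi>"
    then have "(adjoint_hom A ^^ (n - m)) \<xi> = \<xi>" using that by (intro cancel[of m]) simp
    from no_period[OF this] show False using that by simp
  qed
  then show ?thesis by (intro injI) (metis nat_neq_iff)
qed

text \<open>
  At the trivial character the dilation relation propagates non-vanishing to level \<open>0\<close>. There,
  refinement and dilation combine to invariance of the coefficients of \<open>\<phi> 0\<close> along orbits of the
  adjoint, which the Riemann--Lebesgue lemma excludes on infinite orbits unless they vanish.
\<close>

lemma level_zero_constant:
  assumes xi: "\<xi> \<in> dual_group" "\<xi> \<noteq> char_zero" shows "fourier M (\<phi> 0) \<xi> = 0"
proof (rule ccontr)
  assume nz: "fourier M (\<phi> 0) \<xi> \<noteq> 0"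
  have ad0: "adjoint_hom A char_zero = char_zero" by (simp add: adjoint_hom_def char_zero_def fun_eq_iff)
  note zd = char_zero_in_dual
  have step: "fourier M (\<phi> (Suc j)) char_zero = 0" if "fourier M (\<phi> j) char_zero = 0" for j
    using dilation_coefficient[OF zd, of j] that same_coset_refl zd ad0 by (metis mult_zero_right)
  have "fourier M (\<phi> 0) char_zero \<noteq> 0"
  proof
    assume "fourier M (\<phi> 0) char_zero = 0"
    then have "fourier M (\<phi> j) char_zero = 0" for j by (induction j) (auto intro: step)
    then show False using nonvanishing_at_level[OF zd] by blast
  qed
  have K0: "same_coset 0 \<zeta> char_zero" if "\<zeta> \<in> dual_group" for \<zeta>
    using dual_group_zero[OF that] by (simp add: same_coset_def ker_def char_zero_def)
  have K1: "same_coset (Suc 0) (adjoint_hom A \<zeta>) char_zero" if "\<zeta> \<in> dual_group" for \<zeta>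
    using dual_group_zero[OF that] by (simp add: same_coset_def ker_def char_zero_def adjoint_hom_def)
  obtain \<gamma> where g: "\<And>\<zeta>. \<zeta> \<in> dual_group \<Longrightarrow> fourier M (\<phi> (Suc 0)) (adjoint_hom A \<zeta>) = \<gamma> * fourier M (\<phi> 0) \<zeta>"
    using dilation_coefficient[OF zd, of 0] K0 by blast
  obtain \<mu> where m: "\<And>\<zeta>. \<zeta> \<in> dual_group \<Longrightarrow> same_coset (Suc 0) \<zeta> char_zero \<Longrightarrow>
      fourier M (\<phi> 0) \<zeta> = \<mu> * fourier M (\<phi> (Suc 0)) \<zeta>"
    using refinement_coefficient[OF zd, of 0] by blast
  have mg: "fourier M (\<phi> 0) (adjoint_hom A \<zeta>) = \<mu> * \<gamma> * fourier M (\<phi> 0) \<zeta>" if "\<zeta> \<in> dual_group" for \<zeta>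
    using m[OF adjoint_in_dual[OF that] K1[OF that]] g[OF that] by simp
  have "\<mu> * \<gamma> = 1" using mg[OF zd] ad0 \<open>fourier M (\<phi> 0) char_zero \<noteq> 0\<close> by simp
  then have inv: "fourier M (\<phi> 0) (adjoint_hom A \<zeta>) = fourier M (\<phi> 0) \<zeta>" if "\<zeta> \<in> dual_group" for \<zeta>
    using mg[OF that] by simp
  have const: "fourier M (\<phi> 0) ((adjoint_hom A ^^ n) \<xi>) = fourier M (\<phi> 0) \<xi>" for n
    by (induction n) (simp_all add: inv adjoint_power_in_dual xi)
  let ?e = "norm (fourier M (\<phi> 0) \<xi>)"
  have "range (\<lambda>n. (adjoint_hom A ^^ n) \<xi>) \<subseteq> {\<zeta>\<in>dual_group. norm (fourier M (\<phi> 0) \<zeta>) \<ge> ?e}"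
    using const adjoint_power_in_dual[OF xi(1)] by auto
  moreover have "finite {\<zeta>\<in>dual_group. norm (fourier M (\<phi> 0) \<zeta>) \<ge> ?e}"
    using nz by (intro riemann_lebesgue[OF p phi]) simp
  ultimately have "finite (range (\<lambda>n. (adjoint_hom A ^^ n) \<xi>))" by (rule finite_subset)
  then show False using adjoint_orbit_inj[OF xi] finite_imageD infinite_UNIV_nat by blast
qed

end


section \<open>The coefficient conditions produce a multiresolution analysis\<close>

locale scaling_coefficients = expanding_endomorphism A M
  for A :: "'a::{topological_ab_group_add, second_countable_topology, t2_space} \<Rightarrow> 'a" and M +
  fixes p :: real and \<phi> :: "nat \<Rightarrow> 'a \<Rightarrow> complex"
  assumes p: "1 \<le> p" and phi: "\<phi> j \<in> Lp M p"
    and coset: "\<eta> \<in> dual_group \<Longrightarrow> \<exists>\<xi>\<in>dual_group. same_coset j \<xi> \<eta> \<and> fourier M (\<phi> j) \<xi> \<noteq> 0"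
    and level: "\<eta> \<in> dual_group \<Longrightarrow> \<exists>j. fourier M (\<phi> j) \<eta> \<noteq> 0"
    and refine: "\<eta> \<in> dual_group \<Longrightarrow> \<exists>\<mu>. \<forall>\<xi>\<in>dual_group. same_coset (Suc j) \<xi> \<eta> \<longrightarrow>
      fourier M (\<phi> j) \<xi> = \<mu> * fourier M (\<phi> (Suc j)) \<xi>"
    and dilate: "\<eta> \<in> dual_group \<Longrightarrow> \<exists>\<gamma>. \<gamma> \<noteq> 0 \<and> (\<forall>\<xi>\<in>dual_group. same_coset j \<xi> \<eta> \<longrightarrow>
      fourier M (\<phi> (Suc j)) (adjoint_hom A \<xi>) = \<gamma> * fourier M (\<phi> j) \<xi>)"
begin

text \<open>
  The coefficients of a member are, on each coset of the annihilator of \<open>K j\<close>, a multiple of those of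
  \<open>\<phi> j\<close>. In contrast to the span of the translates of \<open>\<phi> j\<close>, with which the space agrees, this form is
  insensitive to changes on null sets and makes closedness visible.
\<close>

definition mult_space :: "nat \<Rightarrow> ('a \<Rightarrow> complex) set" where
  "mult_space j = {f \<in> Lp M p. \<forall>\<eta>\<in>dual_group. \<exists>m. \<forall>\<xi>\<in>dual_group.
     same_coset j \<xi> \<eta> \<longrightarrow> fourier M f \<xi> = m * fourier M (\<phi> j) \<xi>}"

lemma mult_spaceI:
  assumes "f \<in> Lp M p" "\<And>\<eta>. \<eta> \<in> dual_group \<Longrightarrow> \<exists>m. \<forall>\<xi>\<in>dual_group.
     same_coset j \<xi> \<eta> \<longrightarrow> fourier M f \<xi> = m * fourier M (\<phi> j) \<xi>"
  shows "f \<in> mult_space j"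
  using assms by (simp add: mult_space_def)

lemma mult_space_Lp: "f \<in> mult_space j \<Longrightarrow> f \<in> Lp M p"
  by (simp add: mult_space_def)

lemma mult_spaceE:
  assumes "f \<in> mult_space j" "\<eta> \<in> dual_group"
  obtains m where "\<And>\<xi>. \<xi> \<in> dual_group \<Longrightarrow> same_coset j \<xi> \<eta> \<Longrightarrow> fourier M f \<xi> = m * fourier M (\<phi> j) \<xi>"
  using assms unfolding mult_space_def by blast

lemma mult_space_add:
  assumes f: "f \<in> mult_space j" and g: "g \<in> mult_space j" shows "(\<lambda>x. f x + g x) \<in> mult_space j"
proof (rule mult_spaceI)
  note fL = mult_space_Lp[OF f] and gL = mult_space_Lp[OF g]
  show "(\<lambda>x. f x + g x) \<in> Lp M p" by (rule Lp_add(1)[OF p fL gL])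
  fix \<eta> :: "'a \<Rightarrow> complex" assume eta: "\<eta> \<in> dual_group"
  obtain m where m: "\<And>\<xi>. \<xi> \<in> dual_group \<Longrightarrow> same_coset j \<xi> \<eta> \<Longrightarrow> fourier M f \<xi> = m * fourier M (\<phi> j) \<xi>"
    using mult_spaceE[OF f eta] by blast
  obtain n where n: "\<And>\<xi>. \<xi> \<in> dual_group \<Longrightarrow> same_coset j \<xi> \<eta> \<Longrightarrow> fourier M g \<xi> = n * fourier M (\<phi> j) \<xi>"
    using mult_spaceE[OF g eta] by blast
  show "\<exists>m. \<forall>\<xi>\<in>dual_group. same_coset j \<xi> \<eta> \<longrightarrow> fourier M (\<lambda>x. f x + g x) \<xi> = m * fourier M (\<phi> j) \<xi>"
    by (rule exI[of _ "m + n"])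
       (simp add: fourier_add[OF Lp_integrable[OF p fL] Lp_integrable[OF p gL]] m n distrib_right)
qed

lemma mult_space_scale:
  assumes f: "f \<in> mult_space j" shows "(\<lambda>x. c * f x) \<in> mult_space j"
proof (rule mult_spaceI)
  show "(\<lambda>x. c * f x) \<in> Lp M p" by (rule Lp_scale(1)[OF mult_space_Lp[OF f]])
  fix \<eta> :: "'a \<Rightarrow> complex" assume eta: "\<eta> \<in> dual_group"
  obtain m where m: "\<And>\<xi>. \<xi> \<in> dual_group \<Longrightarrow> same_coset j \<xi> \<eta> \<Longrightarrow> fourier M f \<xi> = m * fourier M (\<phi> j) \<xi>"
    using mult_spaceE[OF f eta] by blast
  show "\<exists>m. \<forall>\<xi>\<in>dual_group. same_coset j \<xi> \<eta> \<longrightarrow> fourier M (\<lambda>x. c * f x) \<xi> = m * fourier M (\<phi> j) \<xi>"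
    by (rule exI[of _ "c * m"]) (simp add: fourier_scale m)
qed

lemma mult_space_translate:
  assumes f: "f \<in> mult_space j" and a: "a \<in> K j" shows "translate a f \<in> mult_space j"
proof (rule mult_spaceI)
  show "translate a f \<in> Lp M p" by (rule translate_Lp(1)[OF mult_space_Lp[OF f]])
  fix \<eta> :: "'a \<Rightarrow> complex" assume eta: "\<eta> \<in> dual_group"
  obtain m where m: "\<And>\<xi>. \<xi> \<in> dual_group \<Longrightarrow> same_coset j \<xi> \<eta> \<Longrightarrow> fourier M f \<xi> = m * fourier M (\<phi> j) \<xi>"
    using mult_spaceE[OF f eta] by blast
  show "\<exists>m. \<forall>\<xi>\<in>dual_group. same_coset j \<xi> \<eta> \<longrightarrow> fourier M (translate a f) \<xi> = m * fourier M (\<phi> j) \<xi>"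
    by (rule exI[of _ "cnj (\<eta> a) * m"])
       (use a in \<open>simp add: fourier_translate[OF LpD(1)[OF mult_space_Lp[OF f]]] m same_coset_def\<close>)
qed

lemma phi_in_mult_space: "\<phi> j \<in> mult_space j"
  by (rule mult_spaceI[OF phi]) (auto intro: exI[of _ 1])

text \<open>
  Membership is a system of equations \<open>f^(\<xi>) \<phi>^(\<xi>0) = f^(\<xi>0) \<phi>^(\<xi>)\<close> between Fourier coefficients,
  each of which is continuous in \<open>f\<close>.
\<close>

lemma mult_space_closed:
  assumes f: "f \<in> Lp_closure M p (mult_space j)" shows "f \<in> mult_space j"
proof (rule mult_spaceI)
  show fL: "f \<in> Lp M p" using f by (simp add: Lp_closure_def)
  fix \<eta> :: "'a \<Rightarrow> complex" assume eta: "\<eta> \<in> dual_group"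
  obtain \<xi>0 where x0: "\<xi>0 \<in> dual_group" "same_coset j \<xi>0 \<eta>" "fourier M (\<phi> j) \<xi>0 \<noteq> 0"
    using coset[OF eta] by blast
  let ?P = "fourier M (\<phi> j)" and ?F = "fourier M f"
  have "?F \<xi> * ?P \<xi>0 - ?F \<xi>0 * ?P \<xi> = 0" if xi: "\<xi> \<in> dual_group" "same_coset j \<xi> \<eta>" for \<xi>
  proof (rule ccontr)
    let ?D = "?F \<xi> * ?P \<xi>0 - ?F \<xi>0 * ?P \<xi>" and ?B = "norm (?P \<xi>0) + norm (?P \<xi>)"
    assume D: "?D \<noteq> 0"
    have B: "?B > 0" using x0(3) by (simp add: add_pos_nonneg)
    define e where "e = norm ?D / (2 * ?B)"
    have e: "e > 0" using D B by (simp add: e_def)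
    then obtain g where g: "g \<in> mult_space j" "Lp_norm M p (\<lambda>x. f x - g x) < e"
      using f by (auto simp: Lp_closure_def)
    have close: "norm (?F \<zeta> - fourier M g \<zeta>) < 2 * e" if "\<zeta> \<in> dual_group" for \<zeta>
      using fourier_close[OF p fL mult_space_Lp[OF g(1)] e _ that] g(2) Lp_norm_less_iff[OF p e] by blast
    obtain m where m: "\<And>\<xi>. \<xi> \<in> dual_group \<Longrightarrow> same_coset j \<xi> \<eta> \<Longrightarrow> fourier M g \<xi> = m * ?P \<xi>"
      using mult_spaceE[OF g(1) eta] by blast
    have "?D = (?F \<xi> - fourier M g \<xi>) * ?P \<xi>0 - (?F \<xi>0 - fourier M g \<xi>0) * ?P \<xi>"
      using m[OF xi] m[OF x0(1,2)] by (simp add: algebra_simps)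
    then have "norm ?D \<le> norm (?F \<xi> - fourier M g \<xi>) * norm (?P \<xi>0) + norm (?F \<xi>0 - fourier M g \<xi>0) * norm (?P \<xi>)"
      by (metis norm_mult norm_triangle_ineq4)
    also have "\<dots> < 2 * e * norm (?P \<xi>0) + 2 * e * norm (?P \<xi>)"
      using close[OF xi(1)] close[OF x0(1)] x0(3)
      by (intro add_less_le_mono mult_strict_right_mono mult_right_mono) auto
    also have "\<dots> = 2 * e * ?B" by (simp add: distrib_left)
    also have "\<dots> = norm ?D" using B by (simp add: e_def del: distrib_left_numeral)
    finally show False by simp
  qed
  then show "\<exists>m. \<forall>\<xi>\<in>dual_group. same_coset j \<xi> \<eta> \<longrightarrow> ?F \<xi> = m * ?P \<xi>"
    using x0(3) by (intro exI[of _ "?F \<xi>0 / ?P \<xi>0"]) (auto simp: field_simps)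
qed

lemma closed_subspace_mult_space: "closed_subspace M p (mult_space j)"
proof -
  have z: "(\<lambda>x. 0) \<in> mult_space j"
    using mult_space_scale[OF phi_in_mult_space[of j], of 0] by simp
  have "f \<in> Lp_closure M p (mult_space j)" if "f \<in> mult_space j" for f
    using that mult_space_Lp[OF that] by (auto simp: Lp_closure_def Lp_norm_def intro!: bexI[of _ f])
  then have "Lp_closure M p (mult_space j) = mult_space j" using mult_space_closed by blast
  then show ?thesis
    unfolding closed_subspace_def
    using z mult_space_Lp mult_space_add mult_space_scale by blast
qed

lemma mult_space_mono_Suc: "mult_space j \<subseteq> mult_space (Suc j)"
proof
  fix f assume f: "f \<in> mult_space j"
  show "f \<in> mult_space (Suc j)"
  proof (rule mult_spaceI[OF mult_space_Lp[OF f]])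
    fix \<eta> :: "'a \<Rightarrow> complex" assume eta: "\<eta> \<in> dual_group"
    obtain m where m: "\<And>\<xi>. \<xi> \<in> dual_group \<Longrightarrow> same_coset j \<xi> \<eta> \<Longrightarrow> fourier M f \<xi> = m * fourier M (\<phi> j) \<xi>"
      using mult_spaceE[OF f eta] by blast
    obtain \<mu> where mu: "\<And>\<xi>. \<xi> \<in> dual_group \<Longrightarrow> same_coset (Suc j) \<xi> \<eta> \<Longrightarrow>
        fourier M (\<phi> j) \<xi> = \<mu> * fourier M (\<phi> (Suc j)) \<xi>"
      using refine[OF eta] by blast
    show "\<exists>m. \<forall>\<xi>\<in>dual_group. same_coset (Suc j) \<xi> \<eta> \<longrightarrow> fourier M f \<xi> = m * fourier M (\<phi> (Suc j)) \<xi>"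
      by (rule exI[of _ "m * \<mu>"]) (use m mu same_coset_mono[of "Suc j" _ \<eta> j] in auto)
  qed
qed

lemma mult_space_mono: "i \<le> j \<Longrightarrow> mult_space i \<subseteq> mult_space j"
  by (rule lift_Suc_mono_le[of mult_space]) (auto intro: mult_space_mono_Suc[THEN subsetD])

subsection \<open>Translates of the scaling functions\<close>

text \<open>
  A product of linear factors \<open>\<xi> x - \<xi> a\<close>, with \<open>\<xi>\<close> separating \<open>a\<close> from \<open>b\<close>.
\<close>

lemma trig_poly_interpolate:
  fixes S :: "'a set"
  assumes "finite S" "b \<notin> S" shows "\<exists>q. trig_poly q \<and> q b \<noteq> 0 \<and> (\<forall>a\<in>S. q a = (0::complex))"
  using assms
proof (induction S rule: finite_induct)
  case empty then show ?case using trig_poly_const[of 1] by (intro exI[of _ "\<lambda>x. 1"]) auto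
next
  case (insert a S)
  then obtain q where q: "trig_poly q" "q b \<noteq> 0" "\<forall>a\<in>S. q a = (0::complex)" by auto
  have "b - a \<noteq> 0" using insert by auto
  then obtain \<xi> where xi: "\<xi> \<in> dual_group" "\<xi> (b - a) \<noteq> 1" using separates by blast
  have ne: "\<xi> b \<noteq> \<xi> a"
    using xi dual_group_mult_cnj[OF xi(1), of a] by (auto simp: dual_group_diff[OF xi(1)])
  have "trig_poly (\<lambda>x. (\<xi> x - \<xi> a) * q x)"
    by (intro trig_poly_mult trig_poly_diff trig_poly.char xi trig_poly_const q)
  then show ?case using q ne by (intro exI[of _ "\<lambda>x. (\<xi> x - \<xi> a) * q x"]) auto
qed

text \<open>
  A nonzero coefficient of \<open>\<phi> j\<close> in each coset shows that \<open>c\<close> is orthogonal to all characters on \<open>K j\<close>, hence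
  to all trigonometric polynomials, among them one that vanishes on \<open>K j\<close> except at \<open>b\<close>.
\<close>

lemma translates_independent:
  assumes c: "AE x in M. (\<Sum>a\<in>K j. c a * translate a (\<phi> j) x) = 0" and b: "b \<in> K j"
  shows "c b = 0"
proof -
  have z: "(\<lambda>x. 0::complex) \<in> borel_measurable M" by simp
  have "(\<Sum>a\<in>K j. c a * cnj (\<eta> a)) = 0" if eta: "\<eta> \<in> dual_group" for \<eta>
  proof -
    obtain \<xi> where xi: "\<xi> \<in> dual_group" "same_coset j \<xi> \<eta>" "fourier M (\<phi> j) \<xi> \<noteq> 0"
      using coset[OF eta] by blast
    have "(\<Sum>a\<in>K j. c a * cnj (\<xi> a)) * fourier M (\<phi> j) \<xi> = 0"
      using fourier_cong_AE[OF c LpD(1)[OF sum_translates_Lp[OF p phi]] z xi(1)]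
      by (simp add: fourier_sum_translates[OF p phi xi(1)] fourier_def[of M "\<lambda>x. 0"])
    then have "(\<Sum>a\<in>K j. c a * cnj (\<xi> a)) = 0" using xi(3) by simp
    moreover have "(\<Sum>a\<in>K j. c a * cnj (\<xi> a)) = (\<Sum>a\<in>K j. c a * cnj (\<eta> a))"
      using xi(2) by (intro sum.cong) (auto simp: same_coset_def)
    ultimately show ?thesis by simp
  qed
  note ortho = this
  have trig: "(\<Sum>a\<in>K j. c a * q a) = 0" if "trig_poly q" for q
    using that
  proof induction
    case (char \<xi>) then show ?case using ortho[OF dual_group_cnj[OF char]] by simp
  next
    case (scale q d)
    have "(\<Sum>a\<in>K j. c a * (d * q a)) = d * (\<Sum>a\<in>K j. c a * q a)" by (simp add: sum_distrib_left mult_ac)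
    then show ?case using scale by simp
  next
    case (add q r) then show ?case by (simp add: distrib_left sum.distrib)
  qed
  obtain q where q: "trig_poly q" "q b \<noteq> 0" "\<forall>a\<in>K j - {b}. q a = (0::complex)"
    using trig_poly_interpolate[of "K j - {b}" b] finite_K by auto
  have "(\<Sum>a\<in>K j. c a * q a) = c b * q b"
    using q(3) b finite_K by (subst sum.remove[of _ b]) auto
  then show ?thesis using trig[OF q(1)] q(2) by simp
qed

text \<open>
  The multipliers of \<open>f\<close> depend only on the restrictions of characters to \<open>K j\<close>, and Fourier
  inversion on this finite group recovers the coordinates of \<open>f\<close>.
\<close>

lemma translates_span:
  assumes f: "f \<in> mult_space j"
  obtains c where "AE x in M. f x = (\<Sum>a\<in>K j. c a * translate a (\<phi> j) x)"
proof -
  note fL = mult_space_Lp[OF f]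
  define res where "res = (\<lambda>\<eta>::'a \<Rightarrow> complex. \<lambda>x. if x \<in> K j then \<eta> x else 0)"
  have "res ` dual_group \<subseteq> subgroup_chars (K j)"
    using dual_groupD(2,3) add_subgroup_add[OF subgroup_K[of j]] by (auto simp: res_def subgroup_chars_def)
  then have fin: "finite (res ` dual_group)"
    using finite_subgroup_chars[OF subgroup_K finite_K] finite_subset by blast
  have res_eq: "res \<xi> = res \<eta> \<longleftrightarrow> same_coset j \<xi> \<eta>" for \<xi> \<eta>
    unfolding res_def same_coset_def fun_eq_iff by metis
  have "\<forall>\<eta>. \<exists>m. \<eta> \<in> dual_group \<longrightarrow> (\<forall>\<xi>\<in>dual_group. same_coset j \<xi> \<eta> \<longrightarrow> fourier M f \<xi> = m * fourier M (\<phi> j) \<xi>)"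
    using f by (auto simp: mult_space_def)
  from choice[OF this] obtain m where m: "\<And>\<eta> \<xi>. \<eta> \<in> dual_group \<Longrightarrow> \<xi> \<in> dual_group \<Longrightarrow>
      same_coset j \<xi> \<eta> \<Longrightarrow> fourier M f \<xi> = m \<eta> * fourier M (\<phi> j) \<xi>" by blast
  define rep where "rep = (\<lambda>r. SOME \<eta>. \<eta> \<in> dual_group \<and> res \<eta> = r)"
  have rep: "rep r \<in> dual_group" "res (rep r) = r" if "r \<in> res ` dual_group" for r
  proof -
    have "\<exists>\<eta>. \<eta> \<in> dual_group \<and> res \<eta> = r" using that by auto
    then have "rep r \<in> dual_group \<and> res (rep r) = r" unfolding rep_def by (rule someI_ex)
    then show "rep r \<in> dual_group" "res (rep r) = r" by auto
  qed
  let ?N = "of_nat (card (K j)) :: complex"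
  have N: "?N \<noteq> 0" using card_K_pos[of j] by simp
  \<comment> \<open>The inverse Fourier transform on \<open>K j\<close> of the multiplier.\<close>
  define c where "c = (\<lambda>a. (\<Sum>r\<in>res ` dual_group. m (rep r) * rep r a) / ?N)"
  have "fourier M f \<xi> = fourier M (\<lambda>x. \<Sum>a\<in>K j. c a * translate a (\<phi> j) x) \<xi>" if xi: "\<xi> \<in> dual_group" for \<xi>
  proof -
    have r: "res \<xi> \<in> res ` dual_group" using xi by blast
    have "(\<Sum>a\<in>K j. c a * cnj (\<xi> a)) = (\<Sum>a\<in>K j. (\<Sum>r\<in>res ` dual_group. m (rep r) * (rep r a * cnj (\<xi> a))) / ?N)"
      by (rule sum.cong) (simp_all add: c_def sum_distrib_right mult.assoc)
    also have "\<dots> = (\<Sum>a\<in>K j. \<Sum>r\<in>res ` dual_group. m (rep r) * (rep r a * cnj (\<xi> a))) / ?N"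
      by (rule sum_divide_distrib[symmetric])
    also have "(\<Sum>a\<in>K j. \<Sum>r\<in>res ` dual_group. m (rep r) * (rep r a * cnj (\<xi> a)))
        = (\<Sum>r\<in>res ` dual_group. m (rep r) * (\<Sum>a\<in>K j. rep r a * cnj (\<xi> a)))"
      unfolding sum_distrib_left by (rule sum.swap)
    also have "\<dots> = (\<Sum>r\<in>res ` dual_group. if r = res \<xi> then m (rep r) * ?N else 0)"
    proof (rule sum.cong[OF refl])
      fix r assume r: "r \<in> res ` dual_group"
      have "same_coset j \<xi> (rep r) \<longleftrightarrow> r = res \<xi>" using res_eq[of \<xi> "rep r"] rep(2)[OF r] by auto
      then show "m (rep r) * (\<Sum>a\<in>K j. rep r a * cnj (\<xi> a)) = (if r = res \<xi> then m (rep r) * ?N else 0)"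
        by (simp add: sum_char_mult_cnj[OF rep(1)[OF r] xi])
    qed
    also have "\<dots> / ?N = m (rep (res \<xi>))" using fin r N by simp
    finally have s: "(\<Sum>a\<in>K j. c a * cnj (\<xi> a)) = m (rep (res \<xi>))" .
    have "same_coset j \<xi> (rep (res \<xi>))" using rep(2)[OF r] res_eq by metis
    then have "fourier M f \<xi> = m (rep (res \<xi>)) * fourier M (\<phi> j) \<xi>" using m[OF rep(1)[OF r] xi] by simp
    then show ?thesis by (simp add: fourier_sum_translates[OF p phi xi] s)
  qed
  then have "AE x in M. f x = (\<Sum>a\<in>K j. c a * translate a (\<phi> j) x)"
    by (rule fourier_inj[OF p fL sum_translates_Lp[OF p phi]])
  then show ?thesis by (rule that)
qed

lemma translates_basis: "is_basis M (K j) (\<lambda>a. translate a (\<phi> j)) (mult_space j)"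
  unfolding is_basis_def
proof (intro conjI ballI allI impI)
  fix f assume "f \<in> mult_space j"
  then show "\<exists>c. AE x in M. f x = (\<Sum>a\<in>K j. c a * translate a (\<phi> j) x)"
    by (rule translates_span) (rule exI)
qed (rule mult_space_translate[OF phi_in_mult_space] translates_independent; assumption)+

subsection \<open>Dilation and periodization\<close>

text \<open>
  The spectrum of a dilate consists of characters \<open>\<xi> \<circ> A\<close>. A coset of the annihilator of \<open>K (Suc j)\<close> either
  contains none of them, or it is the image under the adjoint of a coset of the annihilator of \<open>K j\<close>,
  because \<open>A\<close> maps \<open>K (Suc j)\<close> onto \<open>K j\<close>.
\<close>

lemma mult_space_dilate:
  assumes f: "f \<in> mult_space j" shows "(\<lambda>x. f (A x)) \<in> mult_space (Suc j)"
proof (rule mult_spaceI)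
  note fL = mult_space_Lp[OF f]
  show "(\<lambda>x. f (A x)) \<in> Lp M p" by (rule comp_A_Lp[OF fL])
  fix \<eta> :: "'a \<Rightarrow> complex" assume eta: "\<eta> \<in> dual_group"
  show "\<exists>m. \<forall>\<xi>\<in>dual_group. same_coset (Suc j) \<xi> \<eta> \<longrightarrow>
      fourier M (\<lambda>x. f (A x)) \<xi> = m * fourier M (\<phi> (Suc j)) \<xi>"
  proof (cases "\<forall>k\<in>ker A. \<eta> k = 1")
    case True
    then obtain \<zeta> where z: "\<zeta> \<in> dual_group" "adjoint_hom A \<zeta> = \<eta>" using char_factor[OF eta] by blast
    obtain m where m: "\<And>\<xi>. \<xi> \<in> dual_group \<Longrightarrow> same_coset j \<xi> \<zeta> \<Longrightarrow> fourier M f \<xi> = m * fourier M (\<phi> j) \<xi>"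
      using mult_spaceE[OF f z(1)] by blast
    obtain \<gamma> where g: "\<gamma> \<noteq> 0" "\<And>\<xi>. \<xi> \<in> dual_group \<Longrightarrow> same_coset j \<xi> \<zeta> \<Longrightarrow>
        fourier M (\<phi> (Suc j)) (adjoint_hom A \<xi>) = \<gamma> * fourier M (\<phi> j) \<xi>" using dilate[OF z(1)] by blast
    have "fourier M (\<lambda>x. f (A x)) \<xi> = m / \<gamma> * fourier M (\<phi> (Suc j)) \<xi>"
      if xi: "\<xi> \<in> dual_group" "same_coset (Suc j) \<xi> \<eta>" for \<xi>
    proof -
      have "\<xi> k = 1" if "k \<in> ker A" for k
        using that True xi(2) ker_subset_K_Suc[of j] by (auto simp: same_coset_def)
      then obtain \<theta> where t: "\<theta> \<in> dual_group" "adjoint_hom A \<theta> = \<xi>" using char_factor[OF xi(1)] by blast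
      have "\<theta> a = \<zeta> a" if a: "a \<in> K j" for a
      proof -
        obtain b where b: "A b = a" using surj_A by (metis surjD)
        then have "\<xi> b = \<eta> b" using K_lift[OF a b] xi(2) by (simp add: same_coset_def)
        then show ?thesis using b t(2) z(2) by (auto simp: adjoint_hom_def)
      qed
      then have "same_coset j \<theta> \<zeta>" by (simp add: same_coset_def)
      then show ?thesis
        using m[OF t(1)] g(2)[OF t(1)] g(1) fourier_comp_A_adjoint[OF LpD(1)[OF fL] t(1)] t(2) by simp
    qed
    then show ?thesis by blast
  next
    case False
    then obtain k where k: "k \<in> ker A" "\<eta> k \<noteq> 1" by blast
    have "fourier M (\<lambda>x. f (A x)) \<xi> = 0" if xi: "\<xi> \<in> dual_group" "same_coset (Suc j) \<xi> \<eta>" for \<xi>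
    proof (rule fourier_comp_A_zero[OF LpD(1)[OF fL] xi(1) k(1)])
      show "\<xi> k \<noteq> 1" using k xi(2) ker_subset_K_Suc[of j] by (auto simp: same_coset_def)
    qed
    then show ?thesis by (intro exI[of _ 0]) simp
  qed
qed

text \<open>
  Periodization restricts coefficients to the image of the adjoint, which maps cosets at level \<open>j\<close> into
  cosets at level \<open>Suc j\<close>.
\<close>

lemma mult_space_periodize:
  assumes f: "f \<in> mult_space (Suc j)" shows "periodization A f \<in> mult_space j"
proof (rule mult_spaceI)
  note fL = mult_space_Lp[OF f]
  show "periodization A f \<in> Lp M p" by (rule periodization_Lp[OF p fL])
  fix \<eta> :: "'a \<Rightarrow> complex" assume eta: "\<eta> \<in> dual_group"
  obtain m where m: "\<And>\<xi>. \<xi> \<in> dual_group \<Longrightarrow> same_coset (Suc j) \<xi> (adjoint_hom A \<eta>) \<Longrightarrow>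
      fourier M f \<xi> = m * fourier M (\<phi> (Suc j)) \<xi>"
    using mult_spaceE[OF f adjoint_in_dual[OF eta]] by blast
  obtain \<gamma> where g: "\<And>\<xi>. \<xi> \<in> dual_group \<Longrightarrow> same_coset j \<xi> \<eta> \<Longrightarrow>
      fourier M (\<phi> (Suc j)) (adjoint_hom A \<xi>) = \<gamma> * fourier M (\<phi> j) \<xi>" using dilate[OF eta] by blast
  have "fourier M (periodization A f) \<xi> = of_nat (card (ker A)) * m * \<gamma> * fourier M (\<phi> j) \<xi>"
    if xi: "\<xi> \<in> dual_group" "same_coset j \<xi> \<eta>" for \<xi>
  proof -
    have "same_coset (Suc j) (adjoint_hom A \<xi>) (adjoint_hom A \<eta>)"
      using xi(2) A_in_K by (auto simp: same_coset_def adjoint_hom_def)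
    then show ?thesis
      using m[OF adjoint_in_dual[OF xi(1)]] g[OF xi] by (simp add: fourier_periodization[OF p fL xi(1)])
  qed
  then show "\<exists>m. \<forall>\<xi>\<in>dual_group. same_coset j \<xi> \<eta> \<longrightarrow> fourier M (periodization A f) \<xi> = m * fourier M (\<phi> j) \<xi>"
    by blast
qed

subsection \<open>Density\<close>

abbreviation limit_space :: "('a \<Rightarrow> complex) set" where
  "limit_space \<equiv> Lp_limits M p (\<Union>j. mult_space j)"

lemma union_subset_Lp: "(\<Union>j. mult_space j) \<subseteq> Lp M p"
  using mult_space_Lp by blast

lemma limit_space_scale: "f \<in> limit_space \<Longrightarrow> (\<lambda>x. c * f x) \<in> limit_space"
  by (rule Lp_limits_scale[OF p union_subset_Lp]) (auto intro: mult_space_scale)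

lemma limit_space_add:
  assumes "f \<in> limit_space" "g \<in> limit_space" shows "(\<lambda>x. f x + g x) \<in> limit_space"
proof (rule Lp_limits_add[OF p union_subset_Lp _ assms])
  fix u v assume "u \<in> (\<Union>j. mult_space j)" "v \<in> (\<Union>j. mult_space j)"
  then obtain i j where "u \<in> mult_space i" "v \<in> mult_space j" by blast
  then have "u \<in> mult_space (max i j)" "v \<in> mult_space (max i j)"
    using mult_space_mono[of i "max i j"] mult_space_mono[of j "max i j"] by auto
  then show "(\<lambda>x. u x + v x) \<in> (\<Union>j. mult_space j)" using mult_space_add by blast
qed

text \<open>
  A character \<open>\<eta>\<close> is, up to a factor, the limit of the averages over \<open>K k\<close> of \<open>\<phi> j\<close> against \<open>\<eta>\<close>, for
  any \<open>j\<close> such that \<open>\<phi> j\<close> has a nonzero coefficient at \<open>\<eta>\<close>; for \<open>k \<ge> j\<close> these averages belong to the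
  \<open>k\<close>-th space.
\<close>

lemma char_in_limit_space:
  assumes eta: "\<eta> \<in> dual_group" shows "\<eta> \<in> limit_space"
proof -
  obtain j where j: "fourier M (\<phi> j) \<eta> \<noteq> 0" using level[OF eta] by blast
  let ?c = "fourier M (\<phi> j) \<eta>"
  have avg: "char_average k \<eta> (\<phi> j) \<in> mult_space k" if "j \<le> k" for k
    unfolding char_average_def
  proof -
    have jk: "\<phi> j \<in> mult_space k" using phi_in_mult_space mult_space_mono[OF that] by blast
    have "(\<lambda>x. \<Sum>a\<in>S. c a * translate a (\<phi> j) x) \<in> mult_space k" if "finite S" "S \<subseteq> K k" for S and c :: "'a \<Rightarrow> complex"
      using that
    proof (induction S rule: finite_induct)
      case empty then show ?case using mult_space_scale[OF jk, of 0] by simp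
    next
      case (insert a S)
      then show ?case
        using mult_space_add[OF mult_space_scale[OF mult_space_translate[OF jk]]] by simp
    qed
    from this[OF finite_K subset_refl]
    show "(\<lambda>x. \<Sum>a\<in>K k. \<eta> a / of_nat (card (K k)) * translate a (\<phi> j) x) \<in> mult_space k" .
  qed
  have "(\<lambda>x. ?c * \<eta> x) \<in> limit_space"
    unfolding Lp_limits_def
  proof (intro CollectI conjI allI impI)
    show "(\<lambda>x. ?c * \<eta> x) \<in> Lp M p" by (rule Lp_scale(1)[OF char_Lp[OF eta p]])
    fix e :: real assume "e > 0"
    then have "\<forall>\<^sub>F k in sequentially. Lp_power M p (\<lambda>x. char_average k \<eta> (\<phi> j) x - ?c * \<eta> x) < e \<and> j \<le> k"
      by (intro eventually_conj char_average_tendsto[OF p phi eta] eventually_ge_at_top)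
    then obtain k where "Lp_power M p (\<lambda>x. char_average k \<eta> (\<phi> j) x - ?c * \<eta> x) < e" "j \<le> k"
      by (auto simp: eventually_sequentially)
    then show "\<exists>g\<in>\<Union>j. mult_space j. Lp_power M p (\<lambda>x. ?c * \<eta> x - g x) < e"
      by (intro bexI[of _ "char_average k \<eta> (\<phi> j)"] UN_I[of k] UNIV_I avg)
         (simp add: Lp_power_minus_commute[of M p "\<lambda>x. ?c * \<eta> x"])
  qed
  from limit_space_scale[OF this, of "1 / ?c"] show ?thesis using j by simp
qed

lemma trig_poly_in_limit_space: "trig_poly q \<Longrightarrow> q \<in> limit_space"
  by (induction rule: trig_poly.induct) (auto intro: char_in_limit_space limit_space_scale limit_space_add)

lemma mult_space_dense: "Lp_closure M p (\<Union>j. mult_space j) = Lp M p"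
proof -
  have "f \<in> limit_space" if f: "f \<in> Lp M p" for f
  proof (rule Lp_limits_closed[OF p union_subset_Lp f])
    fix e :: real assume "e > 0"
    then obtain q where "trig_poly q" "Lp_power M p (\<lambda>x. f x - q x) < e"
      using compact_group_measure.trig_poly_dense[OF compact_group_measure[OF p] f] by metis
    then show "\<exists>g\<in>limit_space. Lp_power M p (\<lambda>x. f x - g x) < e"
      using trig_poly_in_limit_space by blast
  qed
  then show ?thesis unfolding Lp_closure_eq_limits[OF p] by (auto simp: Lp_limits_def)
qed

lemma mult_space_translate_iff:
  assumes a: "a \<in> K j" and f: "f \<in> Lp M p" shows "f \<in> mult_space j \<longleftrightarrow> translate a f \<in> mult_space j"
proof
  assume "translate a f \<in> mult_space j"
  then have "translate (- a) (translate a f) \<in> mult_space j"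
    by (rule mult_space_translate) (rule add_subgroup_uminus[OF subgroup_K a])
  then show "f \<in> mult_space j" by (simp add: translate_def)
qed (rule mult_space_translate[OF _ a])

theorem mult_space_MRA: "MRA M p A mult_space" "scaling_sequence M A mult_space \<phi>"
proof -
  show "MRA M p A mult_space"
    unfolding MRA_def Suc_eq_plus1[symmetric]
  proof (intro conjI allI ballI)
    show "\<exists>\<psi>\<in>mult_space j. is_basis M (K j) (\<lambda>a. translate a \<psi>) (mult_space j)" for j
      using phi_in_mult_space translates_basis by blast
  qed (use closed_subspace_mult_space mult_space_mono_Suc mult_space_dense mult_space_translate_iff
      mult_space_dilate mult_space_periodize in simp_all)
  show "scaling_sequence M A mult_space \<phi>"
    unfolding scaling_sequence_def using phi_in_mult_space translates_basis by blast
qed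

end


section \<open>The characterization\<close>

theorem theorem3p3:
  fixes A :: "'a::{topological_ab_group_add, second_countable_topology, t2_space} \<Rightarrow> 'a"
    and M :: "'a measure"
    and p :: real
    and \<phi> :: "nat \<Rightarrow> 'a \<Rightarrow> complex"
  assumes "compact (UNIV :: 'a set)"
    and "normalized_haar M"
    and "continuous_on UNIV A"
    and "surj A"
    and "group_hom_add A"
    and "finite (ker A)"
    and "closure (\<Union>j::nat. ker (A ^^ j)) = UNIV"
    and "1 \<le> p"
    and "\<And>j. \<phi> j \<in> Lp M p"
  shows "(\<exists>V. MRA M p A V \<and> scaling_sequence M A V \<phi>) \<longleftrightarrow>
    (\<forall>\<xi>\<in>dual_group. \<xi> \<noteq> char_zero \<longrightarrow> fourier M (\<phi> 0) \<xi> = 0) \<and>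
    (\<forall>j. \<forall>\<eta>\<in>dual_group. \<exists>\<xi>\<in>char_coset (annihilator (ker (A ^^ j))) \<eta>. fourier M (\<phi> j) \<xi> \<noteq> 0) \<and>
    (\<forall>\<xi>\<in>dual_group. \<exists>j. fourier M (\<phi> j) \<xi> \<noteq> 0) \<and>
    (\<forall>j\<ge>1. \<forall>\<eta>\<in>dual_group. \<exists>\<mu>::complex. \<forall>\<xi>\<in>char_coset (annihilator (ker (A ^^ j))) \<eta>.
       fourier M (\<phi> (j - 1)) \<xi> = \<mu> * fourier M (\<phi> j) \<xi>) \<and>
    (\<forall>j. \<forall>\<eta>\<in>dual_group. \<exists>\<gamma>::complex. \<gamma> \<noteq> 0 \<and>
       (\<forall>\<xi>\<in>char_coset (annihilator (ker (A ^^ j))) \<eta>.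
          fourier M (\<phi> (j + 1)) (adjoint_hom A \<xi>) = \<gamma> * fourier M (\<phi> j) \<xi>))"
    (is "?mra \<longleftrightarrow> ?c1 \<and> ?c2 \<and> ?c3 \<and> ?c4 \<and> ?c5")
proof -
  interpret expanding_endomorphism A M by unfold_locales (fact assms)+
  have c2: "?c2 \<longleftrightarrow> (\<forall>j. \<forall>\<eta>\<in>dual_group. \<exists>\<xi>\<in>dual_group. same_coset j \<xi> \<eta> \<and> fourier M (\<phi> j) \<xi> \<noteq> 0)"
    by (simp add: Bex_def mem_char_coset_iff conj_assoc cong: conj_cong)
  have c4: "?c4 \<longleftrightarrow> (\<forall>j. \<forall>\<eta>\<in>dual_group. \<exists>\<mu>. \<forall>\<xi>\<in>dual_group. same_coset (Suc j) \<xi> \<eta> \<longrightarrow>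
      fourier M (\<phi> j) \<xi> = \<mu> * fourier M (\<phi> (Suc j)) \<xi>)"
  proof -
    have "?c4 \<longleftrightarrow> (\<forall>j. \<forall>\<eta>\<in>dual_group. \<exists>\<mu>. \<forall>\<xi>\<in>char_coset (annihilator (K (Suc j))) \<eta>.
       fourier M (\<phi> j) \<xi> = \<mu> * fourier M (\<phi> (Suc j)) \<xi>)" (is "_ \<longleftrightarrow> (\<forall>j. ?Q j)")
    proof
      assume *: ?c4
      show "\<forall>j. ?Q j"
      proof
        fix j show "?Q j" using spec[OF *, of "Suc j"] by simp
      qed
    next
      assume *: "\<forall>j. ?Q j"
      show ?c4
      proof (intro allI impI)
        fix j :: nat assume "j \<ge> 1"
        then obtain i where "j = Suc i" by (cases j) auto
        then show "\<forall>\<eta>\<in>dual_group. \<exists>\<mu>. \<forall>\<xi>\<in>char_coset (annihilator (K j)) \<eta>.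
            fourier M (\<phi> (j - 1)) \<xi> = \<mu> * fourier M (\<phi> j) \<xi>" using spec[OF *, of i] by simp
      qed
    qed
    also have "\<dots> \<longleftrightarrow> (\<forall>j. \<forall>\<eta>\<in>dual_group. \<exists>\<mu>. \<forall>\<xi>\<in>dual_group. same_coset (Suc j) \<xi> \<eta> \<longrightarrow>
      fourier M (\<phi> j) \<xi> = \<mu> * fourier M (\<phi> (Suc j)) \<xi>)"
      by (simp add: Ball_def mem_char_coset_iff imp_conjL del: funpow.simps cong: imp_cong)
    finally show ?thesis .
  qed
  have c5: "?c5 \<longleftrightarrow> (\<forall>j. \<forall>\<eta>\<in>dual_group. \<exists>\<gamma>. \<gamma> \<noteq> 0 \<and> (\<forall>\<xi>\<in>dual_group. same_coset j \<xi> \<eta> \<longrightarrow>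
      fourier M (\<phi> (Suc j)) (adjoint_hom A \<xi>) = \<gamma> * fourier M (\<phi> j) \<xi>))"
    by (simp add: Ball_def mem_char_coset_iff imp_conjL cong: imp_cong)
  show ?thesis
  proof
    assume ?mra
    then obtain V where V: "MRA M p A V" "scaling_sequence M A V \<phi>" by blast
    interpret scaling_mra A M p \<phi> V by unfold_locales (fact assms V)+
    show "?c1 \<and> ?c2 \<and> ?c3 \<and> ?c4 \<and> ?c5"
      unfolding c2 c4 c5
      using level_zero_constant nonvanishing_on_coset nonvanishing_at_level refinement_coefficient
        dilation_coefficient by blast
  next
    assume "?c1 \<and> ?c2 \<and> ?c3 \<and> ?c4 \<and> ?c5"
    then have c: ?c2 ?c3 ?c4 ?c5 by blast+
    interpret scaling_coefficients A M p \<phi>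
      by unfold_locales (use assms c[unfolded c2 c4 c5] in blast)+
    show ?mra using mult_space_MRA by blast
  qed
qed

end
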